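(* Let $\mathcal A$ be a unital operator algebra and $\mathfrak A$ a C$^*$-cover of $\mathcal A$ such that $\mathcal A$ is Dirichlet in $\mathfrak A$. Suppose that $\mathcal A$ contains an abelian $*$-subalgebra $\mathfrak M$ which, under the embedding $\mathcal A\subset\mathfrak A$, is a Cartan subalgebra of $\mathfrak A$. Let $X=\widehat{\mathfrak M}$, let $E:\mathfrak A\to\mathfrak M=C(X)$ be the faithful conditional expectation, and let $Y\subset X$ be the set of points with trivial isotropy. For $y\in Y$ let $\rho_y$ be the pure state $\rho_y(a)=E(a)(y)$ of $\mathfrak A$ and $\pi_y$ the corresponding (irreducible) GNS representation of $\mathfrak A$. Then $\mathcal A$ has sufficiently many nest representations; that is, for every $y\in Y$ the restriction of $\pi_y$ to $\mathcal A$ is a nest representation of $\mathcal A$, and $$\|a\|=\sup_{y\in Y}\|\pi_y(a)\|\qquad\text{for all } a\in\mathcal A.$$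
   Context: A C$^*$-cover of an operator algebra $\mathcal A$ is a C$^*$-algebra $\mathfrak A$ together with a completely isometric (homomorphic) embedding $j:\mathcal A\to\mathfrak A$; one writes $\mathcal A\subset\mathfrak A$. $\mathcal A$ is Dirichlet in $\mathfrak A$ if $\mathcal A+\mathcal A^*$ is norm-dense in $\mathfrak A$. A representation of $\mathcal A$ is a completely contractive homomorphism $\pi:\mathcal A\to\mathcal B(H)$; it is a nest representation if the lattice of invariant subspaces of $\pi(\mathcal A)$ is totally ordered by inclusion. Cartan pairs: all C$^*$-algebras here are unital. $(\mathfrak A,\mathfrak M)$ is a Cartan pair ($\mathfrak M$ is a Cartan subalgebra of $\mathfrak A$) if $\mathfrak A$ is a separable C$^*$-algebra, $\mathfrak M$ is a maximal abelian C$^*$-subalgebra of $\mathfrak A$ (containing the unit), $\mathfrak M$ is regular, i.e. the set $\mathcal N$ of normalizers generates $\mathfrak A$ as a C$^*$-algebra, and there is a faithful conditional expectation $E:\mathfrak A\to\mathfrak M$ (it is unique). A normalizer is an element $0\ne n\in\mathfrak A$ with $n^*\mathfrak M n\subset\mathfrak M$ and $n\mathfrak M n^*\subset\mathfrak M$. With $X=\widehat{\mathfrak M}$ the Gelfand space, $\mathfrak M$ is identified with $C(X)$. For $n\in\mathcal N$, $\alpha_n$ denotes the homeomorphism from the open set $\mathrm{dom}(\alpha_n)=\{x\in X: n^*n(x)>0\}$ onto $\{x\in X: nn^*(x)>0\}$ determined by $(n^*hn)(x)=h(\alpha_n(x))\,n^*n(x)$ for $h\in C(X)$. A point $x\in X$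 has non-trivial isotropy if there is $n\in\mathcal N$ with $x\in\mathrm{dom}(\alpha_n)$, $\alpha_n(x)=x$ and $E(n)(x)=0$ (equivalently, $\alpha_n(x)=x$ but $\alpha_n$ is not the identity on any neighborhood of $x$); otherwise $x$ has trivial isotropy. *)

theory Defs
  imports "HOL-Analysis.Analysis"
begin

subsection \<open>Unital C*-algebras\<close>

text \<open>A unital C*-algebra is a type; its subalgebras are sets. The zero algebra is excluded,
  since \<open>norm 1 = 1\<close> is part of \<^class>\<open>real_normed_algebra_1\<close>.\<close>

class unital_cstar_algebra = real_normed_algebra_1 + banach +
  fixes scaleC :: "complex \<Rightarrow> 'a \<Rightarrow> 'a"  (infixr "*\<^sub>C" 75)
    and star :: "'a \<Rightarrow> 'a"
  assumes scaleC_add_right: "c *\<^sub>C (x + y) = c *\<^sub>C x + c *\<^sub>C y"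
    and scaleC_add_left: "(c + d) *\<^sub>C x = c *\<^sub>C x + d *\<^sub>C x"
    and scaleC_scaleC: "c *\<^sub>C (d *\<^sub>C x) = (c * d) *\<^sub>C x"
    and scaleR_scaleC: "scaleR r x = complex_of_real r *\<^sub>C x"
    and mult_scaleC_left: "(c *\<^sub>C x) * y = c *\<^sub>C (x * y)"
    and mult_scaleC_right: "x * (c *\<^sub>C y) = c *\<^sub>C (x * y)"
    and norm_scaleC: "norm (c *\<^sub>C x) = cmod c * norm x"
    and star_star: "star (star x) = x"
    and star_add: "star (x + y) = star x + star y"
    and star_scaleC: "star (c *\<^sub>C x) = cnj c *\<^sub>C star x"
    and star_mult: "star (x * y) = star y * star x"
    and cstar_identity: "norm (star x * x) = (norm x)\<^sup>2"

instantiation complex :: unital_cstar_algebra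
begin
definition scaleC_complex :: "complex \<Rightarrow> complex \<Rightarrow> complex"
  where "scaleC_complex c z = c * z"
definition star_complex :: "complex \<Rightarrow> complex"
  where "star_complex z = cnj z"
instance
  by standard
    (simp_all add: scaleC_complex_def star_complex_def algebra_simps scaleR_conv_of_real
      norm_mult power2_eq_square)
end

definition positive :: "'a::unital_cstar_algebra \<Rightarrow> bool"
  where "positive x \<longleftrightarrow> (\<exists>b. x = star b * b)"

definition linear_on ::
    "'a::unital_cstar_algebra set \<Rightarrow> ('a \<Rightarrow> 'b::unital_cstar_algebra) \<Rightarrow> bool"
  where "linear_on A f \<longleftrightarrow>
    (\<forall>a\<in>A. \<forall>b\<in>A. f (a + b) = f a + f b) \<and> (\<forall>c. \<forall>a\<in>A. f (c *\<^sub>C a) = c *\<^sub>C f a)"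

definition homomorphism_on ::
    "'a::unital_cstar_algebra set \<Rightarrow> ('a \<Rightarrow> 'b::unital_cstar_algebra) \<Rightarrow> bool"
  where "homomorphism_on A f \<longleftrightarrow> linear_on A f \<and> (\<forall>a\<in>A. \<forall>b\<in>A. f (a * b) = f a * f b)"

definition subalgebra :: "'a::unital_cstar_algebra set \<Rightarrow> bool"
  where "subalgebra A \<longleftrightarrow> 0 \<in> A \<and> (\<forall>a\<in>A. \<forall>b\<in>A. a + b \<in> A) \<and>
    (\<forall>c. \<forall>a\<in>A. c *\<^sub>C a \<in> A) \<and> (\<forall>a\<in>A. \<forall>b\<in>A. a * b \<in> A)"

definition star_subalgebra :: "'a::unital_cstar_algebra set \<Rightarrow> bool"
  where "star_subalgebra A \<longleftrightarrow> subalgebra A \<and> (\<forall>a\<in>A. star a \<in> A)"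

definition cstar_subalgebra :: "'a::unital_cstar_algebra set \<Rightarrow> bool"
  where "cstar_subalgebra A \<longleftrightarrow> star_subalgebra A \<and> closed A"

definition abelian :: "'a::unital_cstar_algebra set \<Rightarrow> bool"
  where "abelian A \<longleftrightarrow> (\<forall>a\<in>A. \<forall>b\<in>A. a * b = b * a)"

definition cstar_generated :: "'a::unital_cstar_algebra set \<Rightarrow> 'a set"
  where "cstar_generated S = \<Inter>{B. cstar_subalgebra B \<and> S \<subseteq> B}"


subsection \<open>Operator algebras and C*-covers\<close>

text \<open>The C*-norm on the \<open>n \<times> n\<close> matrices over a C*-algebra \<open>\<AA>\<close> is the operator norm of the
  matrix acting by left multiplication on the Hilbert \<open>\<AA>\<close>-module \<open>\<AA>\<^sup>n\<close>, whose norm is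
  \<open>\<parallel>\<Sum>\<^sub>i x\<^sub>i\<^sup>* x\<^sub>i\<parallel>\<^sup>1\<^sup>/\<^sup>2\<close>. Matrices and columns are functions, of which only the
  values at indices below \<open>n\<close> matter.\<close>

definition column_norm :: "nat \<Rightarrow> (nat \<Rightarrow> 'a::unital_cstar_algebra) \<Rightarrow> real"
  where "column_norm n x = sqrt (norm (\<Sum>i<n. star (x i) * x i))"

definition matrix_norm :: "nat \<Rightarrow> (nat \<Rightarrow> nat \<Rightarrow> 'a::unital_cstar_algebra) \<Rightarrow> real"
  where "matrix_norm n a =
    Sup {column_norm n (\<lambda>i. \<Sum>k<n. a i k * x k) | x. column_norm n x \<le> 1}"

text \<open>By the Gelfand-Naimark theorem, subalgebras of C*-algebras are the same as algebras of
  operators on Hilbert space; the matrix norms are those of the ambient C*-algebra.\<close>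

definition unital_operator_algebra :: "'a::unital_cstar_algebra set \<Rightarrow> bool"
  where "unital_operator_algebra A \<longleftrightarrow> subalgebra A \<and> closed A \<and> 1 \<in> A"

definition completely_isometric_on ::
    "'a::unital_cstar_algebra set \<Rightarrow> ('a \<Rightarrow> 'b::unital_cstar_algebra) \<Rightarrow> bool"
  where "completely_isometric_on A f \<longleftrightarrow>
    (\<forall>n a. (\<forall>i<n. \<forall>k<n. a i k \<in> A) \<longrightarrow> matrix_norm n (\<lambda>i k. f (a i k)) = matrix_norm n a)"

definition cstar_cover ::
    "'a::unital_cstar_algebra set \<Rightarrow> ('a \<Rightarrow> 'b::unital_cstar_algebra) \<Rightarrow> bool"
  where "cstar_cover A j \<longleftrightarrow> homomorphism_on A j \<and> completely_isometric_on A j"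

definition dirichlet :: "'a::unital_cstar_algebra set \<Rightarrow> bool"
  where "dirichlet A \<longleftrightarrow> closure {a + star b | a b. a \<in> A \<and> b \<in> A} = UNIV"


subsection \<open>Cartan pairs\<close>

definition conditional_expectation ::
    "'a::unital_cstar_algebra set \<Rightarrow> ('a \<Rightarrow> 'a) \<Rightarrow> bool"
  where "conditional_expectation M E \<longleftrightarrow>
    linear_on UNIV E \<and> (\<forall>a. E a \<in> M) \<and> (\<forall>m\<in>M. E m = m) \<and>
    (\<forall>a. norm (E a) \<le> norm a) \<and> (\<forall>a. positive (E (star a * a))) \<and>
    (\<forall>a. \<forall>m\<in>M. E (m * a) = m * E a \<and> E (a * m) = E a * m)"

definition faithful_conditional_expectation ::
    "'a::unital_cstar_algebra set \<Rightarrow> ('a \<Rightarrow> 'a) \<Rightarrow> bool"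
  where "faithful_conditional_expectation M E \<longleftrightarrow>
    conditional_expectation M E \<and> (\<forall>a. E (star a * a) = 0 \<longrightarrow> a = 0)"

definition normalizers :: "'a::unital_cstar_algebra set \<Rightarrow> 'a set"
  where "normalizers M =
    {n. n \<noteq> 0 \<and> (\<forall>m\<in>M. star n * m * n \<in> M) \<and> (\<forall>m\<in>M. n * m * star n \<in> M)}"

definition maximal_abelian :: "'a::unital_cstar_algebra set \<Rightarrow> bool"
  where "maximal_abelian M \<longleftrightarrow> cstar_subalgebra M \<and> abelian M \<and>
    (\<forall>B. cstar_subalgebra B \<and> abelian B \<and> M \<subseteq> B \<longrightarrow> B = M)"

definition cartan_subalgebra :: "'a::unital_cstar_algebra set \<Rightarrow> bool"
  where "cartan_subalgebra M \<longleftrightarrow>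
    (\<exists>D::'a set. countable D \<and> closure D = UNIV) \<and>
    maximal_abelian M \<and> 1 \<in> M \<and>
    cstar_generated (normalizers M) = UNIV \<and>
    (\<exists>E. faithful_conditional_expectation M E)"

text \<open>The points of the Gelfand space of \<open>M\<close> are its characters, as functions that are
  \<open>undefined\<close> outside \<open>M\<close>. For a character \<open>x\<close> and \<open>h \<in> M\<close>, the value
  of \<open>h\<close>, viewed as a function on the Gelfand space, at the point \<open>x\<close> is \<open>x h\<close>.\<close>

definition gelfand_space :: "'a::unital_cstar_algebra set \<Rightarrow> ('a \<Rightarrow> complex) set"
  where "gelfand_space M =
    {x. x \<in> extensional M \<and> homomorphism_on M x \<and> (\<exists>h\<in>M. x h \<noteq> 0)}"

definition normalizer_dom ::
    "'a::unital_cstar_algebra set \<Rightarrow> 'a \<Rightarrow> ('a \<Rightarrow> complex) set"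
  where "normalizer_dom M n = {x \<in> gelfand_space M. Re (x (star n * n)) > 0}"

definition normalizer_map ::
    "'a::unital_cstar_algebra set \<Rightarrow> 'a \<Rightarrow> ('a \<Rightarrow> complex) \<Rightarrow> ('a \<Rightarrow> complex)"
  where "normalizer_map M n x =
    (THE z. z \<in> gelfand_space M \<and> (\<forall>h\<in>M. x (star n * h * n) = z h * x (star n * n)))"

definition nontrivial_isotropy ::
    "'a::unital_cstar_algebra set \<Rightarrow> ('a \<Rightarrow> 'a) \<Rightarrow> ('a \<Rightarrow> complex) \<Rightarrow> bool"
  where "nontrivial_isotropy M E x \<longleftrightarrow>
    (\<exists>n\<in>normalizers M. x \<in> normalizer_dom M n \<and> normalizer_map M n x = x \<and> x (E n) = 0)"

definition trivial_isotropy_points ::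
    "'a::unital_cstar_algebra set \<Rightarrow> ('a \<Rightarrow> 'a) \<Rightarrow> ('a \<Rightarrow> complex) set"
  where "trivial_isotropy_points M E = {x \<in> gelfand_space M. \<not> nontrivial_isotropy M E x}"


subsection \<open>Hilbert spaces and representations\<close>

text \<open>Hilbert spaces are carrier-based, since the space of a GNS representation depends on the
  state. Inner products are linear in the first argument.\<close>

record 'h inner_space =
  hcarrier :: "'h set"
  hzero :: 'h
  hadd :: "'h \<Rightarrow> 'h \<Rightarrow> 'h"
  hscale :: "complex \<Rightarrow> 'h \<Rightarrow> 'h"
  hinner :: "'h \<Rightarrow> 'h \<Rightarrow> complex"

definition hnorm :: "('h, 'z) inner_space_scheme \<Rightarrow> 'h \<Rightarrow> real"
  where "hnorm H u = sqrt (Re (hinner H u u))"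

definition hdist :: "('h, 'z) inner_space_scheme \<Rightarrow> 'h \<Rightarrow> 'h \<Rightarrow> real"
  where "hdist H u v = hnorm H (hadd H u (hscale H (- 1) v))"

locale hilbert_space =
  fixes H :: "('h, 'z) inner_space_scheme"
  assumes zero_closed: "hzero H \<in> hcarrier H"
    and add_closed: "\<lbrakk>u \<in> hcarrier H; v \<in> hcarrier H\<rbrakk> \<Longrightarrow> hadd H u v \<in> hcarrier H"
    and scale_closed: "u \<in> hcarrier H \<Longrightarrow> hscale H c u \<in> hcarrier H"
    and add_assoc: "\<lbrakk>u \<in> hcarrier H; v \<in> hcarrier H; w \<in> hcarrier H\<rbrakk>
      \<Longrightarrow> hadd H (hadd H u v) w = hadd H u (hadd H v w)"
    and add_commute: "\<lbrakk>u \<in> hcarrier H; v \<in> hcarrier H\<rbrakk> \<Longrightarrow> hadd H u v = hadd H v u"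
    and add_zero: "u \<in> hcarrier H \<Longrightarrow> hadd H (hzero H) u = u"
    and add_inverse: "u \<in> hcarrier H \<Longrightarrow> hadd H u (hscale H (- 1) u) = hzero H"
    and scale_add_right: "\<lbrakk>u \<in> hcarrier H; v \<in> hcarrier H\<rbrakk>
      \<Longrightarrow> hscale H c (hadd H u v) = hadd H (hscale H c u) (hscale H c v)"
    and scale_add_left: "u \<in> hcarrier H
      \<Longrightarrow> hscale H (c + d) u = hadd H (hscale H c u) (hscale H d u)"
    and scale_scale: "u \<in> hcarrier H \<Longrightarrow> hscale H c (hscale H d u) = hscale H (c * d) u"
    and scale_one: "u \<in> hcarrier H \<Longrightarrow> hscale H 1 u = u"
    and inner_add_left: "\<lbrakk>u \<in> hcarrier H; v \<in> hcarrier H; w \<in> hcarrier H\<rbrakk>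
      \<Longrightarrow> hinner H (hadd H u v) w = hinner H u w + hinner H v w"
    and inner_scale_left: "\<lbrakk>u \<in> hcarrier H; v \<in> hcarrier H\<rbrakk>
      \<Longrightarrow> hinner H (hscale H c u) v = c * hinner H u v"
    and inner_commute: "\<lbrakk>u \<in> hcarrier H; v \<in> hcarrier H\<rbrakk>
      \<Longrightarrow> hinner H v u = cnj (hinner H u v)"
    and inner_ge_zero: "u \<in> hcarrier H \<Longrightarrow> 0 \<le> Re (hinner H u u)"
    and inner_eq_zero: "\<lbrakk>u \<in> hcarrier H; hinner H u u = 0\<rbrakk> \<Longrightarrow> u = hzero H"
    and complete: "\<lbrakk>\<And>n. s n \<in> hcarrier H;
        \<forall>e>0. \<exists>N. \<forall>m\<ge>N. \<forall>n\<ge>N. hdist H (s m) (s n) < e\<rbrakk>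
      \<Longrightarrow> \<exists>u\<in>hcarrier H. (\<lambda>n. hdist H (s n) u) \<longlonglongrightarrow> 0"

text \<open>Operators are functions on the whole type, of which only the values on the carrier
  matter.\<close>

definition bounded_operator :: "('h, 'z) inner_space_scheme \<Rightarrow> ('h \<Rightarrow> 'h) \<Rightarrow> bool"
  where "bounded_operator H T \<longleftrightarrow>
    (\<forall>u\<in>hcarrier H. T u \<in> hcarrier H) \<and>
    (\<forall>u\<in>hcarrier H. \<forall>v\<in>hcarrier H. T (hadd H u v) = hadd H (T u) (T v)) \<and>
    (\<forall>c. \<forall>u\<in>hcarrier H. T (hscale H c u) = hscale H c (T u)) \<and>
    (\<exists>K. \<forall>u\<in>hcarrier H. hnorm H (T u) \<le> K * hnorm H u)"

definition operator_norm :: "('h, 'z) inner_space_scheme \<Rightarrow> ('h \<Rightarrow> 'h) \<Rightarrow> real"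
  where "operator_norm H T = Sup {hnorm H (T u) | u. u \<in> hcarrier H \<and> hnorm H u \<le> 1}"

primrec hsum :: "('h, 'z) inner_space_scheme \<Rightarrow> (nat \<Rightarrow> 'h) \<Rightarrow> nat \<Rightarrow> 'h"
  where
    "hsum H f 0 = hzero H"
  | "hsum H f (Suc n) = hadd H (hsum H f n) (f n)"

text \<open>The norm of an \<open>n \<times> n\<close> matrix of operators on \<open>H\<close>, as an operator on \<open>H\<^sup>n\<close>.\<close>

definition operator_matrix_norm ::
    "('h, 'z) inner_space_scheme \<Rightarrow> nat \<Rightarrow> (nat \<Rightarrow> nat \<Rightarrow> 'h \<Rightarrow> 'h) \<Rightarrow> real"
  where "operator_matrix_norm H n T =
    Sup {sqrt (\<Sum>i<n. (hnorm H (hsum H (\<lambda>k. T i k (u k)) n))\<^sup>2) | u.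
      (\<forall>k<n. u k \<in> hcarrier H) \<and> (\<Sum>k<n. (hnorm H (u k))\<^sup>2) \<le> 1}"

definition representation ::
    "'a::unital_cstar_algebra set \<Rightarrow> ('h, 'z) inner_space_scheme \<Rightarrow> ('a \<Rightarrow> 'h \<Rightarrow> 'h) \<Rightarrow> bool"
  where "representation A H \<pi> \<longleftrightarrow>
    hilbert_space H \<and>
    (\<forall>a\<in>A. bounded_operator H (\<pi> a)) \<and>
    (\<forall>a\<in>A. \<forall>b\<in>A. \<forall>u\<in>hcarrier H. \<pi> (a + b) u = hadd H (\<pi> a u) (\<pi> b u)) \<and>
    (\<forall>c. \<forall>a\<in>A. \<forall>u\<in>hcarrier H. \<pi> (c *\<^sub>C a) u = hscale H c (\<pi> a u)) \<and>
    (\<forall>a\<in>A. \<forall>b\<in>A. \<forall>u\<in>hcarrier H. \<pi> (a * b) u = \<pi> a (\<pi> b u)) \<and>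
    (\<forall>n a. (\<forall>i<n. \<forall>k<n. a i k \<in> A) \<longrightarrow>
      operator_matrix_norm H n (\<lambda>i k. \<pi> (a i k)) \<le> matrix_norm n a)"

definition closed_subspace :: "('h, 'z) inner_space_scheme \<Rightarrow> 'h set \<Rightarrow> bool"
  where "closed_subspace H S \<longleftrightarrow>
    S \<subseteq> hcarrier H \<and> hzero H \<in> S \<and>
    (\<forall>u\<in>S. \<forall>v\<in>S. hadd H u v \<in> S) \<and> (\<forall>c. \<forall>u\<in>S. hscale H c u \<in> S) \<and>
    (\<forall>s. \<forall>u\<in>hcarrier H. (\<forall>n. s n \<in> S) \<and> (\<lambda>n. hdist H (s n) u) \<longlonglongrightarrow> 0 \<longrightarrow> u \<in> S)"

definition invariant_subspaces ::
    "('h, 'z) inner_space_scheme \<Rightarrow> ('h \<Rightarrow> 'h) set \<Rightarrow> 'h set set"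
  where "invariant_subspaces H \<T> = {S. closed_subspace H S \<and> (\<forall>T\<in>\<T>. \<forall>u\<in>S. T u \<in> S)}"

definition nest_representation ::
    "'a::unital_cstar_algebra set \<Rightarrow> ('h, 'z) inner_space_scheme \<Rightarrow> ('a \<Rightarrow> 'h \<Rightarrow> 'h) \<Rightarrow> bool"
  where "nest_representation A H \<pi> \<longleftrightarrow> representation A H \<pi> \<and>
    (\<forall>S\<in>invariant_subspaces H (\<pi> ` A). \<forall>T\<in>invariant_subspaces H (\<pi> ` A). S \<subseteq> T \<or> T \<subseteq> S)"

definition irreducible_representation ::
    "'a::unital_cstar_algebra set \<Rightarrow> ('h, 'z) inner_space_scheme \<Rightarrow> ('a \<Rightarrow> 'h \<Rightarrow> 'h) \<Rightarrow> bool"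
  where "irreducible_representation A H \<pi> \<longleftrightarrow> representation A H \<pi> \<and>
    hcarrier H \<noteq> {hzero H} \<and>
    invariant_subspaces H (\<pi> ` A) = {{hzero H}, hcarrier H}"


subsection \<open>States and the GNS construction\<close>

definition state :: "('a::unital_cstar_algebra \<Rightarrow> complex) \<Rightarrow> bool"
  where "state \<phi> \<longleftrightarrow> linear_on UNIV \<phi> \<and> (\<forall>a. positive (\<phi> (star a * a))) \<and> \<phi> 1 = 1"

definition pure_state :: "('a::unital_cstar_algebra \<Rightarrow> complex) \<Rightarrow> bool"
  where "pure_state \<phi> \<longleftrightarrow> state \<phi> \<and>
    (\<forall>\<psi>\<^sub>1 \<psi>\<^sub>2 t. state \<psi>\<^sub>1 \<and> state \<psi>\<^sub>2 \<and> 0 < t \<and> t < 1 \<and>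
      (\<forall>a. \<phi> a = complex_of_real t * \<psi>\<^sub>1 a + complex_of_real (1 - t) * \<psi>\<^sub>2 a)
      \<longrightarrow> \<psi>\<^sub>1 = \<phi> \<and> \<psi>\<^sub>2 = \<phi>)"

text \<open>The GNS space of \<open>\<phi>\<close> is the Hausdorff completion of the algebra for the semi-inner product
  \<open>\<langle>a, b\<rangle> = \<phi> (b\<^sup>* a)\<close>: its elements are the classes of Cauchy sequences modulo
  sequences of seminorm tending to 0. This divides out \<open>{a. \<phi> (a\<^sup>* a) = 0}\<close> and completes in
  one step. The algebra acts by left multiplication.\<close>

definition gns_seminorm :: "('a::unital_cstar_algebra \<Rightarrow> complex) \<Rightarrow> 'a \<Rightarrow> real"
  where "gns_seminorm \<phi> a = sqrt (Re (\<phi> (star a * a)))"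

definition gns_cauchy :: "('a::unital_cstar_algebra \<Rightarrow> complex) \<Rightarrow> (nat \<Rightarrow> 'a) set"
  where "gns_cauchy \<phi> = {s. \<forall>e>0. \<exists>N. \<forall>m\<ge>N. \<forall>n\<ge>N. gns_seminorm \<phi> (s m - s n) < e}"

definition gns_equiv ::
    "('a::unital_cstar_algebra \<Rightarrow> complex) \<Rightarrow> ((nat \<Rightarrow> 'a) \<times> (nat \<Rightarrow> 'a)) set"
  where "gns_equiv \<phi> = {(s, t). s \<in> gns_cauchy \<phi> \<and> t \<in> gns_cauchy \<phi> \<and>
    (\<lambda>n. gns_seminorm \<phi> (s n - t n)) \<longlonglongrightarrow> 0}"

definition gns_class ::
    "('a::unital_cstar_algebra \<Rightarrow> complex) \<Rightarrow> (nat \<Rightarrow> 'a) \<Rightarrow> (nat \<Rightarrow> 'a) set"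
  where "gns_class \<phi> s = gns_equiv \<phi> `` {s}"

definition gns_seq :: "(nat \<Rightarrow> 'a::unital_cstar_algebra) set \<Rightarrow> nat \<Rightarrow> 'a"
  where "gns_seq u = (SOME s. s \<in> u)"

definition gns_space ::
    "('a::unital_cstar_algebra \<Rightarrow> complex) \<Rightarrow> (nat \<Rightarrow> 'a) set inner_space"
  where "gns_space \<phi> =
    \<lparr>hcarrier = gns_cauchy \<phi> // gns_equiv \<phi>,
     hzero = gns_class \<phi> (\<lambda>n. 0),
     hadd = (\<lambda>u v. gns_class \<phi> (\<lambda>n. gns_seq u n + gns_seq v n)),
     hscale = (\<lambda>c u. gns_class \<phi> (\<lambda>n. c *\<^sub>C gns_seq u n)),
     hinner = (\<lambda>u v. lim (\<lambda>n. \<phi> (star (gns_seq v n) * gns_seq u n)))\<rparr>"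

definition gns_rep ::
    "('a::unital_cstar_algebra \<Rightarrow> complex) \<Rightarrow> 'a \<Rightarrow> (nat \<Rightarrow> 'a) set \<Rightarrow> (nat \<Rightarrow> 'a) set"
  where "gns_rep \<phi> a u = gns_class \<phi> (\<lambda>n. a * gns_seq u n)"

definition point_state ::
    "('a::unital_cstar_algebra \<Rightarrow> 'a) \<Rightarrow> ('a \<Rightarrow> complex) \<Rightarrow> 'a \<Rightarrow> complex"
  where "point_state E y a = y (E a)"

end

theory Submission
  imports Defs
begin

text \<open>
  Fix a point \<open>y\<close> with trivial isotropy, let \<open>\<rho> = y \<circ> E\<close>, let \<open>\<pi>\<close> be its GNS representation and \<open>\<xi>\<close> its
  cyclic vector. For a normalizer \<open>n\<close> the vector \<open>\<pi>(n)\<xi>\<close> is a joint eigenvector of the Cartan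
  subalgebra \<open>M\<close>: an element \<open>h\<close> of \<open>M\<close> acts on it by the value of \<open>h\<close> at \<open>\<alpha>\<^sub>n(y)\<close>. These vectors
  span a dense subspace, because normalizers are closed under products and adjoints up to 0
  (\<open>normalizer_induct\<close>). If a normalizer \<open>k\<close> fixes \<open>y\<close>, then \<open>E(k)(y) \<noteq> 0\<close> by trivial isotropy, and
  this forces \<open>\<pi>(k)\<xi> = E(k)(y)\<xi>\<close> (\<open>char_E_normalizer\<close>, \<open>fixing_seminorm\<close>). Applied to \<open>k = n\<^sup>*m\<close> this
  shows that \<open>\<pi>(n)\<xi>\<close> and \<open>\<pi>(m)\<xi>\<close> are parallel when \<open>\<alpha>\<^sub>n(y) = \<alpha>\<^sub>m(y)\<close>; otherwise they are
  orthogonal. So \<open>M\<close> acts diagonally and with multiplicity one, and a closed \<open>M\<close>-invariant subspace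
  contains each \<open>\<pi>(n)\<xi>\<close> or is orthogonal to it (\<open>M_invariant_dichotomy\<close>); it is determined by
  those which it contains.

  Everything about a single \<open>y\<close> follows from this. Let \<open>S\<close> and \<open>T\<close> be invariant under a Dirichlet
  algebra containing \<open>M\<close>, and suppose that neither contains the other. Then there are \<open>\<pi>(n)\<xi>\<close> in
  \<open>S\<close> orthogonal to \<open>T\<close> and \<open>\<pi>(m)\<xi>\<close> in \<open>T\<close> orthogonal to \<open>S\<close>. The functional
  \<open>a \<mapsto> \<langle>\<pi>(a)\<pi>(n)\<xi>, \<pi>(m)\<xi>\<rangle>\<close> vanishes on the algebra by invariance of \<open>S\<close> and on its adjoint by
  invariance of \<open>T\<close>, hence everywhere; but its value at \<open>m n\<^sup>*\<close> is the product of the squared norms of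
  the two vectors. A subspace invariant under the whole algebra contains \<open>\<xi>\<close> or is orthogonal to it,
  which gives irreducibility. A state dominated by a multiple of \<open>\<rho>\<close> restricts to \<open>y\<close> on \<open>M\<close>, and the
  same alternative for \<open>\<alpha>\<^sub>n(y)\<close> determines its value at each normalizer, so \<open>\<rho>\<close> is pure.

  For the norm formula, let \<open>c\<close> bound all \<open>\<parallel>\<pi>\<^sub>y(b)\<parallel>\<close> and let \<open>h = c\<^sup>2 - b\<^sup>*b\<close>. Then \<open>E(m\<^sup>*hm)\<close> is
  nonnegative at every point with trivial isotropy, for every \<open>m\<close>. Taking for \<open>m\<close> the negative part
  of \<open>h\<close> makes \<open>m\<^sup>*hm\<close> a negative element \<open>-w\<^sup>2\<close>, so \<open>E(w\<^sup>2)\<close> vanishes at those points. Since they are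
  dense (\<open>trivial_isotropy_dense\<close>) and \<open>E\<close> is faithful, \<open>w = 0\<close>; so \<open>h\<close> is positive and \<open>\<parallel>b\<parallel> \<le> c\<close>.

  Density is a Baire category argument over countably many normalizers. It is carried out inside \<open>M\<close>:
  nonempty open sets of the Gelfand space are represented by nonzero elements \<open>p\<close> of \<open>M\<close>, smaller
  ones by nonzero multiples \<open>p f\<close>. A sequence that decides more and more determines a character, so
  that the existence of characters is proved together with the density, and the topology of the
  Gelfand space does not enter.

  The order structure of an abstract C*-algebra comes from the binomial series for \<open>sqrt (1 - x)\<close>: it
  identifies the positive elements with the squares of self-adjoint ones (\<open>positive_iff_square\<close>) and
  makes them a cone on which the norm is monotone.
\<close>

section \<open>Arithmetic of the involution\<close>

lemma scaleC_minus_one [simp]: "(- 1) *\<^sub>C (x::'a::unital_cstar_algebra) = - x"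
  using scaleR_scaleC[of "-1" x] by simp

lemma scaleC_one [simp]: "1 *\<^sub>C (x::'a::unital_cstar_algebra) = x"
  using scaleR_scaleC[of "1" x] by simp

lemma scaleC_zero_left [simp]: "0 *\<^sub>C (x::'a::unital_cstar_algebra) = 0"
  using scaleR_scaleC[of "0" x] by simp

lemma scaleC_zero_right [simp]: "c *\<^sub>C (0::'a::unital_cstar_algebra) = 0"
  using scaleC_add_right[of c "0::'a" 0] by simp

lemma scaleC_minus_right: "c *\<^sub>C (- x::'a::unital_cstar_algebra) = - (c *\<^sub>C x)"
  using scaleC_add_right[of c x "- x"] by (simp add: eq_neg_iff_add_eq_0 add.commute)

lemma scaleC_minus_left: "(- c) *\<^sub>C (x::'a::unital_cstar_algebra) = - (c *\<^sub>C x)"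
  using scaleC_add_left[of c "-c" x] by (simp add: eq_neg_iff_add_eq_0 add.commute)

lemma scaleC_diff_right: "c *\<^sub>C (x - y::'a::unital_cstar_algebra) = c *\<^sub>C x - c *\<^sub>C y"
  using scaleC_add_right[of c x "- y"] by (simp add: scaleC_minus_right)

lemma scaleC_diff_left: "(c - d) *\<^sub>C (x::'a::unital_cstar_algebra) = c *\<^sub>C x - d *\<^sub>C x"
  using scaleC_add_left[of c "- d" x] by (simp add: scaleC_minus_left)

lemma star_zero [simp]: "star (0::'a::unital_cstar_algebra) = 0"
  using star_add[of "0::'a" 0] by simp

lemma star_minus: "star (- x::'a::unital_cstar_algebra) = - star x"
  using star_add[of x "- x"] by (simp add: eq_neg_iff_add_eq_0 add.commute)

lemma star_diff: "star (x - y::'a::unital_cstar_algebra) = star x - star y"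
  using star_add[of x "- y"] by (simp add: star_minus)

lemma star_one [simp]: "star (1::'a::unital_cstar_algebra) = 1"
  by (metis mult.right_neutral mult_1 star_mult star_star)

lemma star_scaleR: "star (r *\<^sub>R x::'a::unital_cstar_algebra) = r *\<^sub>R star x"
  by (simp add: scaleR_scaleC star_scaleC)

lemma star_sum: "star (sum f A::'a::unital_cstar_algebra) = (\<Sum>i\<in>A. star (f i))"
  by (induction A rule: infinite_finite_induct) (auto simp: star_add)

lemma star_power: "star (x ^ n::'a::unital_cstar_algebra) = star x ^ n"
  by (induction n) (auto simp: star_mult power_commutes)

lemma norm_star [simp]: "norm (star x) = norm (x::'a::unital_cstar_algebra)"
proof -
  have le: "norm x \<le> norm (star x)" for x :: 'a
  proof (cases "norm x = 0")
    case False
    have "norm x * norm x \<le> norm (star x) * norm x"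
      using norm_mult_ineq[of "star x" x] by (simp add: cstar_identity power2_eq_square)
    with False show ?thesis by (simp add: mult_le_cancel_right)
  qed simp
  show ?thesis using le[of x] le[of "star x"] by (simp add: star_star)
qed

lemma norm_mult_star_self: "norm (x * star x) = (norm (x::'a::unital_cstar_algebra))\<^sup>2"
  using cstar_identity[of "star x"] by (simp add: star_star)

lemma norm_square_selfadjoint:
  "star x = x \<Longrightarrow> norm (x * x) = (norm (x::'a::unital_cstar_algebra))\<^sup>2"
  using cstar_identity[of x] by simp

lemma star_mult_self_eq_0 [simp]: "star x * x = 0 \<longleftrightarrow> (x::'a::unital_cstar_algebra) = 0"
  using cstar_identity[of x] by auto

lemma square_selfadjoint_eq_0:
  "star x = x \<Longrightarrow> x * x = 0 \<longleftrightarrow> (x::'a::unital_cstar_algebra) = 0"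
  using star_mult_self_eq_0[of x] by simp

lemma bounded_linear_star: "bounded_linear (star :: 'a::unital_cstar_algebra \<Rightarrow> 'a)"
  by (rule bounded_linear_intro[where K=1]) (auto simp: star_add star_scaleR)

lemmas star_simps = star_add star_diff star_minus star_mult star_scaleR star_scaleC star_star

section \<open>Square roots\<close>

text \<open>The coefficients of the power series of \<open>sqrt (1 - x)\<close>.\<close>

definition sqrt_coeff :: "nat \<Rightarrow> real"
  where "sqrt_coeff k = (1/2 gchoose k) * (- 1) ^ k"

lemma sqrt_coeff_0 [simp]: "sqrt_coeff 0 = 1"
  by (simp add: sqrt_coeff_def)

lemma gbinomial_minus_half_sign: "(- 1) ^ k * ((- (1/2) :: real) gchoose k) \<ge> 0"
proof -
  have "((- (1/2) :: real) gchoose k) = (- 1) ^ k * ((1/2 + of_nat k - 1) gchoose k)"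
    by (rule gbinomial_minus)
  also have "((1/2 + of_nat k - 1 :: real) gchoose k) = pochhammer (1/2) k / fact k"
    by (simp add: gbinomial_pochhammer')
  finally show ?thesis
    by (simp add: mult.assoc[symmetric] power_mult_distrib[symmetric] pochhammer_nonneg)
qed

lemma sqrt_coeff_nonpos: "k > 0 \<Longrightarrow> sqrt_coeff k \<le> 0"
proof -
  assume k: "k > 0"
  then obtain l where l: "k = Suc l" by (cases k) auto
  have "(1/2 :: real) gchoose k = (1/2) / of_nat k * (- (1/2) gchoose l)"
    using gbinomial_absorption'[OF k, of "1/2 :: real"] l by simp
  then have "sqrt_coeff k = - ((1/2) / of_nat k * ((- 1) ^ l * (- (1/2) gchoose l)))"
    by (simp add: sqrt_coeff_def l)
  then show ?thesis using gbinomial_minus_half_sign[of l] by simp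
qed

lemma sum_sqrt_coeff_nonneg: "(\<Sum>k\<le>n. sqrt_coeff k) \<ge> 0"
  using gbinomial_sum_lower_neg[of "1/2 :: real" n] gbinomial_minus_half_sign[of n]
  by (simp add: sqrt_coeff_def)

text \<open>The coefficients after the first are nonpositive, and the partial sums of all coefficients stay
  nonnegative because \<open>gbinomial_sum_lower_neg\<close> expresses them by one coefficient of
  \<open>1 / sqrt (1 - x)\<close>. Hence the series converges absolutely even on the unit sphere, which is what
  makes \<open>sqrt_one_minus\<close> available for \<open>norm x = 1\<close>.\<close>

lemma sum_abs_sqrt_coeff_Suc_le_1: "(\<Sum>k<n. \<bar>sqrt_coeff (Suc k)\<bar>) \<le> 1"
proof -
  have "(\<Sum>k\<le>n. sqrt_coeff k) = 1 + (\<Sum>k<n. sqrt_coeff (Suc k))"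
    by (simp add: sum.atMost_shift)
  moreover have "(\<Sum>k<n. \<bar>sqrt_coeff (Suc k)\<bar>) = - (\<Sum>k<n. sqrt_coeff (Suc k))"
    by (simp add: sum_negf[symmetric] abs_of_nonpos sqrt_coeff_nonpos)
  ultimately show ?thesis using sum_sqrt_coeff_nonneg[of n] by simp
qed

lemma summable_abs_sqrt_coeff_Suc: "summable (\<lambda>k. \<bar>sqrt_coeff (Suc k)\<bar>)"
  by (rule summableI_nonneg_bounded[where x=1]) (auto simp: sum_abs_sqrt_coeff_Suc_le_1)

lemma summable_abs_sqrt_coeff: "summable (\<lambda>k. \<bar>sqrt_coeff k\<bar>)"
  using summable_abs_sqrt_coeff_Suc summable_Suc_iff[of "\<lambda>k. \<bar>sqrt_coeff k\<bar>"] by simp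


lemma suminf_abs_sqrt_coeff_Suc_le_1: "(\<Sum>k. \<bar>sqrt_coeff (Suc k)\<bar>) \<le> 1"
  by (rule suminf_le_const[OF summable_abs_sqrt_coeff_Suc sum_abs_sqrt_coeff_Suc_le_1])

lemma sqrt_coeff_convolution:
  "(\<Sum>i\<le>n. sqrt_coeff i * sqrt_coeff (n - i)) = (1 gchoose n) * (- 1) ^ n"
proof -
  have "(\<Sum>i\<le>n. sqrt_coeff i * sqrt_coeff (n - i))
      = (\<Sum>i\<le>n. ((1/2) gchoose i) * ((1/2) gchoose (n - i)) * (- 1) ^ n)"
    by (intro sum.cong refl) (auto simp: sqrt_coeff_def power_add[symmetric])
  also have "\<dots> = ((1/2 + 1/2) gchoose n) * (- 1) ^ n"
    using gbinomial_Vandermonde[of "1/2 :: real" "1/2" n]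
    by (simp add: sum_distrib_right[symmetric] atLeast0AtMost)
  finally show ?thesis by simp
qed

text \<open>The root is a limit of polynomials in \<open>x\<close>, so it commutes with everything that commutes with
  \<open>x\<close>; this property stands in for membership in the C*-algebra generated by \<open>x\<close>. The bound on
  \<open>1 - c\<close> is what makes the root itself positive, see \<open>squareI_norm_diff_le\<close>.\<close>

lemma sqrt_one_minus:
  fixes x :: "'a::unital_cstar_algebra"
  assumes "star x = x" and "norm x \<le> 1"
  obtains c where "star c = c" and "c * c = 1 - x" and "norm (1 - c) \<le> 1"
    and "\<And>d. d * x = x * d \<Longrightarrow> d * c = c * d"
proof -
  define f where "f k = sqrt_coeff k *\<^sub>R x ^ k" for k
  have nf: "norm (f k) \<le> \<bar>sqrt_coeff k\<bar>" for k
  proof -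
    have "norm (x ^ k) \<le> 1"
      using norm_power_ineq[of x k] power_le_one[of "norm x" k] assms(2) by simp
    then show ?thesis by (simp add: f_def mult_left_le)
  qed
  have snf: "summable (\<lambda>k. norm (f k))"
    by (rule summable_comparison_test'[OF summable_abs_sqrt_coeff, of 0]) (simp add: nf)
  then have sf: "summable f" by (rule summable_norm_cancel)
  define c where "c = (\<Sum>k. f k)"
  have "star c = (\<Sum>k. star (f k))"
    unfolding c_def by (rule bounded_linear.suminf[OF bounded_linear_star sf])
  then have 1: "star c = c"
    by (simp add: f_def c_def star_scaleR star_power assms(1))
  have conv: "(\<Sum>i\<le>n. f i * f (n - i)) = ((1 gchoose n) * (- 1) ^ n) *\<^sub>R x ^ n" for n
  proof -
    have "(\<Sum>i\<le>n. f i * f (n - i)) = (\<Sum>i\<le>n. (sqrt_coeff i * sqrt_coeff (n - i)) *\<^sub>R x ^ n)"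
      by (intro sum.cong refl) (auto simp: f_def power_add[symmetric])
    then show ?thesis by (simp only: scaleR_sum_left[symmetric] sqrt_coeff_convolution)
  qed
  have "c * c = (\<Sum>n. ((1 gchoose n) * (- 1) ^ n) *\<^sub>R x ^ n)"
    unfolding c_def Cauchy_product[OF snf snf] conv ..
  also have "\<dots> = (\<Sum>n\<in>{0,1}. ((1 gchoose n) * (- 1) ^ n) *\<^sub>R x ^ n)"
  proof (rule suminf_finite)
    fix n :: nat assume "n \<notin> {0, 1}"
    then have "1 < n" by auto
    then have "1 choose n = 0" by (simp add: binomial_eq_0)
    then have "(1::real) gchoose n = 0"
      using binomial_gbinomial[of 1 n, where 'a=real] by (simp only: of_nat_0 of_nat_1)
    then show "((1 gchoose n) * (- 1) ^ n) *\<^sub>R x ^ n = 0" by simp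
  qed auto
  also have "\<dots> = 1 - x" by simp
  finally have 2: "c * c = 1 - x" .
  have "c = 1 + (\<Sum>k. f (Suc k))"
    using suminf_split_head[OF sf] c_def by (simp add: f_def[of 0])
  then have "norm (1 - c) = norm (\<Sum>k. f (Suc k))" by (simp add: norm_minus_commute)
  also have "\<dots> \<le> (\<Sum>k. \<bar>sqrt_coeff (Suc k)\<bar>)"
    by (rule norm_suminf_le[OF nf summable_abs_sqrt_coeff_Suc])
  also have "\<dots> \<le> 1" by (rule suminf_abs_sqrt_coeff_Suc_le_1)
  finally have 3: "norm (1 - c) \<le> 1" .
  have 4: "d * c = c * d" if d: "d * x = x * d" for d
  proof -
    have "d * f k = f k * d" for k
      using power_commuting_commutes[of x d k] d by (simp add: f_def)
    moreover have "d * c = (\<Sum>k. d * f k)" unfolding c_def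
      by (rule bounded_linear.suminf[OF bounded_linear_mult_right sf])
    moreover have "c * d = (\<Sum>k. f k * d)" unfolding c_def
      by (rule bounded_linear.suminf[OF bounded_linear_mult_left sf])
    ultimately show ?thesis by simp
  qed
  show ?thesis by (rule that[OF 1 2 3 4])
qed

lemma sqrt_diff:
  fixes y :: "'a::unital_cstar_algebra"
  assumes "star y = y" and "norm y \<le> t"
  obtains c where "star c = c" and "c * c = t *\<^sub>R 1 - y" and "norm (sqrt t *\<^sub>R 1 - c) \<le> sqrt t"
    and "\<And>d. d * y = y * d \<Longrightarrow> d * c = c * d"
proof (cases "t = 0")
  case True
  then show ?thesis using that[of 0] assms by simp
next
  case False
  with assms have t: "t > 0" using norm_ge_zero[of y] by linarith
  have "star ((1/t) *\<^sub>R y) = (1/t) *\<^sub>R y" "norm ((1/t) *\<^sub>R y) \<le> 1"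
    using assms t by (auto simp: star_scaleR field_simps)
  then obtain c where c: "star c = c" "c * c = 1 - (1/t) *\<^sub>R y" "norm (1 - c) \<le> 1"
    "\<And>d. d * ((1/t) *\<^sub>R y) = (1/t) *\<^sub>R y * d \<Longrightarrow> d * c = c * d"
    by (rule sqrt_one_minus) blast
  show ?thesis
  proof (rule that[of "sqrt t *\<^sub>R c"])
    show "(sqrt t *\<^sub>R c) * (sqrt t *\<^sub>R c) = t *\<^sub>R 1 - y"
      using c(2) t by (simp add: scaleR_diff_right)
    have "norm (sqrt t *\<^sub>R 1 - sqrt t *\<^sub>R c) = sqrt t * norm (1 - c)"
      using t by (simp add: scaleR_diff_right[symmetric])
    then show "norm (sqrt t *\<^sub>R 1 - sqrt t *\<^sub>R c) \<le> sqrt t"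
      using c(3) t by (simp add: mult_left_le)
    show "star (sqrt t *\<^sub>R c) = sqrt t *\<^sub>R c" by (simp add: star_scaleR c(1))
    show "d * sqrt t *\<^sub>R c = sqrt t *\<^sub>R c * d" if "d * y = y * d" for d
      using c(4)[of d] that by simp
  qed
qed

section \<open>Positive elements\<close>

text \<open>By \<open>positive_iff_square\<close> below this is the same as \<^const>\<open>positive\<close>. Until that is known, this
  is the notion with a usable theory.\<close>

definition square :: "'a::unital_cstar_algebra \<Rightarrow> bool"
  where "square x \<longleftrightarrow> (\<exists>u. star u = u \<and> x = u * u)"

lemma squareI: "star u = u \<Longrightarrow> square (u * u)"
  unfolding square_def by auto

lemma square_selfadjoint: "square x \<Longrightarrow> star x = x"
  unfolding square_def by (auto simp: star_mult)

text \<open>The C*-identity for \<open>w = u + \<i>v\<close>, which has \<open>w\<^sup>*w = u\<^sup>2 + v\<^sup>2\<close> and real part \<open>u\<close>.\<close>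

lemma norm_le_norm_sum_squares:
  fixes u v :: "'a::unital_cstar_algebra"
  assumes "star u = u" "star v = v" "u * v = v * u"
  shows "(norm u)\<^sup>2 \<le> norm (u * u + v * v)"
proof -
  define w where "w = u + \<i> *\<^sub>C v"
  have sw: "star w = u - \<i> *\<^sub>C v" by (simp add: w_def star_add star_scaleC assms scaleC_minus_left)
  have "star w * w = u * u + v * v"
    unfolding sw unfolding w_def
    by (simp add: ring_distribs left_diff_distrib right_diff_distrib mult_scaleC_left
        mult_scaleC_right scaleC_scaleC assms(3) scaleC_minus_left scaleC_add_right scaleC_diff_right)
  then have nw: "(norm w)\<^sup>2 = norm (u * u + v * v)" using cstar_identity[of w] by simp
  have "w + star w = 2 *\<^sub>R u" unfolding sw by (simp add: w_def scaleR_2)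
  then have "2 * norm u \<le> norm w + norm (star w)"
    using norm_triangle_ineq[of w "star w"] by simp
  then have "norm u \<le> norm w" by simp
  then show ?thesis using nw by (metis norm_ge_zero power_mono)
qed

lemma square_if_norm_diff_le:
  fixes h :: "'a::unital_cstar_algebra"
  assumes "star h = h" and "norm (t *\<^sub>R 1 - h) \<le> t"
  obtains u where "star u = u" "u * u = h" "norm (sqrt t *\<^sub>R 1 - u) \<le> sqrt t"
    "\<And>d. d * h = h * d \<Longrightarrow> d * u = u * d"
proof -
  have "star (t *\<^sub>R 1 - h) = t *\<^sub>R 1 - h" using assms(1) by (simp add: star_simps)
  then obtain c where c: "star c = c" "c * c = t *\<^sub>R 1 - (t *\<^sub>R 1 - h)"
    "norm (sqrt t *\<^sub>R 1 - c) \<le> sqrt t"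
    "\<And>d. d * (t *\<^sub>R 1 - h) = (t *\<^sub>R 1 - h) * d \<Longrightarrow> d * c = c * d"
    by (rule sqrt_diff[OF _ assms(2)]) blast
  show ?thesis
  proof (rule that[OF c(1) _ c(3)])
    show "c * c = h" using c(2) by simp
    show "d * c = c * d" if "d * h = h * d" for d
      using c(4)[of d] that by (simp add: algebra_simps)
  qed
qed

text \<open>Together with \<open>square_norm_diff_le\<close> this describes squares by a distance condition that is stable
  under sums, which is why squares form a cone.\<close>

lemma squareI_norm_diff_le:
  assumes "star h = h" and "norm (t *\<^sub>R 1 - h) \<le> t"
  shows "square (h::'a::unital_cstar_algebra)"
proof (rule square_if_norm_diff_le[OF assms])
  fix u assume "star u = u" "u * u = h"
  then show "square h" using squareI by blast
qed

lemma square_norm_diff_le: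
  assumes "square (h::'a::unital_cstar_algebra)"
  shows "norm (norm h *\<^sub>R 1 - h) \<le> norm h"
proof -
  have "star h = h" using assms by (rule square_selfadjoint)
  obtain u where u: "star u = u" "h = u * u" using assms unfolding square_def by auto
  obtain c where c: "star c = c" "c * c = norm h *\<^sub>R 1 - h" "\<And>d. d * h = h * d \<Longrightarrow> d * c = c * d"
    by (rule sqrt_diff[OF \<open>star h = h\<close> order_refl]) blast
  have "u * h = h * u" by (simp add: u(2) mult.assoc)
  then have "c * u = u * c" by (rule c(3)[symmetric])
  then have "(norm c)\<^sup>2 \<le> norm (c * c + u * u)"
    by (rule norm_le_norm_sum_squares[OF c(1) u(1)])
  also have "c * c + u * u = norm h *\<^sub>R 1" using c(2) u by simp
  finally show ?thesis using c(2) norm_square_selfadjoint[OF c(1)] by simp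
qed

lemma square_root:
  assumes "square (h::'a::unital_cstar_algebra)"
  obtains u where "star u = u" "square u" "u * u = h" "\<And>d. d * h = h * d \<Longrightarrow> d * u = u * d"
proof (rule square_if_norm_diff_le[OF square_selfadjoint[OF assms] square_norm_diff_le[OF assms]])
  fix u assume u: "star u = u" "u * u = h" "norm (sqrt (norm h) *\<^sub>R 1 - u) \<le> sqrt (norm h)"
    "\<And>d. d * h = h * d \<Longrightarrow> d * u = u * d"
  show ?thesis by (rule that[OF u(1) squareI_norm_diff_le[OF u(1,3)] u(2,4)])
qed

lemma square_add:
  assumes "square (x::'a::unital_cstar_algebra)" "square y"
  shows "square (x + y)"
proof (rule squareI_norm_diff_le)
  show "star (x + y) = x + y" using assms by (simp add: star_add square_selfadjoint)
  have "(norm x + norm y) *\<^sub>R 1 - (x + y) = (norm x *\<^sub>R 1 - x) + (norm y *\<^sub>R 1 - y)"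
    by (simp add: algebra_simps)
  then show "norm ((norm x + norm y) *\<^sub>R 1 - (x + y)) \<le> norm x + norm y"
    using norm_triangle_mono[OF square_norm_diff_le[OF assms(1)] square_norm_diff_le[OF assms(2)]]
    by (simp only:)
qed

lemma square_scaleR: "square (x::'a::unital_cstar_algebra) \<Longrightarrow> r \<ge> 0 \<Longrightarrow> square (r *\<^sub>R x)"
proof -
  assume "square x" and r: "r \<ge> 0"
  then obtain u where u: "star u = u" "x = u * u" unfolding square_def by auto
  have "r *\<^sub>R x = (sqrt r *\<^sub>R u) * (sqrt r *\<^sub>R u)" using u r by simp
  then show ?thesis using squareI[of "sqrt r *\<^sub>R u"] u(1) by (simp only: star_scaleR)
qed

lemma square_mult:
  assumes "square (x::'a::unital_cstar_algebra)" "square y" "x * y = y * x"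
  shows "square (x * y)"
proof -
  obtain u where u: "star u = u" "u * u = x" "\<And>d. d * x = x * d \<Longrightarrow> d * u = u * d"
    by (rule square_root[OF assms(1)]) blast
  obtain v where v: "star v = v" "v * v = y" "\<And>d. d * y = y * d \<Longrightarrow> d * v = v * d"
    by (rule square_root[OF assms(2)]) blast
  have "y * u = u * y" by (rule u(3)) (simp add: assms(3))
  then have uv: "u * v = v * u" using v(3)[of u] by simp
  have "x * y = (u * v) * (u * v)" using u(2) v(2) uv by (metis mult.assoc)
  moreover have "star (u * v) = u * v" using u(1) v(1) uv by (simp add: star_mult)
  ultimately show ?thesis using squareI by metis
qed

lemma square_norm_diff:
  assumes "star (x::'a::unital_cstar_algebra) = x" "norm x \<le> t"
  shows "square (t *\<^sub>R 1 - x)"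
proof (rule sqrt_diff[OF assms])
  fix u assume u: "star u = u" "u * u = t *\<^sub>R 1 - x"
  show "square (t *\<^sub>R 1 - x)" using squareI[OF u(1)] u(2) by simp
qed

text \<open>The difference \<open>norm b *\<^sub>R 1 - a\<close> is a square \<open>s\<^sup>2\<close>, being the sum of \<open>norm b *\<^sub>R 1 - b\<close> and
  \<open>b - a\<close>, and \<open>s\<close> commutes with the root of \<open>a\<close>; so \<open>norm_le_norm_sum_squares\<close> applies.\<close>

lemma square_norm_mono:
  assumes "square (a::'a::unital_cstar_algebra)" "square (b - a)"
  shows "norm a \<le> norm b"
proof -
  have b: "square b" using square_add[OF assms] by simp
  have "square (norm b *\<^sub>R 1 - b)"
    by (rule square_norm_diff) (auto simp: square_selfadjoint b)
  then have "square (norm b *\<^sub>R 1 - a)" using square_add[OF _ assms(2)] by fastforce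
  then obtain s where s: "star s = s" "s * s = norm b *\<^sub>R 1 - a"
    "\<And>d. d * (norm b *\<^sub>R 1 - a) = (norm b *\<^sub>R 1 - a) * d \<Longrightarrow> d * s = s * d"
    by (rule square_root) blast
  obtain u where u: "star u = u" "a = u * u" using assms(1) unfolding square_def by auto
  have "u * s = s * u" using s(3)[of u] by (simp add: u(2) algebra_simps)
  then have "(norm u)\<^sup>2 \<le> norm (u * u + s * s)"
    by (rule norm_le_norm_sum_squares[OF u(1) s(1)])
  then show ?thesis using s(2) u(2) norm_square_selfadjoint[OF u(1)] by simp
qed

lemma selfadjoint_abs:
  fixes p :: "'a::unital_cstar_algebra"
  assumes "star p = p"
  obtains q r where "star q = q" "q * q = p * p" "star r = r" "r * r = q"
    "\<And>d. d * p = p * d \<Longrightarrow> d * q = q * d" "\<And>d. d * p = p * d \<Longrightarrow> d * r = r * d"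
proof -
  obtain q where q: "star q = q" "square q" "q * q = p * p"
    "\<And>d. d * (p * p) = p * p * d \<Longrightarrow> d * q = q * d"
    by (rule square_root[OF squareI[OF assms]]) blast
  obtain r where r: "star r = r" "r * r = q" "\<And>d. d * q = q * d \<Longrightarrow> d * r = r * d"
    by (rule square_root[OF q(2)]) blast
  have "d * q = q * d" if "d * p = p * d" for d
    by (rule q(4)) (metis that mult.assoc)
  then show ?thesis using that[of q r] q(1,3) r by blast
qed

text \<open>Let \<open>q = r\<^sup>2\<close> be the absolute value of \<open>p\<close>. Then \<open>m = q - p\<close> is twice the negative part, \<open>m\<^sup>2 = 2qm\<close>
  and \<open>pm = -qm\<close>, so that \<open>mpm = -qm\<^sup>2 = -(rm)\<^sup>2\<close> and \<open>w = rm\<close> will do.\<close>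

lemma negative_part:
  fixes p :: "'a::unital_cstar_algebra"
  assumes "star p = p"
  obtains m w where "star m = m" "star w = w" "m * p * m = - (w * w)" "w = 0 \<Longrightarrow> square p"
    "\<And>d. d * p = p * d \<Longrightarrow> d * m = m * d"
proof -
  obtain q r where q: "star q = q" "q * q = p * p" and r: "star r = r" "r * r = q"
    and cq: "\<And>d. d * p = p * d \<Longrightarrow> d * q = q * d" and cr: "\<And>d. d * p = p * d \<Longrightarrow> d * r = r * d"
    by (rule selfadjoint_abs[OF assms]) blast
  have pq: "p * q = q * p" using cq[of p] by simp
  have pr: "p * r = r * p" using cr[of p] by simp
  define m where "m = q - p"
  have mm: "m * m = 2 *\<^sub>R (q * m)"
    unfolding m_def by (simp add: algebra_simps pq q(2) scaleR_2)
  have pm: "p * m = - (q * m)"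
    unfolding m_def by (simp add: algebra_simps pq q(2))
  have mr: "m * r = r * m"
    unfolding m_def by (simp add: algebra_simps pr r(2)[symmetric])
  have "m * p = p * m" unfolding m_def by (simp add: algebra_simps pq)
  then have "m * p * m = p * (m * m)" by (simp add: mult.assoc)
  also have "\<dots> = 2 *\<^sub>R (p * m * q)"
  proof -
    have "m * q = q * m" unfolding m_def by (simp add: algebra_simps pq)
    then show ?thesis by (simp add: mm mult.assoc)
  qed
  also have "\<dots> = - (2 *\<^sub>R (q * m) * q)" by (simp add: pm)
  also have "2 *\<^sub>R (q * m) * q = m * m * q" by (simp add: mm)
  also have "\<dots> = (r * m) * (r * m)"
    using mr r(2) by (metis mult.assoc)
  finally have 1: "m * p * m = - ((r * m) * (r * m))" .
  have 2: "square p" if "r * m = 0"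
  proof -
    have "q * m = 0" using that r(2) by (metis mult.assoc mult_zero_right)
    then have "m * m = 0" using mm by simp
    then have "m = 0" using square_selfadjoint_eq_0[of m] q assms by (simp add: m_def star_diff)
    then show ?thesis using r squareI[of r] by (simp add: m_def)
  qed
  have 3: "d * m = m * d" if "d * p = p * d" for d
    using cq[OF that] that by (simp add: m_def algebra_simps)
  have sm: "star m = m" by (simp add: m_def star_diff q(1) assms)
  have "star (r * m) = r * m" by (simp add: star_mult r(1) sm mr)
  then show ?thesis by (rule that[OF sm _ 1 2 3])
qed

text \<open>Let \<open>T = \<parallel>c\<parallel>\<^sup>2\<close>. Since \<open>c c\<^sup>* - w\<^sup>2 = c c\<^sup>* + c\<^sup>* c\<close> is a sum of squares, so is \<open>c c\<^sup>*\<close>, and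
  \<open>\<parallel>T - c c\<^sup>*\<parallel> \<le> T\<close>, so \<open>c\<^sup>* (T - c c\<^sup>*)\<^sup>2 c\<close> has norm at most \<open>T\<^sup>3\<close>. But it equals \<open>-w\<^sup>2 (T + w\<^sup>2)\<^sup>2\<close>,
  which dominates \<open>2Tw\<^sup>4\<close> in norm, and \<open>\<parallel>2Tw\<^sup>4\<parallel> = 2T\<^sup>3\<close>.\<close>

lemma no_negative_star_mult_self:
  fixes c :: "'a::unital_cstar_algebra"
  assumes "star c * c = - (w * w)" and w: "star w = w"
  shows "c = 0"
proof -
  define T where "T = norm (w * w)"
  have cc: "(norm c)\<^sup>2 = T" using cstar_identity[of c] by (simp add: assms T_def)
  define u v where "u = (1/2) *\<^sub>R (c + star c)" and "v = (-\<i>/2) *\<^sub>C (c - star c)"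
  have su: "star u = u" by (simp add: u_def star_simps add.commute)
  have sv: "star v = v" by (simp add: v_def star_simps scaleC_diff_right scaleC_minus_left)
  have uu: "4 *\<^sub>R (u * u) = (c + star c) * (c + star c)" unfolding u_def by simp
  have vv: "4 *\<^sub>R (v * v) = - ((c - star c) * (c - star c))"
  proof -
    have "4 *\<^sub>R (v * v) = (4 * ((-\<i>/2) * (-\<i>/2))) *\<^sub>C ((c - star c) * (c - star c))"
      unfolding v_def by (simp only: mult_scaleC_left mult_scaleC_right scaleC_scaleC scaleR_scaleC) simp
    then show ?thesis by simp
  qed
  have "4 *\<^sub>R (u * u + v * v) = 2 *\<^sub>R (c * star c + star c * c)"
    by (simp add: scaleR_add_right uu vv) (simp add: algebra_simps scaleR_2)
  then have "(1/2) *\<^sub>R (4 *\<^sub>R (u * u + v * v)) = (1/2) *\<^sub>R (2 *\<^sub>R (c * star c + star c * c))" by simp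
  then have "c * star c = 2 *\<^sub>R (u * u + v * v) + w * w"
    by (simp add: assms(1))
  then have sq: "square (c * star c)"
    by (simp add: square_add square_scaleR squareI su sv w)
  have ncc: "norm (c * star c) = T" using cc norm_mult_star_self[of c] by simp
  define k where "k = T *\<^sub>R 1 - c * star c"
  have nk: "norm k \<le> T" using square_norm_diff_le[OF sq] by (simp add: k_def ncc)
  have kc: "k * c = c * (T *\<^sub>R 1 + w * w)"
    using assms(1) by (simp add: k_def algebra_simps)
  have "star c * (k * (k * c)) = (star c * c) * (T *\<^sub>R 1 + w * w) * (T *\<^sub>R 1 + w * w)"
    by (metis kc mult.assoc)
  then have eq: "star c * (k * (k * c)) = - (w * w * (T *\<^sub>R 1 + w * w) * (T *\<^sub>R 1 + w * w))"
    by (simp add: assms(1))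
  have "norm (star c * (k * (k * c))) \<le> norm c * (norm k * (norm k * norm c))"
  proof -
    have "norm (k * (k * c)) \<le> norm k * (norm k * norm c)"
      by (rule order_trans[OF norm_mult_ineq]) (simp add: norm_mult_ineq mult_left_mono)
    then show ?thesis
      by (intro order_trans[OF norm_mult_ineq]) (simp add: mult_left_mono)
  qed
  also have "\<dots> = (norm c)\<^sup>2 * (norm k * norm k)" by (simp add: power2_eq_square)
  also have "\<dots> \<le> T * (T * T)"
    unfolding cc by (intro mult_left_mono mult_mono nk) (use nk cc in auto)
  finally have up: "norm (w * w * (T *\<^sub>R 1 + w * w) * (T *\<^sub>R 1 + w * w)) \<le> T * (T * T)"
    by (simp add: eq)
  have T0: "T \<ge> 0" by (simp add: T_def)
  have nw4: "norm ((w * w) * (w * w)) = T * T"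
    using norm_square_selfadjoint[of "w * w"] w by (simp add: star_mult T_def power2_eq_square)
  have "norm ((2 * T) *\<^sub>R ((w * w) * (w * w)))
      \<le> norm (w * w * (T *\<^sub>R 1 + w * w) * (T *\<^sub>R 1 + w * w))"
  proof (rule square_norm_mono)
    show "square ((2 * T) *\<^sub>R ((w * w) * (w * w)))"
      using T0 w by (intro square_scaleR squareI) (auto simp: star_mult)
    have "w * w * (T *\<^sub>R 1 + w * w) * (T *\<^sub>R 1 + w * w) - (2 * T) *\<^sub>R ((w * w) * (w * w))
      = (T * T) *\<^sub>R (w * w) + (w * w * w) * (w * w * w)"
      by (simp add: algebra_simps scaleR_add_left[symmetric])
    moreover have "square ((w * w * w) * (w * w * w))"
      by (rule squareI) (simp add: star_mult w mult.assoc)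
    ultimately show "square (w * w * (T *\<^sub>R 1 + w * w) * (T *\<^sub>R 1 + w * w) - (2 * T) *\<^sub>R ((w * w) * (w * w)))"
      using T0 by (simp add: square_add square_scaleR squareI w)
  qed
  then have "2 * T * (T * T) \<le> T * (T * T)" using up nw4 T0 by simp
  then have "T * (T * T) \<le> 0" by simp
  then have "T = 0" using T0 mult_pos_pos[of T "T * T"] mult_pos_pos[of T T] by fastforce
  then show ?thesis using cc by simp
qed

text \<open>Kaplansky's theorem. With \<open>m\<close> and \<open>w\<close> as in \<open>negative_part\<close> for \<open>x = b\<^sup>*b\<close>, the element \<open>c = bm\<close> has
  \<open>c\<^sup>*c = -w\<^sup>2\<close>, so \<open>no_negative_star_mult_self\<close> gives \<open>c = 0\<close>, and then \<open>w = 0\<close>.\<close>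

theorem positive_iff_square: "positive (x::'a::unital_cstar_algebra) \<longleftrightarrow> square x"
proof
  assume "square x" then show "positive x" unfolding square_def positive_def by metis
next
  assume "positive x"
  then obtain b where b: "x = star b * b" unfolding positive_def by auto
  have sx: "star x = x" by (simp add: b star_mult star_star)
  obtain m w where mw: "star m = m" "star w = w" "m * x * m = - (w * w)" "w = 0 \<Longrightarrow> square x"
    by (rule negative_part[OF sx]) blast
  have "star (b * m) * (b * m) = - (w * w)" using mw b by (simp add: star_mult mult.assoc)
  then have bm: "b * m = 0" using no_negative_star_mult_self mw(2) by blast
  have "m * x * m = star (b * m) * (b * m)" using mw b by (simp add: star_mult mult.assoc)
  then have "w * w = 0" using bm mw(3) by simp
  then show "square x" using mw square_selfadjoint_eq_0 by blast
qed

lemma positive_star_mult_self: "positive (star b * (b::'a::unital_cstar_algebra))"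
  unfolding positive_def by auto

lemma positive_selfadjoint: "positive (x::'a::unital_cstar_algebra) \<Longrightarrow> star x = x"
  by (simp add: positive_iff_square square_selfadjoint)

lemma positive_add: "positive (x::'a::unital_cstar_algebra) \<Longrightarrow> positive y \<Longrightarrow> positive (x + y)"
  by (simp add: positive_iff_square square_add)

lemma positive_scaleR: "positive (x::'a::unital_cstar_algebra) \<Longrightarrow> r \<ge> 0 \<Longrightarrow> positive (r *\<^sub>R x)"
  by (simp add: positive_iff_square square_scaleR)

lemma positive_zero [simp]: "positive (0::'a::unital_cstar_algebra)"
  using positive_star_mult_self[of 0] by simp

lemma positive_one [simp]: "positive (1::'a::unital_cstar_algebra)"
  using positive_star_mult_self[of 1] by simp

lemma positive_sum: "(\<And>i. i \<in> I \<Longrightarrow> positive (f i::'a::unital_cstar_algebra)) \<Longrightarrow> positive (sum f I)"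
  by (induction I rule: infinite_finite_induct) (auto simp: positive_add)

lemma positive_mult:
  "positive (x::'a::unital_cstar_algebra) \<Longrightarrow> positive y \<Longrightarrow> x * y = y * x \<Longrightarrow> positive (x * y)"
  by (simp add: positive_iff_square square_mult)

lemma positive_conjugate:
  assumes "positive (x::'a::unital_cstar_algebra)"
  shows "positive (star b * x * b)"
proof -
  obtain d where "x = star d * d" using assms by (auto simp: positive_def)
  then have "star b * x * b = star (d * b) * (d * b)" by (simp add: star_mult mult.assoc)
  then show ?thesis by (metis positive_star_mult_self)
qed

lemma positive_norm_diff:
  "star (x::'a::unital_cstar_algebra) = x \<Longrightarrow> norm x \<le> t \<Longrightarrow> positive (t *\<^sub>R 1 - x)"
  by (simp add: positive_iff_square square_norm_diff)

lemma positive_norm_sq_diff: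
  "norm (a::'a::unital_cstar_algebra) \<le> t \<Longrightarrow> positive (t\<^sup>2 *\<^sub>R 1 - star a * a)"
  by (rule positive_norm_diff)
    (auto simp: star_mult star_star cstar_identity power_mono)

lemma positive_norm_mono:
  "positive (a::'a::unital_cstar_algebra) \<Longrightarrow> positive (b - a) \<Longrightarrow> norm a \<le> norm b"
  by (simp add: positive_iff_square square_norm_mono)

lemma positive_root:
  assumes "positive (h::'a::unital_cstar_algebra)"
  obtains u where "star u = u" "positive u" "u * u = h" "\<And>d. d * h = h * d \<Longrightarrow> d * u = u * d"
proof (rule square_root[OF assms[unfolded positive_iff_square]])
  fix u assume u: "star u = u" "square u" "u * u = h" "\<And>d. d * h = h * d \<Longrightarrow> d * u = u * d"
  show ?thesis by (rule that[OF u(1) u(2)[folded positive_iff_square] u(3,4)])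
qed

text \<open>Up to the factor \<open>T = \<parallel>s\<parallel> + \<epsilon>\<close>, the element is \<open>1 - z\<close> with \<open>\<parallel>z\<parallel> < 1\<close>; the inverse is a Neumann
  series.\<close>

lemma positive_plus_pos_invertible:
  fixes s :: "'a::unital_cstar_algebra"
  assumes "positive s" "\<epsilon> > 0"
  obtains i where "i * (s + \<epsilon> *\<^sub>R 1) = 1" "(s + \<epsilon> *\<^sub>R 1) * i = 1"
    "\<And>d. d * s = s * d \<Longrightarrow> d * i = i * d"
proof -
  define T where "T = norm s + \<epsilon>"
  have T: "T > 0" using assms(2) by (simp add: T_def add_nonneg_pos)
  define z where "z = (1/T) *\<^sub>R (norm s *\<^sub>R 1 - s)"
  have "norm (norm s *\<^sub>R 1 - s) \<le> norm s"
    using assms(1) by (simp add: positive_iff_square square_norm_diff_le)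
  then have "norm z < 1" using T assms(2) by (simp add: z_def T_def)
  then have sg: "summable (\<lambda>n. z ^ n)"
    by (intro summable_comparison_test'[OF summable_geometric[of "norm z"], of 0])
      (simp_all add: norm_power_ineq)
  define G where "G = (\<Sum>n. z ^ n)"
  have zG: "z * G = G - 1" "G * z = G - 1"
  proof -
    have "z * G = (\<Sum>n. z * z ^ n)" unfolding G_def
      by (rule bounded_linear.suminf[OF bounded_linear_mult_right sg])
    then show "z * G = G - 1" using suminf_split_head[OF sg] by (simp add: G_def)
    have "G * z = (\<Sum>n. z ^ n * z)" unfolding G_def
      by (rule bounded_linear.suminf[OF bounded_linear_mult_left sg])
    then show "G * z = G - 1" using suminf_split_head[OF sg] by (simp add: G_def power_commutes)
  qed
  have sz: "s + \<epsilon> *\<^sub>R 1 = T *\<^sub>R (1 - z)"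
  proof -
    have "T *\<^sub>R z = norm s *\<^sub>R 1 - s" using T by (simp add: z_def)
    then have "s = norm s *\<^sub>R 1 - T *\<^sub>R z" by simp
    then show ?thesis by (simp add: T_def scaleR_diff_right scaleR_add_left)
  qed
  show ?thesis
  proof (rule that[of "(1/T) *\<^sub>R G"])
    show "(1/T) *\<^sub>R G * (s + \<epsilon> *\<^sub>R 1) = 1"
      using T zG by (simp add: sz right_diff_distrib scaleR_diff_right)
    show "(s + \<epsilon> *\<^sub>R 1) * (1/T) *\<^sub>R G = 1"
      using T zG by (simp add: sz left_diff_distrib scaleR_diff_right)
    show "d * (1/T) *\<^sub>R G = (1/T) *\<^sub>R G * d" if "d * s = s * d" for d
    proof -
      have "d * z = z * d" using that by (simp add: z_def algebra_simps)
      then have "d * z ^ n = z ^ n * d" for n using power_commuting_commutes[of z d n] by simp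
      moreover have "d * G = (\<Sum>n. d * z ^ n)" unfolding G_def
        by (rule bounded_linear.suminf[OF bounded_linear_mult_right sg])
      moreover have "G * d = (\<Sum>n. z ^ n * d)" unfolding G_def
        by (rule bounded_linear.suminf[OF bounded_linear_mult_left sg])
      ultimately show ?thesis by simp
    qed
  qed
qed

section \<open>States\<close>

lemma positive_complex_iff: "positive (z::complex) \<longleftrightarrow> Im z = 0 \<and> Re z \<ge> 0"
proof
  assume "positive z"
  then obtain b :: complex where "z = cnj b * b" by (auto simp: positive_def star_complex_def)
  then show "Im z = 0 \<and> Re z \<ge> 0" by (simp add: mult.commute)
next
  assume z: "Im z = 0 \<and> Re z \<ge> 0"
  then have "z = star (complex_of_real (sqrt (Re z))) * complex_of_real (sqrt (Re z))"
    by (simp add: star_complex_def complex_eq_iff)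
  then show "positive z" unfolding positive_def by blast
qed

lemma cartesian_decomposition:
  fixes a :: "'a::unital_cstar_algebra"
  obtains u v where "star u = u" "star v = v" "a = u + \<i> *\<^sub>C v"
    "u = (1/2) *\<^sub>C (a + star a)" "v = (-\<i>/2) *\<^sub>C (a - star a)"
proof -
  let ?u = "(1/2) *\<^sub>C (a + star a)" and ?v = "(-\<i>/2) *\<^sub>C (a - star a)"
  have 1: "star ?u = ?u" by (simp add: star_simps add.commute)
  have 2: "star ?v = ?v" by (simp add: star_simps scaleC_diff_right scaleC_minus_left)
  have "?u + \<i> *\<^sub>C ?v = (1/2) *\<^sub>C (a + star a) + (1/2) *\<^sub>C (a - star a)"
    by (simp only: scaleC_scaleC) simp
  also have "\<dots> = (1/2) *\<^sub>C a + (1/2) *\<^sub>C a" by (simp add: scaleC_add_right scaleC_diff_right)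
  also have "\<dots> = (1/2 + 1/2) *\<^sub>C a" by (simp only: scaleC_add_left)
  also have "\<dots> = a" by simp
  finally have "a = ?u + \<i> *\<^sub>C ?v" ..
  then show ?thesis by (rule that[OF 1 2 _ refl refl])
qed

lemma
  assumes "state \<phi>"
  shows state_add: "\<phi> (a + b) = \<phi> a + \<phi> b"
    and state_scaleC: "\<phi> (c *\<^sub>C a) = c * \<phi> a"
    and state_Re_nonneg: "0 \<le> Re (\<phi> (star a * a))"
    and state_Im_zero: "Im (\<phi> (star a * a)) = 0"
    and state_one: "\<phi> 1 = 1"
  using assms by (simp_all add: state_def linear_on_def scaleC_complex_def positive_complex_iff)

lemma state_scaleR: "state \<phi> \<Longrightarrow> \<phi> (r *\<^sub>R a) = complex_of_real r * \<phi> a"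
  by (simp add: scaleR_scaleC state_scaleC)

lemma state_zero: "state \<phi> \<Longrightarrow> \<phi> 0 = 0"
  using state_scaleC[of \<phi> 0 0] by simp

lemma state_minus: "state \<phi> \<Longrightarrow> \<phi> (- a) = - \<phi> a"
  using state_scaleC[of \<phi> "- 1" a] by simp

lemma state_diff: "state \<phi> \<Longrightarrow> \<phi> (a - b) = \<phi> a - \<phi> b"
  using state_add[of \<phi> a "- b"] by (simp add: state_minus)

lemma state_sum: "state \<phi> \<Longrightarrow> \<phi> (sum f A) = (\<Sum>i\<in>A. \<phi> (f i))"
  by (induction A rule: infinite_finite_induct) (auto simp: state_add state_zero)

lemma state_positive: "state \<phi> \<Longrightarrow> positive p \<Longrightarrow> Im (\<phi> p) = 0 \<and> Re (\<phi> p) \<ge> 0"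
  by (auto simp: positive_def state_Re_nonneg state_Im_zero)

lemma state_selfadjoint: 
  assumes "state \<phi>" "star h = h"
  shows "Im (\<phi> h) = 0"
proof -
  have "Im (\<phi> (norm h *\<^sub>R 1 - h)) = 0"
    using state_positive[OF assms(1) positive_norm_diff[OF assms(2)]] by simp
  then show ?thesis by (simp add: assms(1) state_diff state_scaleR state_one)
qed

lemma state_star:
  assumes "state \<phi>"
  shows "\<phi> (star a) = cnj (\<phi> a)"
proof -
  obtain u v where uv: "star u = u" "star v = v" "a = u + \<i> *\<^sub>C v"
    by (rule cartesian_decomposition)
  have "star a = u + (- \<i>) *\<^sub>C v" by (simp add: uv star_simps)
  then show ?thesis
    using state_selfadjoint[OF assms uv(1)] state_selfadjoint[OF assms uv(2)]
    by (simp add: uv(3) assms state_add state_scaleC complex_eq_iff)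
qed

lemma cmod_mult_self: "cmod k * cmod k = Re k * Re k + Im k * Im k"
  using cmod_power2[of k] by (simp only: power2_eq_square)

text \<open>The discriminant argument behind every Cauchy-Schwarz inequality below: take \<open>c\<close> to be a real
  multiple of \<open>k\<close>. For \<open>A = 0\<close> it says that a linear term cannot be dominated by a quadratic one.\<close>

lemma quadratic_bound:
  fixes k :: complex and A B :: real
  assumes quad: "\<And>c. 0 \<le> A - 2 * Re (cnj c * k) + (cmod c)\<^sup>2 * B" and B: "B \<ge> 0"
  shows "(cmod k)\<^sup>2 \<le> A * B"
proof -
  have real: "0 \<le> A - 2 * (s * (cmod k)\<^sup>2) + s\<^sup>2 * (cmod k)\<^sup>2 * B" for s
  proof -
    have "Re (cnj (complex_of_real s * k) * k) = s * (cmod k)\<^sup>2"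
      by (simp add: cmod_mult_self power2_eq_square algebra_simps)
    moreover have "(cmod (complex_of_real s * k))\<^sup>2 = s\<^sup>2 * (cmod k)\<^sup>2"
      by (simp add: norm_mult power_mult_distrib)
    ultimately show ?thesis using quad[of "complex_of_real s * k"] by (simp only:)
  qed
  show ?thesis
  proof (cases "B = 0")
    case True
    show ?thesis
    proof (rule ccontr)
      assume "\<not> ?thesis"
      then have k: "(cmod k)\<^sup>2 > 0" using True by simp
      show False using real[of "(A + 1) / (2 * (cmod k)\<^sup>2)"] k True by (simp add: field_simps)
    qed
  next
    case False
    with B have B: "B > 0" by simp
    have "0 \<le> A - (cmod k)\<^sup>2 / B" using real[of "1 / B"] B
      by (simp add: field_simps power2_eq_square)
    then show ?thesis using B by (simp add: field_simps)
  qed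
qed

lemma state_Cauchy_Schwarz:
  assumes "state \<phi>"
  shows "(cmod (\<phi> (star b * a)))\<^sup>2 \<le> Re (\<phi> (star a * a)) * Re (\<phi> (star b * b))"
proof (rule quadratic_bound)
  fix c
  have ab: "\<phi> (star a * b) = cnj (\<phi> (star b * a))"
    using state_star[OF assms, of "star b * a"] by (simp add: star_mult star_star)
  have "star (a - c *\<^sub>C b) * (a - c *\<^sub>C b)
    = star a * a - c *\<^sub>C (star a * b) - cnj c *\<^sub>C (star b * a) + (c * cnj c) *\<^sub>C (star b * b)"
    by (simp add: star_simps left_diff_distrib right_diff_distrib mult_scaleC_left
        mult_scaleC_right scaleC_scaleC scaleC_diff_right)
  then have "\<phi> (star (a - c *\<^sub>C b) * (a - c *\<^sub>C b)) = \<phi> (star a * a)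
      - c * cnj (\<phi> (star b * a)) - cnj c * \<phi> (star b * a) + (c * cnj c) * \<phi> (star b * b)"
    using assms by (simp add: state_add state_diff state_scaleC ab)
  also have "Re \<dots> = Re (\<phi> (star a * a)) - 2 * Re (cnj c * \<phi> (star b * a))
      + (cmod c)\<^sup>2 * Re (\<phi> (star b * b))"
    using state_Im_zero[OF assms, of b]
    by (simp add: cmod_mult_self power2_eq_square algebra_simps)
  finally show "0 \<le> Re (\<phi> (star a * a)) - 2 * Re (cnj c * \<phi> (star b * a))
      + (cmod c)\<^sup>2 * Re (\<phi> (star b * b))"
    using state_Re_nonneg[OF assms, of "a - c *\<^sub>C b"] by simp
qed (rule state_Re_nonneg[OF assms])

lemma state_left_mult_le:
  assumes "state \<phi>"
  shows "Re (\<phi> (star (a * x) * (a * x))) \<le> (norm a)\<^sup>2 * Re (\<phi> (star x * x))"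
proof -
  have "positive (star x * ((norm a)\<^sup>2 *\<^sub>R 1 - star a * a) * x)"
    by (rule positive_conjugate[OF positive_norm_sq_diff]) simp
  also have "star x * ((norm a)\<^sup>2 *\<^sub>R 1 - star a * a) * x
      = (norm a)\<^sup>2 *\<^sub>R (star x * x) - star (a * x) * (a * x)"
    by (simp add: star_mult algebra_simps)
  finally have "Re (\<phi> ((norm a)\<^sup>2 *\<^sub>R (star x * x) - star (a * x) * (a * x))) \<ge> 0"
    using state_positive[OF assms] by blast
  then show ?thesis by (simp add: assms state_diff state_scaleR)
qed

lemma gns_seminorm_nonneg: "state \<phi> \<Longrightarrow> gns_seminorm \<phi> a \<ge> 0"
  by (simp add: gns_seminorm_def state_Re_nonneg)

lemma gns_seminorm_sq: "state \<phi> \<Longrightarrow> (gns_seminorm \<phi> a)\<^sup>2 = Re (\<phi> (star a * a))"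
  by (simp add: gns_seminorm_def state_Re_nonneg)

lemma gns_seminorm_sq_complex:
  "state \<phi> \<Longrightarrow> \<phi> (star a * a) = complex_of_real ((gns_seminorm \<phi> a)\<^sup>2)"
  by (simp add: gns_seminorm_sq complex_eq_iff state_Im_zero)

lemma gns_Cauchy_Schwarz:
  assumes "state \<phi>"
  shows "cmod (\<phi> (star b * a)) \<le> gns_seminorm \<phi> a * gns_seminorm \<phi> b"
proof -
  have "(cmod (\<phi> (star b * a)))\<^sup>2 \<le> (gns_seminorm \<phi> a * gns_seminorm \<phi> b)\<^sup>2"
    using state_Cauchy_Schwarz[OF assms] by (simp add: power_mult_distrib gns_seminorm_sq[OF assms])
  then show ?thesis
    by (rule power2_le_imp_le) (simp add: gns_seminorm_nonneg assms)
qed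

lemma gns_seminorm_left_mult:
  assumes "state \<phi>"
  shows "gns_seminorm \<phi> (a * x) \<le> norm a * gns_seminorm \<phi> x"
proof -
  have "(gns_seminorm \<phi> (a * x))\<^sup>2 \<le> (norm a * gns_seminorm \<phi> x)\<^sup>2"
    using state_left_mult_le[OF assms, of a x] by (simp add: power_mult_distrib gns_seminorm_sq[OF assms])
  then show ?thesis by (rule power2_le_imp_le) (simp add: gns_seminorm_nonneg assms)
qed

lemma gns_seminorm_one: "state \<phi> \<Longrightarrow> gns_seminorm \<phi> 1 = 1"
  by (simp add: gns_seminorm_def state_one)

lemma gns_seminorm_le_norm: "state \<phi> \<Longrightarrow> gns_seminorm \<phi> a \<le> norm a"
  using gns_seminorm_left_mult[of \<phi> a 1] by (simp add: gns_seminorm_one)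

lemma state_norm_le: "state \<phi> \<Longrightarrow> cmod (\<phi> a) \<le> gns_seminorm \<phi> a"
  using gns_Cauchy_Schwarz[of \<phi> 1 a] by (simp add: gns_seminorm_one)

lemma state_contractive: "state \<phi> \<Longrightarrow> cmod (\<phi> a) \<le> norm a"
  using state_norm_le gns_seminorm_le_norm order_trans by blast

lemma gns_seminorm_scaleC: "state \<phi> \<Longrightarrow> gns_seminorm \<phi> (c *\<^sub>C a) = cmod c * gns_seminorm \<phi> a"
proof -
  assume s: "state \<phi>"
  have "\<phi> (star (c *\<^sub>C a) * (c *\<^sub>C a)) = complex_of_real ((cmod c)\<^sup>2) * \<phi> (star a * a)"
    by (simp add: star_simps mult_scaleC_left mult_scaleC_right scaleC_scaleC state_scaleC[OF s]
        complex_norm_square[symmetric] mult.commute[of "cnj c" c] del: of_real_power)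
  then have "(gns_seminorm \<phi> (c *\<^sub>C a))\<^sup>2 = (cmod c * gns_seminorm \<phi> a)\<^sup>2"
    by (simp add: gns_seminorm_sq[OF s] power_mult_distrib)
  then show ?thesis by (rule power2_eq_imp_eq) (simp_all add: gns_seminorm_nonneg s)
qed

lemma gns_seminorm_minus: "state \<phi> \<Longrightarrow> gns_seminorm \<phi> (- a) = gns_seminorm \<phi> a"
  using gns_seminorm_scaleC[of \<phi> "- 1" a] by simp

lemma gns_seminorm_zero: "state \<phi> \<Longrightarrow> gns_seminorm \<phi> 0 = 0"
  by (simp add: gns_seminorm_def state_zero)

lemma gns_seminorm_triangle:
  assumes s: "state \<phi>"
  shows "gns_seminorm \<phi> (a + b) \<le> gns_seminorm \<phi> a + gns_seminorm \<phi> b"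
proof -
  have "\<phi> (star (a + b) * (a + b)) = \<phi> (star a * a) + \<phi> (star b * a) + \<phi> (star a * b) + \<phi> (star b * b)"
    by (simp add: star_add algebra_simps state_add[OF s])
  moreover have "Re (\<phi> (star b * a)) \<le> gns_seminorm \<phi> a * gns_seminorm \<phi> b"
    "Re (\<phi> (star a * b)) \<le> gns_seminorm \<phi> a * gns_seminorm \<phi> b"
    using gns_Cauchy_Schwarz[OF s, of b a] gns_Cauchy_Schwarz[OF s, of a b]
      complex_Re_le_cmod[of "\<phi> (star b * a)"] complex_Re_le_cmod[of "\<phi> (star a * b)"]
    by (auto simp: mult.commute)
  ultimately have "(gns_seminorm \<phi> (a + b))\<^sup>2 \<le> (gns_seminorm \<phi> a + gns_seminorm \<phi> b)\<^sup>2"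
    by (simp add: gns_seminorm_sq[OF s] power2_sum)
  then show ?thesis by (rule power2_le_imp_le) (simp add: gns_seminorm_nonneg s)
qed

lemma gns_seminorm_commute: "state \<phi> \<Longrightarrow> gns_seminorm \<phi> (a - b) = gns_seminorm \<phi> (b - a)"
  using gns_seminorm_minus[of \<phi> "a - b"] by simp

lemma gns_seminorm_triangle_diff:
  "state \<phi> \<Longrightarrow> gns_seminorm \<phi> (a - c) \<le> gns_seminorm \<phi> (a - b) + gns_seminorm \<phi> (b - c)"
  using gns_seminorm_triangle[of \<phi> "a - b" "b - c"] by simp

section \<open>Maximal abelian subalgebras and their characters\<close>

text \<open>The double commutant of a commuting self-adjoint set is an abelian C*-algebra that contains the
  set; it is the larger algebra against which maximality is tested.\<close>

definition commutant :: "'a::unital_cstar_algebra set \<Rightarrow> 'a set"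
  where "commutant S = {x. \<forall>s\<in>S. x * s = s * x}"

lemma commutantD: "x \<in> commutant S \<Longrightarrow> s \<in> S \<Longrightarrow> x * s = s * x"
  by (simp add: commutant_def)

lemma commutantI: "(\<And>s. s \<in> S \<Longrightarrow> x * s = s * x) \<Longrightarrow> x \<in> commutant S"
  by (simp add: commutant_def)

lemma cstar_subalgebra_commutant:
  assumes "\<And>s. s \<in> S \<Longrightarrow> star s \<in> S"
  shows "cstar_subalgebra (commutant S)"
proof -
  have "commutant S = (\<Inter>s\<in>S. {x. x * s = s * x})"
    unfolding commutant_def by blast
  moreover have "closed {x. x * s = s * x}" for s :: 'a
    by (intro closed_Collect_eq continuous_intros)
  ultimately have "closed (commutant S)" by (simp add: closed_INT)
  moreover have "star x \<in> commutant S" if x: "x \<in> commutant S" for x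
  proof (rule commutantI)
    fix s assume "s \<in> S"
    then have "star (x * star s) = star (star s * x)" using commutantD[OF x assms] by simp
    then show "star x * s = s * star x" by (simp add: star_mult star_star)
  qed
  moreover have "x * y \<in> commutant S" if x: "x \<in> commutant S" and y: "y \<in> commutant S" for x y
  proof (rule commutantI)
    fix s assume "s \<in> S"
    have "x * y * s = x * (s * y)" using commutantD[OF y \<open>s \<in> S\<close>] by (simp add: mult.assoc)
    also have "\<dots> = s * x * y" using commutantD[OF x \<open>s \<in> S\<close>] by (simp flip: mult.assoc)
    finally show "x * y * s = s * (x * y)" by (simp add: mult.assoc)
  qed
  moreover have "x + y \<in> commutant S" if x: "x \<in> commutant S" and y: "y \<in> commutant S" for x y
    by (rule commutantI) (simp add: ring_distribs commutantD[OF x] commutantD[OF y])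
  moreover have "c *\<^sub>C x \<in> commutant S" if x: "x \<in> commutant S" for x c
    by (rule commutantI) (simp add: mult_scaleC_left mult_scaleC_right commutantD[OF x])
  moreover have "0 \<in> commutant S" by (simp add: commutant_def)
  ultimately show ?thesis
    unfolding cstar_subalgebra_def star_subalgebra_def subalgebra_def
    by (intro conjI ballI allI) simp_all
qed

locale masa =
  fixes M :: "'a::unital_cstar_algebra set"
  assumes maximal: "maximal_abelian M" and one_in: "1 \<in> M"
begin

lemma subalgebra_closed:
  shows zero_in: "0 \<in> M"
    and add_in: "a \<in> M \<Longrightarrow> b \<in> M \<Longrightarrow> a + b \<in> M"
    and mult_in: "a \<in> M \<Longrightarrow> b \<in> M \<Longrightarrow> a * b \<in> M"
    and scaleC_in: "a \<in> M \<Longrightarrow> c *\<^sub>C a \<in> M"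
    and star_in: "a \<in> M \<Longrightarrow> star a \<in> M"
    and comm: "a \<in> M \<Longrightarrow> b \<in> M \<Longrightarrow> a * b = b * a"
  using maximal
  unfolding maximal_abelian_def cstar_subalgebra_def star_subalgebra_def subalgebra_def abelian_def
  by simp_all

lemma scaleR_in: "a \<in> M \<Longrightarrow> r *\<^sub>R a \<in> M"
  by (simp add: scaleR_scaleC scaleC_in)

lemma minus_in: "a \<in> M \<Longrightarrow> - a \<in> M"
  using scaleC_in[of a "- 1"] by simp

lemma diff_in: "a \<in> M \<Longrightarrow> b \<in> M \<Longrightarrow> a - b \<in> M"
  using add_in[of a "- b"] minus_in by simp

lemmas M_intros = zero_in one_in add_in mult_in scaleC_in star_in scaleR_in minus_in diff_in

lemma selfadjoint_commuting_in:
  assumes su: "star u = u" and u: "\<And>h. h \<in> M \<Longrightarrow> h * u = u * h"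
  shows "u \<in> M"
proof -
  (* The double commutant B of S is abelian because it is contained in the commutant of S. *)
  define S where "S = insert u M"
  have S: "star s \<in> S" if "s \<in> S" for s using that su star_in unfolding S_def by fastforce
  have CS: "star s \<in> commutant S" if "s \<in> commutant S" for s
    using cstar_subalgebra_commutant[OF S] that
    unfolding cstar_subalgebra_def star_subalgebra_def by blast
  define B where "B = commutant (commutant S)"
  have SC: "S \<subseteq> commutant S"
  proof
    fix a assume "a \<in> S"
    show "a \<in> commutant S"
    proof (rule commutantI)
      fix b assume "b \<in> S"
      with \<open>a \<in> S\<close> consider "a = u" "b = u" | "a = u" "b \<in> M" | "a \<in> M" "b = u" | "a \<in> M" "b \<in> M"
        by (auto simp: S_def)
      then show "a * b = b * a"
      proof cases
        case 2 then show ?thesis using u[of b] by simp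
      next
        case 3 then show ?thesis using u[of a] by simp
      next
        case 4 then show ?thesis by (rule comm)
      qed simp
    qed
  qed
  have SB: "S \<subseteq> B" unfolding B_def
    by (intro subsetI commutantI) (rule commutantD[symmetric])
  have BC: "B \<subseteq> commutant S" unfolding B_def
  proof (intro subsetI commutantI)
    fix a s assume "a \<in> commutant (commutant S)" "s \<in> S"
    then show "a * s = s * a" using commutantD subsetD[OF SC] by blast
  qed
  have "cstar_subalgebra B" unfolding B_def by (rule cstar_subalgebra_commutant[OF CS])
  moreover have "abelian B" unfolding abelian_def
  proof (intro ballI)
    fix a b assume a: "a \<in> B" and b: "b \<in> B"
    show "a * b = b * a" by (rule commutantD[OF a[unfolded B_def] subsetD[OF BC b]])
  qed
  moreover have "M \<subseteq> B" using SB by (simp add: S_def)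
  ultimately have "B = M" using maximal unfolding maximal_abelian_def by blast
  then show ?thesis using SB by (simp add: S_def)
qed

lemma commuting_in:
  assumes "\<And>h. h \<in> M \<Longrightarrow> h * z = z * h"
  shows "z \<in> M"
proof -
  obtain u v where uv: "star u = u" "star v = v" "z = u + \<i> *\<^sub>C v"
    "u = (1/2) *\<^sub>C (z + star z)" "v = (-\<i>/2) *\<^sub>C (z - star z)"
    by (rule cartesian_decomposition)
  have s: "h * star z = star z * h" if "h \<in> M" for h
  proof -
    have "star (star h * z) = star (z * star h)" using assms[OF star_in[OF that]] by simp
    then show ?thesis by (simp add: star_mult star_star)
  qed
  have "u \<in> M" by (rule selfadjoint_commuting_in[OF uv(1)])
      (simp add: uv(4) mult_scaleC_left mult_scaleC_right ring_distribs assms s)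
  moreover have "v \<in> M" by (rule selfadjoint_commuting_in[OF uv(2)])
      (simp add: uv(5) mult_scaleC_left mult_scaleC_right left_diff_distrib right_diff_distrib assms s)
  ultimately show ?thesis by (simp add: uv(3) M_intros)
qed

lemma positive_root_in:
  assumes "p \<in> M" "positive p"
  obtains u where "u \<in> M" "star u = u" "u * u = p"
proof (rule positive_root[OF assms(2)])
  fix u assume u: "star u = u" "u * u = p" "\<And>d. d * p = p * d \<Longrightarrow> d * u = u * d"
  have "u \<in> M" by (rule commuting_in, rule u(3), rule comm) (use assms(1) in auto)
  then show ?thesis using that u by blast
qed

abbreviation "X \<equiv> gelfand_space M"

lemma
  assumes "x \<in> X"
  shows char_add: "a \<in> M \<Longrightarrow> b \<in> M \<Longrightarrow> x (a + b) = x a + x b"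
    and char_scaleC: "a \<in> M \<Longrightarrow> x (c *\<^sub>C a) = c * x a"
    and char_mult: "a \<in> M \<Longrightarrow> b \<in> M \<Longrightarrow> x (a * b) = x a * x b"
  using assms
  by (auto simp: gelfand_space_def homomorphism_on_def linear_on_def scaleC_complex_def)

lemma char_scaleR: "x \<in> X \<Longrightarrow> a \<in> M \<Longrightarrow> x (r *\<^sub>R a) = complex_of_real r * x a"
  by (simp add: scaleR_scaleC char_scaleC)

lemma char_minus: "x \<in> X \<Longrightarrow> a \<in> M \<Longrightarrow> x (- a) = - x a"
  using char_scaleC[of x a "- 1"] by simp

lemma char_diff: "x \<in> X \<Longrightarrow> a \<in> M \<Longrightarrow> b \<in> M \<Longrightarrow> x (a - b) = x a - x b"
  using char_add[of x a "- b"] by (simp add: char_minus minus_in)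

lemma char_one: "x \<in> X \<Longrightarrow> x 1 = 1"
proof -
  assume x: "x \<in> X"
  then obtain h where h: "h \<in> M" "x h \<noteq> 0" by (auto simp: gelfand_space_def)
  have "x h = x h * x 1" using char_mult[OF x h(1) one_in] by simp
  with h show ?thesis by simp
qed

lemma char_zero: "x \<in> X \<Longrightarrow> x 0 = 0"
  using char_scaleC[of x 0 0] by (simp add: zero_in)

text \<open>If \<open>x u\<close> were not real, then \<open>(u - Re (x u))\<^sup>2 + (Im (x u))\<^sup>2\<close> would be an invertible element of
  \<open>M\<close> in the kernel of \<open>x\<close>.\<close>

lemma char_selfadjoint:
  assumes x: "x \<in> X" and u: "u \<in> M" "star u = u"
  shows "Im (x u) = 0"
proof (rule ccontr)
  assume b: "Im (x u) \<noteq> 0"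
  define w where "w = u - Re (x u) *\<^sub>R 1"
  have w: "w \<in> M" "star w = w" using u by (simp_all add: w_def M_intros star_simps)
  have pw: "positive (w * w)" by (metis w(2) positive_star_mult_self)
  have b2: "(Im (x u))\<^sup>2 > 0" using b by simp
  obtain i where i: "i * (w * w + (Im (x u))\<^sup>2 *\<^sub>R 1) = 1"
    "\<And>d. d * (w * w) = (w * w) * d \<Longrightarrow> d * i = i * d"
    by (rule positive_plus_pos_invertible[OF pw b2]) blast
  have iM: "i \<in> M" by (rule commuting_in, rule i(2), rule comm) (use w in \<open>auto simp: M_intros\<close>)
  have "x w = \<i> * Im (x u)"
    using u x by (simp add: w_def char_diff char_scaleR char_one M_intros complex_eq_iff)
  then have "x (w * w + (Im (x u))\<^sup>2 *\<^sub>R 1) = 0"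
    using x w by (simp add: char_add char_mult char_scaleR char_one M_intros complex_eq_iff power2_eq_square)
  moreover have "x i * x (w * w + (Im (x u))\<^sup>2 *\<^sub>R 1) = 1"
    using char_mult[OF x iM, of "w * w + (Im (x u))\<^sup>2 *\<^sub>R 1"] i(1) w char_one[OF x] by (simp add: M_intros)
  ultimately show False by simp
qed

lemma char_star:
  assumes x: "x \<in> X" and h: "h \<in> M"
  shows "x (star h) = cnj (x h)"
proof -
  obtain u v where uv: "star u = u" "star v = v" "h = u + \<i> *\<^sub>C v"
    "u = (1/2) *\<^sub>C (h + star h)" "v = (-\<i>/2) *\<^sub>C (h - star h)"
    by (rule cartesian_decomposition)
  have M: "u \<in> M" "v \<in> M" using h by (simp_all add: uv(4,5) M_intros)
  have "star h = u + (- \<i>) *\<^sub>C v" by (simp add: uv(1,2,3) star_simps)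
  then show ?thesis
    using char_selfadjoint[OF x M(1) uv(1)] char_selfadjoint[OF x M(2) uv(2)] M
    by (simp add: uv(3) x char_add char_scaleC char_minus M_intros complex_eq_iff)
qed

lemma char_star_mult: "x \<in> X \<Longrightarrow> h \<in> M \<Longrightarrow> x (star h * h) = complex_of_real ((cmod (x h))\<^sup>2)"
  by (simp add: char_mult star_in char_star complex_norm_square mult.commute del: of_real_power)

lemma char_positive:
  assumes "x \<in> X" "p \<in> M" "positive p"
  shows "Im (x p) = 0 \<and> Re (x p) \<ge> 0"
proof -
  obtain u where u: "u \<in> M" "star u = u" "u * u = p" by (rule positive_root_in[OF assms(2,3)])
  then have "x p = complex_of_real ((cmod (x u))\<^sup>2)" using char_star_mult[OF assms(1) u(1)] by simp
  then show ?thesis by simp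
qed

end

section \<open>Normalizers and the conditional expectation\<close>

locale cartan_pair = masa M for M :: "'a::unital_cstar_algebra set" +
  fixes E :: "'a \<Rightarrow> 'a"
  assumes cartan: "cartan_subalgebra M" and faithful: "faithful_conditional_expectation M E"
begin

lemma
  shows E_add: "E (a + b) = E a + E b"
    and E_scaleC: "E (c *\<^sub>C a) = c *\<^sub>C E a"
    and E_in: "E a \<in> M"
    and E_id: "m \<in> M \<Longrightarrow> E m = m"
    and E_positive: "positive (E (star a * a))"
    and E_left: "m \<in> M \<Longrightarrow> E (m * a) = m * E a"
    and E_right: "m \<in> M \<Longrightarrow> E (a * m) = E a * m"
    and E_faithful: "E (star a * a) = 0 \<Longrightarrow> a = 0"
  using faithful
  unfolding faithful_conditional_expectation_def conditional_expectation_def linear_on_def Ball_def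
  by (meson UNIV_I)+

lemma E_minus: "E (- a) = - E a"
  using E_scaleC[of "- 1" a] by simp

lemma E_diff: "E (a - b) = E a - E b"
  using E_add[of a "- b"] by (simp add: E_minus)

text \<open>Positivity of \<open>E\<close> gives the claim for \<open>norm h *\<^sub>R 1 - h\<close> with \<open>h\<close> self-adjoint, and linearity gives
  the rest.\<close>

lemma E_star: "E (star a) = star (E a)"
proof -
  have sa: "star (E h) = E h" if "star h = h" for h
  proof -
    have "positive (norm h *\<^sub>R 1 - h)" by (rule positive_norm_diff[OF that order_refl])
    then have "star (E (norm h *\<^sub>R 1 - h)) = E (norm h *\<^sub>R 1 - h)"
      using E_positive positive_selfadjoint by (metis positive_def)
    moreover have "E (norm h *\<^sub>R 1 - h) = norm h *\<^sub>R 1 - E h"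
      by (simp add: E_diff E_id M_intros)
    ultimately show ?thesis by (simp add: star_simps)
  qed
  obtain u v where uv: "star u = u" "star v = v" "a = u + \<i> *\<^sub>C v"
    by (rule cartesian_decomposition)
  have "star a = u + (- \<i>) *\<^sub>C v" by (simp add: uv star_simps)
  then show ?thesis using sa[OF uv(1)] sa[OF uv(2)]
    by (simp add: uv(3) E_add E_diff E_scaleC star_simps scaleC_minus_left E_minus)
qed

lemma state_point_state:
  assumes "y \<in> X"
  shows "state (point_state E y)"
  unfolding state_def linear_on_def
proof (intro conjI ballI allI)
  fix a b c
  show "point_state E y (a + b) = point_state E y a + point_state E y b"
    by (simp add: point_state_def E_add char_add[OF assms] E_in)
  show "point_state E y (c *\<^sub>C a) = c *\<^sub>C point_state E y a"
    by (simp add: point_state_def E_scaleC char_scaleC[OF assms] E_in scaleC_complex_def)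
  show "positive (point_state E y (star a * a))"
    using char_positive[OF assms E_in E_positive] by (simp add: point_state_def positive_complex_iff)
  show "point_state E y 1 = 1"
    by (simp add: point_state_def E_id one_in char_one[OF assms])
qed

lemma point_state_on_M: "m \<in> M \<Longrightarrow> point_state E y m = y m"
  by (simp add: point_state_def E_id)

text \<open>Normalizers together with 0; unlike the normalizers alone, these are closed under products.\<close>

definition normalizing :: "'a \<Rightarrow> bool"
  where "normalizing n \<longleftrightarrow> (\<forall>m\<in>M. star n * m * n \<in> M) \<and> (\<forall>m\<in>M. n * m * star n \<in> M)"

lemma normalizers_iff: "n \<in> normalizers M \<longleftrightarrow> n \<noteq> 0 \<and> normalizing n"
  by (auto simp: normalizers_def normalizing_def)

lemma normalizing_star: "normalizing n \<Longrightarrow> normalizing (star n)"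
  by (auto simp: normalizing_def star_star)

lemma normalizing_conj: "normalizing n \<Longrightarrow> m \<in> M \<Longrightarrow> star n * (m * n) \<in> M"
  by (auto simp: normalizing_def mult.assoc)

lemma normalizing_conj': "normalizing n \<Longrightarrow> m \<in> M \<Longrightarrow> n * (m * star n) \<in> M"
  by (auto simp: normalizing_def mult.assoc)

lemma normalizing_star_mult: "normalizing n \<Longrightarrow> star n * n \<in> M"
  using normalizing_conj[of n 1] one_in by simp

lemma normalizing_mult_star: "normalizing n \<Longrightarrow> n * star n \<in> M"
  using normalizing_conj'[of n 1] one_in by simp

lemma normalizing_mult: 
  assumes "normalizing n" "normalizing k" shows "normalizing (n * k)"
proof -
  have "star (n * k) * m * (n * k) = star k * (star n * m * n) * k" for m by (simp add: star_mult mult.assoc)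
  moreover have "(n * k) * m * star (n * k) = n * (k * m * star k) * star n" for m by (simp add: star_mult mult.assoc)
  ultimately show ?thesis using assms by (simp add: normalizing_def)
qed

lemma normalizing_in: "m \<in> M \<Longrightarrow> normalizing m"
  by (simp add: normalizing_def M_intros)

text \<open>The closed linear span of the normalizers is a C*-algebra, and the normalizers generate
  everything. So a closed linear property only has to be checked on normalizers.\<close>

lemma normalizer_induct [consumes 0, case_names closed zero add scale normalizing]:
  assumes cl: "closed {a. Q a}" and zero: "Q 0"
    and add: "\<And>a b. Q a \<Longrightarrow> Q b \<Longrightarrow> Q (a + b)"
    and scale: "\<And>a c. Q a \<Longrightarrow> Q (c *\<^sub>C a)"
    and nrm: "\<And>n. normalizing n \<Longrightarrow> Q n"
  shows "Q (a::'a)"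
proof -
  define lin where "lin K \<longleftrightarrow> closed K \<and> 0 \<in> K \<and> (\<forall>a\<in>K. \<forall>b\<in>K. a + b \<in> K) \<and> (\<forall>c. \<forall>a\<in>K. c *\<^sub>C a \<in> K)"
    for K :: "'a set"
  define K where "K = \<Inter>{K. lin K \<and> {n. normalizing n} \<subseteq> K}"
  have least: "x \<in> L" if "lin L" "\<And>n. normalizing n \<Longrightarrow> n \<in> L" "x \<in> K" for L x
    using that by (auto simp: K_def)
  have linK: "lin K" unfolding lin_def K_def by (auto intro!: closed_Inter)
  have nK: "normalizing n \<Longrightarrow> n \<in> K" for n by (auto simp: K_def)
  have cont: "closed {a. f a \<in> K}" if "bounded_linear f" for f :: "'a \<Rightarrow> 'a"
  proof -
    have "closed (f -` K)" using linK that
      by (intro continuous_closed_vimage) (auto simp: lin_def linear_continuous_at)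
    then show ?thesis by (simp add: vimage_def)
  qed
  have mult1: "n * x \<in> K" if "normalizing n" "x \<in> K" for n x
  proof -
    have "lin {a. n * a \<in> K}"
      unfolding lin_def using cont[OF bounded_linear_mult_right[of n]] linK
      by (auto simp: lin_def ring_distribs mult_scaleC_right)
    then show ?thesis using least[of "{a. n * a \<in> K}" x] that by (auto intro: nK normalizing_mult)
  qed
  have mult: "x * z \<in> K" if "x \<in> K" "z \<in> K" for x z
  proof -
    have "lin {a. a * z \<in> K}"
      unfolding lin_def using cont[OF bounded_linear_mult_left[of z]] linK
      by (auto simp: lin_def ring_distribs mult_scaleC_left)
    then show ?thesis using least[of "{a. a * z \<in> K}" x] that mult1 by auto
  qed
  have st: "star x \<in> K" if "x \<in> K" for x
  proof -
    have "lin {a. star a \<in> K}"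
      unfolding lin_def using cont[OF bounded_linear_star] linK
      by (auto simp: lin_def star_add star_scaleC)
    then show ?thesis using least[of "{a. star a \<in> K}" x] that by (auto intro: nK normalizing_star)
  qed
  have "cstar_subalgebra K"
    using linK mult st by (auto simp: cstar_subalgebra_def star_subalgebra_def subalgebra_def lin_def)
  moreover have "normalizers M \<subseteq> K" using nK by (auto simp: normalizers_iff)
  ultimately have "cstar_generated (normalizers M) \<subseteq> K" by (auto simp: cstar_generated_def)
  then have "a \<in> K" using cartan by (auto simp: cartan_subalgebra_def)
  moreover have "lin {a. Q a}" using cl zero add scale by (auto simp: lin_def)
  ultimately show ?thesis using least[of "{a. Q a}" a] nrm by auto
qed

text \<open>Where \<open>E(k)\<close> does not vanish, \<open>\<alpha>\<^sub>k\<close> is the identity. Therefore \<open>k\<^sup>* E(k)\<close> commutes with \<open>M\<close>, belongs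
  to \<open>M\<close> by maximality, and equals its own expectation. In the proof, values at points are replaced
  by products in \<open>M\<close>.\<close>

lemma star_normalizer_mult_E:
  assumes n: "normalizing k"
  shows "star k * E k = star (E k) * E k"
proof -
  (* Apply E to l (l^* h l) = h l l^* l, which holds because l l^* commutes with h. *)
  have rel: "E l * (star l * (h * l)) = h * (E l * (star l * l))" if l: "normalizing l" and h: "h \<in> M" for l h
  proof -
    have ll: "l * star l \<in> M" by (rule normalizing_mult_star[OF l])
    have "l * (star l * (h * l)) = (l * star l) * h * l" by (simp add: mult.assoc)
    also have "\<dots> = h * (l * (star l * l))" by (simp only: comm[OF ll h]) (simp only: mult.assoc)
    finally have "E (l * (star l * (h * l))) = E (h * (l * (star l * l)))" by simp
    then show ?thesis
      using E_right[OF normalizing_conj[OF l h], of l] E_left[OF h] E_right[OF normalizing_star_mult[OF l], of l]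
      by simp
  qed
  define b where "b = E k"
  have bM: "b \<in> M" by (simp add: b_def E_in)
  have key: "h * (star k * b) = star k * b * h" if h: "h \<in> M" for h
  proof -
    (* As functions, d is (h o \<alpha>_k - h) k^* k, and b d = 0 says that \<alpha>_k is the identity where b is
       not 0. *)
    define d where "d = star k * (h * k) - star k * k * h"
    have dM: "d \<in> M" by (simp add: d_def M_intros normalizing_conj normalizing_star_mult n h)
    have "b * d = 0"
    proof -
      have "b * d = h * (b * (star k * k)) - b * (star k * k) * h"
        using rel[OF n h] by (simp add: d_def b_def right_diff_distrib mult.assoc)
      also have "b * (star k * k) * h = h * (b * (star k * k))"
        by (rule comm) (simp_all add: M_intros bM normalizing_star_mult n h)
      finally show ?thesis by simp
    qed
    then have bd: "d * b = 0" using comm[OF dM bM] by simp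
    have bd': "star b * d = 0"
    proof -
      have "star (star b * d) * (star b * d) = star d * (b * star b) * d" by (simp add: star_mult star_star mult.assoc)
      also have "\<dots> = star d * star b * (b * d)" by (simp add: comm[OF bM star_in[OF bM]] mult.assoc)
      finally show ?thesis using \<open>b * d = 0\<close> by (metis mult_zero_right star_mult_self_eq_0)
    qed
    define w where "w = d * (star k * b)"
    have "star b * (k * (star d * d * star k)) = star d * d * (star b * (k * star k))"
      using rel[OF normalizing_star[OF n], of "star d * d"] dM
      by (simp add: E_star b_def star_star M_intros)
    also have "\<dots> = star d * (star b * d) * (k * star k)"
      by (simp add: comm[OF star_in[OF bM] dM] mult.assoc)
    finally have "star b * (k * (star d * d * star k)) = 0" by (simp add: bd')
    moreover have "star w * w = star b * (k * (star d * d * star k)) * b"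
      by (simp add: w_def star_mult star_star mult.assoc)
    ultimately have "star w * w = 0" by simp
    then have w0: "w = 0" by simp
    (* The commutator z satisfies k^* k z = 0, so k z = 0. That kills z because z z^* lies in M and
       is therefore movable past h. *)
    define z where "z = star k * b * h - h * (star k * b)"
    have "star k * k * z = star k * (k * (star k * h)) * b - star k * k * h * (star k * b)"
      unfolding z_def by (simp add: right_diff_distrib mult.assoc comm[OF bM h])
    also have "star k * (k * (star k * h)) = star k * (h * k) * star k"
    proof -
      have "star k * (k * (star k * h)) = star k * ((k * star k) * h)" by (simp add: mult.assoc)
      also have "\<dots> = star k * (h * (k * star k))" by (simp only: comm[OF normalizing_mult_star[OF n] h])
      finally show ?thesis by (simp add: mult.assoc)
    qed
    finally have "star k * k * z = w" by (simp add: w_def d_def left_diff_distrib mult.assoc)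
    then have "star (k * z) * (k * z) = 0" using w0 by (simp add: star_mult mult.assoc)
    then have kz: "k * z = 0" by simp
    have sz: "star z = star h * (star b * k) - star b * k * star h"
      by (simp add: z_def star_simps mult.assoc)
    have "z * star z = star k * ((b * h * star h * star b) * k) - (star k * ((b * h * star b) * k)) * star h
        - h * (star k * ((b * star h * star b) * k)) + h * (star k * ((b * star b) * k)) * star h"
      unfolding sz unfolding z_def by (simp add: left_diff_distrib right_diff_distrib mult.assoc)
    also have "\<dots> \<in> M" by (simp add: M_intros normalizing_conj[OF n] bM h)
    finally have zzM: "z * star z \<in> M" .
    have "star z * (z * star z) = star h * star b * (k * z) * star z - star b * k * (star h * (z * star z))"
      by (subst (1) sz) (simp add: left_diff_distrib mult.assoc)
    also have "star h * (z * star z) = z * star z * star h" by (rule comm[OF star_in[OF h] zzM])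
    also have "star b * k * (z * star z * star h) = star b * (k * z) * star z * star h" by (simp add: mult.assoc)
    finally have "star z * (z * star z) = 0" by (simp add: kz)
    then have "star (z * star z) * (z * star z) = 0" by (simp add: star_mult star_star mult.assoc)
    then have "star (star z) * star z = 0" by (simp add: star_star)
    then have "star z = 0" by (metis star_mult_self_eq_0)
    then have "z = 0" by (metis star_star star_zero)
    then show ?thesis by (simp add: z_def)
  qed
  have "star k * b \<in> M" by (rule commuting_in[OF key])
  then have "star k * b = E (star k * b)" by (simp add: E_id)
  also have "\<dots> = E (star k) * b" by (rule E_right[OF bM])
  also have "\<dots> = star b * b" by (simp add: E_star b_def)
  finally show ?thesis by (simp add: b_def)
qed

text \<open>With \<open>e = E(n)\<^sup>* E(n)\<close>, the relation \<open>n\<^sup>* E(n) = e\<close> gives \<open>n\<^sup>* e n = e\<^sup>2\<close>; inserting this into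
  \<open>E(n) (n\<^sup>* e n) = e E(n) n\<^sup>* n\<close> and cancelling at \<open>y\<close> leaves \<open>e(y) = (n\<^sup>* n)(y)\<close>.\<close>

lemma char_E_normalizer:
  assumes n: "normalizing n" and y: "y \<in> X" and nz: "y (E n) \<noteq> 0"
  shows "y (star n * n) = complex_of_real ((cmod (y (E n)))\<^sup>2)"
proof -
  define b where "b = E n"
  define e where "e = star b * b"
  have bM: "b \<in> M" and eM: "e \<in> M" by (simp_all add: b_def e_def E_in M_intros)
  have nb: "star n * b = e" using star_normalizer_mult_E[OF n] by (simp add: b_def e_def)
  have "star e = e" by (simp add: e_def star_mult star_star)
  then have bn: "star b * n = e" using arg_cong[OF nb, of star] by (simp add: star_mult star_star)
  have nn: "star n * n \<in> M" by (rule normalizing_star_mult[OF n])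
  have e': "e = b * star b" using comm[OF bM star_in[OF bM]] by (simp add: e_def)
  have "star n * (e * n) = (star n * b) * (star b * n)" by (simp add: e' mult.assoc)
  then have nen: "star n * (e * n) = e * e" by (simp add: nb bn)
  have "n * (star n * (e * n)) = ((n * star n) * e) * n" by (simp only: mult.assoc)
  also have "\<dots> = e * (n * (star n * n))"
    by (simp only: comm[OF normalizing_mult_star[OF n] eM]) (simp only: mult.assoc)
  finally have "E (n * (e * e)) = E (e * (n * (star n * n)))" by (simp add: nen)
  then have "b * (e * e) = e * (b * (star n * n))"
    using E_right[OF mult_in[OF eM eM], of n] E_left[OF eM] E_right[OF nn, of n] by (simp add: b_def)
  then have "y (b * (e * e)) = y (e * (b * (star n * n)))" by simp
  then have "y b * (y e * y e) = y e * (y b * y (star n * n))"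
    using y bM eM nn by (simp add: char_mult mult_in)
  moreover have ye: "y e = complex_of_real ((cmod (y b))\<^sup>2)" unfolding e_def by (rule char_star_mult[OF y bM])
  moreover have "y b \<noteq> 0" using nz by (simp add: b_def)
  ultimately have "y b * y e * (y e - y (star n * n)) = 0" "y b * y e \<noteq> 0"
    by (simp_all add: algebra_simps)
  then have "y (star n * n) = y e" by simp
  then show ?thesis using ye by (simp add: b_def)
qed

lemma char_conj_normalizer_mult:
  assumes y: "y \<in> X" and n: "normalizing n" and M: "h \<in> M" "g \<in> M"
  shows "y (star n * (h * n)) * y (star n * (g * n)) = y (star n * (h * g * n)) * y (star n * n)"
proof -
  have "star n * (h * n) * (star n * (g * n)) = star n * (h * ((n * star n) * g) * n)" by (simp add: mult.assoc)
  also have "\<dots> = star n * (h * g * n) * (star n * n)"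
    by (simp only: comm[OF normalizing_mult_star[OF n] M(2)]) (simp only: mult.assoc)
  finally have "y (star n * (h * n) * (star n * (g * n))) = y (star n * (h * g * n) * (star n * n))" by simp
  then show ?thesis
    using y by (simp add: char_mult normalizing_conj[OF n] normalizing_star_mult[OF n] M M_intros)
qed

text \<open>The value of \<open>h\<close> at the point \<open>\<alpha>\<^sub>n(y)\<close>; meaningful when \<open>y (star n * n) \<noteq> 0\<close>, that is, when \<open>y\<close>
  lies in the domain of \<open>\<alpha>\<^sub>n\<close>.\<close>

definition transported :: "('a \<Rightarrow> complex) \<Rightarrow> 'a \<Rightarrow> 'a \<Rightarrow> complex"
  where "transported y n h = y (star n * (h * n)) / y (star n * n)"

lemma normalizer_map_eq:
  assumes y: "y \<in> X" and n: "normalizing n" and nz: "y (star n * n) \<noteq> 0"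
  shows "normalizer_map M n y = restrict (transported y n) M"
  unfolding normalizer_map_def
proof (rule the_equality)
  have "homomorphism_on M (restrict (transported y n) M)"
    unfolding homomorphism_on_def linear_on_def
  proof (intro conjI ballI allI)
    fix a b c assume ab: "a \<in> M" "b \<in> M"
    have "star n * ((a + b) * n) = star n * (a * n) + star n * (b * n)" by (simp add: ring_distribs)
    then show "restrict (transported y n) M (a + b) = restrict (transported y n) M a + restrict (transported y n) M b"
      using ab by (simp add: transported_def M_intros char_add[OF y] normalizing_conj[OF n] add_divide_distrib)
    show "restrict (transported y n) M (a * b) = restrict (transported y n) M a * restrict (transported y n) M b"
      using char_conj_normalizer_mult[OF y n ab] nz ab by (simp add: transported_def M_intros field_simps)
    show "restrict (transported y n) M (c *\<^sub>C a) = c *\<^sub>C restrict (transported y n) M a"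
      using ab by (simp add: transported_def M_intros scaleC_complex_def mult_scaleC_left mult_scaleC_right
          char_scaleC[OF y] normalizing_conj[OF n])
  qed
  moreover have "restrict (transported y n) M 1 \<noteq> 0" using nz one_in by (simp add: transported_def)
  ultimately have "restrict (transported y n) M \<in> X"
    unfolding gelfand_space_def using one_in by (auto simp del: restrict_apply)
  then show "restrict (transported y n) M \<in> X \<and>
    (\<forall>h\<in>M. y (star n * h * n) = restrict (transported y n) M h * y (star n * n))"
    using nz by (simp add: transported_def mult.assoc)
next
  fix z assume z: "z \<in> X \<and> (\<forall>h\<in>M. y (star n * h * n) = z h * y (star n * n))"
  show "z = restrict (transported y n) M"
  proof
    fix h show "z h = restrict (transported y n) M h"
      using z nz by (cases "h \<in> M") (auto simp: gelfand_space_def extensional_def transported_def mult.assoc)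
  qed
qed

lemma char_star_normalizer_pos:
  assumes "y \<in> X" "normalizing n"
  shows "Im (y (star n * n)) = 0 \<and> Re (y (star n * n)) \<ge> 0"
  by (rule char_positive[OF assms(1) normalizing_star_mult[OF assms(2)] positive_star_mult_self])

definition fixes_point :: "'a \<Rightarrow> ('a \<Rightarrow> complex) \<Rightarrow> bool"
  where "fixes_point n y \<longleftrightarrow> y (star n * n) \<noteq> 0 \<and> (\<forall>h\<in>M. y (star n * (h * n)) = y h * y (star n * n))"

lemma nontrivial_isotropy_iff:
  assumes y: "y \<in> X"
  shows "nontrivial_isotropy M E y \<longleftrightarrow> (\<exists>n. normalizing n \<and> fixes_point n y \<and> y (E n) = 0)"
proof -
  have "y \<in> normalizer_dom M n \<and> normalizer_map M n y = y \<longleftrightarrow> fixes_point n y" if n: "normalizing n" for n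
  proof -
    have pos: "y \<in> normalizer_dom M n \<longleftrightarrow> y (star n * n) \<noteq> 0"
      using char_star_normalizer_pos[OF y n] y by (auto simp: normalizer_dom_def complex_eq_iff)
    show ?thesis
    proof (cases "y (star n * n) = 0")
      case False
      have "restrict (transported y n) M = y \<longleftrightarrow> (\<forall>h\<in>M. transported y n h = y h)"
        using y by (auto simp: gelfand_space_def extensional_def fun_eq_iff restrict_def)
      then show ?thesis
        using False pos normalizer_map_eq[OF y n False]
        by (auto simp: fixes_point_def transported_def field_simps)
    qed (simp add: pos fixes_point_def)
  qed
  moreover have "n \<noteq> 0" if "fixes_point n y" for n
    using that char_zero[OF y] by (auto simp: fixes_point_def)
  ultimately show ?thesis
    unfolding nontrivial_isotropy_def Bex_def normalizers_iff by blast
qed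

text \<open>For \<open>g = h - h(\<alpha>\<^sub>n(y))\<close> the squared seminorm of \<open>g n\<close> is \<open>(n\<^sup>* g\<^sup>* g n)(y)\<close>, which is
  \<open>\<bar>g(\<alpha>\<^sub>n(y))\<bar>\<^sup>2 (n\<^sup>* n)(y) = 0\<close>. This is the eigenvector property of \<open>\<pi>(n)\<xi>\<close>.\<close>

lemma gns_seminorm_normalizer_eigen:
  assumes y: "y \<in> X" and n: "normalizing n" and nz: "y (star n * n) \<noteq> 0" and h: "h \<in> M"
  shows "gns_seminorm (point_state E y) (h * n - transported y n h *\<^sub>C n) = 0"
proof -
  define c where "c = transported y n h"
  define g where "g = h - c *\<^sub>C 1"
  have g: "g \<in> M" by (simp add: g_def h M_intros)
  have gn: "h * n - c *\<^sub>C n = g * n" by (simp add: g_def left_diff_distrib mult_scaleC_left)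
  have "star n * (g * n) = star n * (h * n) - c *\<^sub>C (star n * n)"
    by (simp add: g_def left_diff_distrib right_diff_distrib mult_scaleC_left mult_scaleC_right)
  then have yg: "y (star n * (g * n)) = 0"
    using nz by (simp add: char_diff[OF y] char_scaleC[OF y] normalizing_conj[OF n h]
        normalizing_star_mult[OF n] M_intros c_def transported_def)
  have "y (star n * (star g * n)) * y (star n * (g * n)) = y (star n * (star g * g * n)) * y (star n * n)"
    by (rule char_conj_normalizer_mult[OF y n star_in[OF g] g])
  then have "y (star n * (star g * g * n)) = 0" using yg nz by simp
  moreover have "point_state E y (star (g * n) * (g * n)) = y (star n * (star g * g * n))"
    by (subst point_state_on_M[symmetric])
      (simp_all add: star_mult mult.assoc normalizing_conj[OF n, of "star g * g", simplified mult.assoc] M_intros g)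
  ultimately show ?thesis by (simp add: gns_seminorm_def gn c_def[symmetric])
qed

end

section \<open>Points with trivial isotropy are dense\<close>

context masa
begin

lemma left_comm: "a \<in> M \<Longrightarrow> b \<in> M \<Longrightarrow> a * (b * c) = b * (a * c)"
  by (simp add: comm flip: mult.assoc)

lemmas M_ac = mult.assoc comm left_comm

text \<open>Here \<open>f\<close> is twice the positive part of \<open>k\<close> and \<open>r\<^sup>2\<close> is the absolute value of \<open>k\<close>. The first
  identity says that \<open>k\<close> is nonnegative where \<open>f\<close> does not vanish, the second that \<open>k\<close> is
  nonpositive on every \<open>p\<close> supported where \<open>f\<close> vanishes.\<close>

lemma positive_part:
  assumes k: "k \<in> M" "star k = k"
  obtains f r where "f \<in> M" "r \<in> M" "star f = f" "star r = r" "k * (f * f) = (r * f) * (r * f)"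
    "\<And>p. p \<in> M \<Longrightarrow> p * f = 0 \<Longrightarrow> star p * p * k = - (star (r * p) * (r * p))"
proof -
  obtain q r where q: "star q = q" "q * q = k * k" and r: "star r = r" "r * r = q"
    and cq: "\<And>d. d * k = k * d \<Longrightarrow> d * q = q * d" and cr: "\<And>d. d * k = k * d \<Longrightarrow> d * r = r * d"
    by (rule selfadjoint_abs[OF k(2)]) blast
  have qM: "q \<in> M" by (rule commuting_in, rule cq, rule comm[OF _ k(1)])
  have rM: "r \<in> M" by (rule commuting_in, rule cr, rule comm[OF _ k(1)])
  define f where "f = q + k"
  have fM: "f \<in> M" by (simp add: f_def qM k M_intros)
  have kf: "k * f = q * f" by (simp add: f_def ring_distribs q(2) comm[OF k(1) qM] add.commute)
  have "k * (f * f) = q * f * f" by (simp add: kf flip: mult.assoc)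
  also have "\<dots> = (r * f) * (r * f)" unfolding r(2)[symmetric] by (simp add: M_ac rM fM)
  finally have 1: "k * (f * f) = (r * f) * (r * f)" .
  have 2: "star p * p * k = - (star (r * p) * (r * p))" if p: "p \<in> M" "p * f = 0" for p
  proof -
    have "p * k = - (p * q)" using p(2) by (simp add: f_def ring_distribs eq_neg_iff_add_eq_0 add.commute)
    then have "star p * p * k = - (star p * (p * q))" by (simp add: mult.assoc)
    also have "star p * (p * q) = star (r * p) * (r * p)"
      unfolding r(2)[symmetric] by (simp add: M_ac rM p star_in star_mult r(1))
    finally show ?thesis .
  qed
  have "star f = f" by (simp add: f_def star_add q k)
  then show ?thesis by (rule that[OF fM rM _ r(1) 1 2])
qed

text \<open>In the following definitions \<open>p\<close> stands for the open set where it does not vanish. Quantifying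
  over all multiples \<open>p m\<close> makes the statement local, so that it passes from \<open>p\<close> to \<open>p f\<close>.\<close>

definition bounded_below_on :: "'a \<Rightarrow> 'a \<Rightarrow> bool"
  where "bounded_below_on g p \<longleftrightarrow> (\<exists>\<delta>>0. \<forall>m\<in>M. \<delta> * norm (p * m) \<le> norm (g * (p * m)))"

definition near_on :: "'a \<Rightarrow> complex \<Rightarrow> real \<Rightarrow> 'a \<Rightarrow> bool"
  where "near_on h c \<epsilon> p \<longleftrightarrow> (\<forall>m\<in>M. norm (h * (p * m) - c *\<^sub>C (p * m)) \<le> \<epsilon> * norm (p * m))"

lemma bounded_below_on_mult: "bounded_below_on g p \<Longrightarrow> f \<in> M \<Longrightarrow> bounded_below_on g (p * f)"
  unfolding bounded_below_on_def by (metis mult.assoc mult_in)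

lemma near_on_mult: "near_on h c \<epsilon> p \<Longrightarrow> f \<in> M \<Longrightarrow> near_on h c \<epsilon> (p * f)"
  unfolding near_on_def by (metis mult.assoc mult_in)

lemma near_on_mono: "near_on h c \<epsilon> p \<Longrightarrow> \<epsilon> \<le> \<delta> \<Longrightarrow> near_on h c \<delta> p"
  unfolding near_on_def by (meson mult_right_mono norm_ge_zero order_trans)

lemma near_on_add:
  assumes h: "near_on h c \<epsilon> p" and g: "near_on g d \<delta> p"
  shows "near_on (h + g) (c + d) (\<epsilon> + \<delta>) p"
  unfolding near_on_def
proof
  fix m assume m: "m \<in> M"
  let ?v = "p * m"
  have "(h + g) * ?v - (c + d) *\<^sub>C ?v = (h * ?v - c *\<^sub>C ?v) + (g * ?v - d *\<^sub>C ?v)"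
    by (simp add: distrib_right scaleC_add_left)
  also have "norm \<dots> \<le> \<epsilon> * norm ?v + \<delta> * norm ?v"
    using h g m by (intro norm_triangle_mono) (auto simp: near_on_def)
  finally show "norm ((h + g) * ?v - (c + d) *\<^sub>C ?v) \<le> (\<epsilon> + \<delta>) * norm ?v"
    by (simp add: distrib_right)
qed

lemma near_on_small: "norm h \<le> \<epsilon> \<Longrightarrow> near_on h 0 \<epsilon> p"
  unfolding near_on_def using order_trans[OF norm_mult_ineq mult_right_mono] by fastforce

lemma near_on_scalar: "cmod (c - d) \<le> \<epsilon> \<Longrightarrow> near_on (c *\<^sub>C 1) d \<epsilon> p"
  by (simp add: near_on_def mult_scaleC_left scaleC_diff_left[symmetric] norm_scaleC mult_right_mono)

lemma near_on_product:
  assumes h: "near_on h c \<epsilon> p" and g: "near_on g d \<delta> p"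
  shows "near_on (h * g) (c * d) (norm h * \<delta> + cmod d * \<epsilon>) p"
  unfolding near_on_def
proof
  fix m assume m: "m \<in> M"
  let ?v = "p * m"
  have "(h * g) * ?v - (c * d) *\<^sub>C ?v = h * (g * ?v - d *\<^sub>C ?v) + d *\<^sub>C (h * ?v - c *\<^sub>C ?v)"
    by (simp add: right_diff_distrib scaleC_diff_right mult_scaleC_right scaleC_scaleC mult.assoc mult.commute[of d])
  also have "norm \<dots> \<le> norm h * (\<delta> * norm ?v) + cmod d * (\<epsilon> * norm ?v)"
  proof (rule norm_triangle_mono)
    show "norm (h * (g * ?v - d *\<^sub>C ?v)) \<le> norm h * (\<delta> * norm ?v)"
      using g m by (intro order_trans[OF norm_mult_ineq] mult_left_mono) (auto simp: near_on_def)
    show "norm (d *\<^sub>C (h * ?v - c *\<^sub>C ?v)) \<le> cmod d * (\<epsilon> * norm ?v)"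
      using h m unfolding norm_scaleC by (intro mult_left_mono) (auto simp: near_on_def)
  qed
  finally show "norm ((h * g) * ?v - (c * d) *\<^sub>C ?v) \<le> (norm h * \<delta> + cmod d * \<epsilon>) * norm ?v"
    by (simp add: distrib_right mult.assoc)
qed

lemma near_on_unique:
  assumes "near_on h c \<epsilon> p" "near_on h d \<delta> p" "p \<noteq> 0"
  shows "cmod (c - d) \<le> \<epsilon> + \<delta>"
proof -
  have 1: "norm (h * p - c *\<^sub>C p) \<le> \<epsilon> * norm p" "norm (h * p - d *\<^sub>C p) \<le> \<delta> * norm p"
    using assms(1,2) one_in unfolding near_on_def by force+
  have "cmod (c - d) * norm p = norm ((h * p - d *\<^sub>C p) - (h * p - c *\<^sub>C p))"
    by (simp add: scaleC_diff_left norm_scaleC[symmetric])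
  also have "\<dots> \<le> (\<epsilon> + \<delta>) * norm p" using 1 norm_triangle_ineq4[of "h * p - d *\<^sub>C p" "h * p - c *\<^sub>C p"]
    by (simp add: distrib_right)
  finally show ?thesis using assms(3) by simp
qed

text \<open>A function that does not vanish identically on an open set is bounded away from 0 on a smaller
  one: cut off at a level \<open>\<delta>\<close> with \<open>\<delta> \<parallel>p\<parallel> < \<parallel>g p\<parallel>\<close>.\<close>

lemma bounded_below_on_refine:
  assumes p: "p \<in> M" and g: "g \<in> M" and nz: "g * p \<noteq> 0"
  obtains f where "f \<in> M" "p * f \<noteq> 0" "bounded_below_on g (p * f)"
proof -
  define \<delta> where "\<delta> = norm (g * p) / (norm p + 1)"
  have \<delta>: "\<delta> > 0" using nz by (simp add: \<delta>_def add_nonneg_pos)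
  have \<delta>p: "\<delta> * norm p < norm (g * p)"
  proof -
    have "\<delta> * (norm p + 1) = norm (g * p)"
      by (simp add: \<delta>_def) (metis add.commute add_nonneg_eq_0_iff norm_ge_zero zero_le_one zero_neq_one)
    then show ?thesis using \<delta> by (simp add: ring_distribs)
  qed
  define k where "k = star g * g - \<delta>\<^sup>2 *\<^sub>R 1"
  have k: "k \<in> M" "star k = k" using g by (simp_all add: k_def M_intros star_simps)
  obtain f r where f: "f \<in> M" "r \<in> M" "star f = f" "star r = r" "k * (f * f) = (r * f) * (r * f)"
    "\<And>p. p \<in> M \<Longrightarrow> p * f = 0 \<Longrightarrow> star p * p * k = - (star (r * p) * (r * p))"
    by (rule positive_part[OF k]) blast
  have "p * f \<noteq> 0"
  proof
    assume "p * f = 0"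
    then have "star p * p * k = - (star (r * p) * (r * p))" by (rule f(6)[OF p])
    moreover have "star p * p * k = star (g * p) * (g * p) - \<delta>\<^sup>2 *\<^sub>R (star p * p)"
      by (simp add: k_def right_diff_distrib star_mult M_ac p g star_in)
    ultimately have "\<delta>\<^sup>2 *\<^sub>R (star p * p) - star (g * p) * (g * p) = star (r * p) * (r * p)"
      by (simp add: algebra_simps)
    then have "norm (star (g * p) * (g * p)) \<le> norm (\<delta>\<^sup>2 *\<^sub>R (star p * p))"
      using positive_norm_mono positive_star_mult_self by metis
    then have "(norm (g * p))\<^sup>2 \<le> (\<delta> * norm p)\<^sup>2" by (simp add: cstar_identity power_mult_distrib)
    then have "norm (g * p) \<le> \<delta> * norm p" by (rule power2_le_imp_le) (use \<delta> in simp)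
    then show False using \<delta>p by simp
  qed
  moreover have "\<delta> * norm (p * f * m) \<le> norm (g * (p * f * m))" if m: "m \<in> M" for m
  proof -
    have "star (g * (p * f * m)) * (g * (p * f * m)) - \<delta>\<^sup>2 *\<^sub>R (star (p * f * m) * (p * f * m))
      = star (p * m) * (p * m) * (k * (f * f))"
      by (simp add: k_def left_diff_distrib right_diff_distrib star_mult f(3) M_ac p g m f(1) star_in)
    also have "\<dots> = star (r * f * (p * m)) * (r * f * (p * m))"
      by (simp add: f(5)) (simp add: star_mult f(3,4) M_ac p m f(1,2) star_in mult_in)
    finally have "norm (\<delta>\<^sup>2 *\<^sub>R (star (p * f * m) * (p * f * m))) \<le> norm (star (g * (p * f * m)) * (g * (p * f * m)))"
      using positive_norm_mono[of "\<delta>\<^sup>2 *\<^sub>R (star (p * f * m) * (p * f * m))"] positive_star_mult_self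
        positive_scaleR by (metis zero_le_power2)
    then have "(\<delta> * norm (p * f * m))\<^sup>2 \<le> (norm (g * (p * f * m)))\<^sup>2"
      by (simp add: cstar_identity power_mult_distrib)
    then show ?thesis by (rule power2_le_imp_le) simp
  qed
  ultimately show ?thesis using that[of f] f(1) \<delta> unfolding bounded_below_on_def by blast
qed

text \<open>The function \<open>h\<close> takes values between \<open>a\<close> and \<open>b\<close> where \<open>p\<close> does not vanish. Order is better suited
  than distance for bisecting an interval.\<close>

definition between_on :: "'a \<Rightarrow> real \<Rightarrow> real \<Rightarrow> 'a \<Rightarrow> bool"
  where "between_on h a b p \<longleftrightarrow> positive ((h - a *\<^sub>R 1) * (star p * p)) \<and> positive ((b *\<^sub>R 1 - h) * (star p * p))"

lemma between_on_mult:
  assumes "between_on h a b p" and M: "h \<in> M" "p \<in> M" "f \<in> M"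
  shows "between_on h a b (p * f)"
proof -
  have *: "positive (k * (star (p * f) * (p * f)))" if "positive (k * (star p * p))" "k \<in> M" for k
  proof -
    have "k * (star (p * f) * (p * f)) = star f * (k * (star p * p)) * f"
      by (simp add: star_mult M_ac M that star_in mult_in)
    then show ?thesis using positive_conjugate[OF that(1)] by simp
  qed
  show ?thesis using assms(1) * by (simp add: between_on_def M M_intros)
qed

text \<open>Either \<open>h\<close> exceeds \<open>t\<close> on a smaller open set, or it is at most \<open>t\<close> on all of \<open>p\<close>.\<close>

lemma between_on_bisect:
  assumes M: "h \<in> M" "p \<in> M" and h: "star h = h" and p: "p \<noteq> 0" and I: "between_on h a b p"
  obtains f where "f \<in> M" "p * f \<noteq> 0" "between_on h a t (p * f) \<or> between_on h t b (p * f)"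
proof -
  define k where "k = h - t *\<^sub>R 1"
  have k: "k \<in> M" "star k = k" using M h by (simp_all add: k_def M_intros star_simps)
  obtain f r where f: "f \<in> M" "r \<in> M" "star f = f" "star r = r" "k * (f * f) = (r * f) * (r * f)"
    "\<And>p. p \<in> M \<Longrightarrow> p * f = 0 \<Longrightarrow> star p * p * k = - (star (r * p) * (r * p))"
    by (rule positive_part[OF k]) blast
  show ?thesis
  proof (cases "p * f = 0")
    case True
    have "(t *\<^sub>R 1 - h) * (star p * p) = - (star p * p * k)"
      by (simp add: k_def left_diff_distrib right_diff_distrib M_ac M star_in mult_in)
    also have "\<dots> = star (r * p) * (r * p)" using f(6)[OF M(2) True] by simp
    finally have "between_on h a t p" using I by (simp add: between_on_def positive_star_mult_self)
    then show ?thesis using that[of 1] one_in p by simp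
  next
    case False
    have "(h - t *\<^sub>R 1) * (star (p * f) * (p * f)) = star p * p * (k * (f * f))"
      by (simp add: k_def[symmetric] star_mult M_ac M f(1,3) k star_in mult_in)
    also have "\<dots> = star (r * f * p) * (r * f * p)"
      by (simp add: f(5)) (simp add: star_mult f(3,4) M_ac M f(1,2) star_in mult_in)
    finally have "between_on h t b (p * f)"
      using between_on_mult[OF I M f(1)] by (simp add: between_on_def positive_star_mult_self)
    then show ?thesis using that[OF f(1) False] by blast
  qed
qed

lemma between_on_refine:
  assumes M: "h \<in> M" "p \<in> M" and h: "star h = h" and p: "p \<noteq> 0" and e: "\<epsilon> > 0"
  obtains f a where "f \<in> M" "p * f \<noteq> 0" "between_on h a (a + \<epsilon>) (p * f)"
proof -
  define L where "L = norm h"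
  have ex: "\<exists>f a. f \<in> M \<and> p * f \<noteq> 0 \<and> between_on h a (a + 2 * L / 2 ^ n) (p * f)" for n
  proof (induction n)
    case 0
    have pos: "positive (star p * k * p)" if "positive k" for k using that by (rule positive_conjugate)
    have "positive (L *\<^sub>R 1 - h)" "positive (L *\<^sub>R 1 - (- h))"
      by (rule positive_norm_diff; simp add: L_def h star_minus)+
    from this[THEN pos] have "between_on h (- L) (- L + 2 * L / 2 ^ 0) (p * 1)"
      by (simp add: between_on_def algebra_simps M_ac M star_in mult_in)
    then show ?case using one_in p by fastforce
  next
    case (Suc n)
    then obtain f a where f: "f \<in> M" "p * f \<noteq> 0" "between_on h a (a + 2 * L / 2 ^ n) (p * f)" by blast
    obtain g where g: "g \<in> M" "p * f * g \<noteq> 0"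
      "between_on h a (a + 2 * L / 2 ^ Suc n) (p * f * g) \<or>
       between_on h (a + 2 * L / 2 ^ Suc n) (a + 2 * L / 2 ^ n) (p * f * g)"
      by (rule between_on_bisect[OF M(1) mult_in[OF M(2) f(1)] h f(2,3)]) blast
    have "a + 2 * L / 2 ^ n = (a + 2 * L / 2 ^ Suc n) + 2 * L / 2 ^ Suc n" by simp
    then have "\<exists>a'. between_on h a' (a' + 2 * L / 2 ^ Suc n) (p * (f * g))"
      using g(3) by (metis mult.assoc)
    then show ?case using g f(1) mult_in by (metis mult.assoc)
  qed
  have L: "L \<ge> 0" by (simp add: L_def)
  then obtain n where n: "(1/2) ^ n < \<epsilon> / (2 * L + 1)"
    using real_arch_pow_inv[of "\<epsilon> / (2 * L + 1)" "1/2"] e by auto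
  have "2 * L / 2 ^ n \<le> (2 * L + 1) * (1/2) ^ n" by (simp add: power_one_over field_simps)
  also have "\<dots> < \<epsilon>" using n L by (simp add: field_simps)
  finally have n: "2 * L / 2 ^ n < \<epsilon>" .
  obtain f a where f: "f \<in> M" "p * f \<noteq> 0" "between_on h a (a + 2 * L / 2 ^ n) (p * f)" using ex by blast
  define q where "q = p * f"
  have qM: "q \<in> M" by (simp add: q_def M f M_intros)
  have eq: "(a + \<epsilon>) *\<^sub>R 1 - h = ((a + 2 * L / 2 ^ n) *\<^sub>R 1 - h) + (\<epsilon> - 2 * L / 2 ^ n) *\<^sub>R 1"
    by (simp add: algebra_simps)
  have "((a + \<epsilon>) *\<^sub>R 1 - h) * (star q * q)
      = ((a + 2 * L / 2 ^ n) *\<^sub>R 1 - h) * (star q * q) + (\<epsilon> - 2 * L / 2 ^ n) *\<^sub>R (star q * q)"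
    by (simp only: eq distrib_right mult_scaleR_left mult_1)
  then have "between_on h a (a + \<epsilon>) q"
    using f(3) n unfolding between_on_def q_def[symmetric]
    by (simp add: positive_add positive_scaleR positive_star_mult_self)
  then show ?thesis using that f by (simp add: q_def)
qed

text \<open>If \<open>k\<close> and \<open>l\<close> are the distances of \<open>h\<close> to the two ends, then \<open>\<epsilon>\<^sup>2 - k\<^sup>2 = \<epsilon>l + kl\<close>. Positivity of the
  product \<open>kl\<close> requires a factor \<open>p\<^sup>*p\<close> for each of \<open>k\<close> and \<open>l\<close>, which is why the conclusion is about
  \<open>p p\<^sup>*\<close>.\<close>

lemma near_on_if_between_on:
  assumes M: "h \<in> M" "p \<in> M" and h: "star h = h" and e: "\<epsilon> > 0" and I: "between_on h a (a + \<epsilon>) p"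
  shows "near_on h (complex_of_real a) \<epsilon> (p * star p)"
  unfolding near_on_def
proof
  fix m assume m: "m \<in> M"
  define v where "v = p * star p * m"
  have vM: "v \<in> M" by (simp add: v_def M m M_intros)
  define k where "k = h - a *\<^sub>R 1"
  define l where "l = (a + \<epsilon>) *\<^sub>R 1 - h"
  have kl: "k \<in> M" "l \<in> M" "star k = k" using M h by (simp_all add: k_def l_def M_intros star_simps)
  have k: "positive (k * (star p * p))" and l: "positive (l * (star p * p))"
    using I by (simp_all add: between_on_def k_def l_def)
  have kl\<epsilon>: "k + l = \<epsilon> *\<^sub>R 1" by (simp add: k_def l_def algebra_simps)
  have "\<epsilon>\<^sup>2 *\<^sub>R 1 - k * k = \<epsilon> *\<^sub>R l + k * l"
  proof -
    have "\<epsilon>\<^sup>2 *\<^sub>R 1 = (k + l) * (k + l)" by (simp add: kl\<epsilon> power2_eq_square)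
    moreover have "\<epsilon> *\<^sub>R l = (k + l) * l" by (simp add: kl\<epsilon>)
    ultimately show ?thesis by (simp add: ring_distribs M_ac kl)
  qed
  then have "star v * (\<epsilon>\<^sup>2 *\<^sub>R 1 - k * k) * v = star v * (\<epsilon> *\<^sub>R l + k * l) * v" by simp
  also have "\<dots> = star (star p * m) * (\<epsilon> *\<^sub>R (l * (star p * p))) * (star p * m)
      + star m * ((k * (star p * p)) * (l * (star p * p))) * m"
    by (simp add: v_def ring_distribs star_mult star_star M_ac kl M m star_in mult_in scaleR_in)
  finally have eq: "\<epsilon>\<^sup>2 *\<^sub>R (star v * v) - star (k * v) * (k * v)
      = star (star p * m) * (\<epsilon> *\<^sub>R (l * (star p * p))) * (star p * m)
      + star m * ((k * (star p * p)) * (l * (star p * p))) * m"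
    by (simp add: star_mult kl(3) left_diff_distrib right_diff_distrib mult.assoc)
  have "positive ((k * (star p * p)) * (l * (star p * p)))"
    by (rule positive_mult[OF k l], rule comm) (simp_all add: kl M M_intros)
  then have "positive (\<epsilon>\<^sup>2 *\<^sub>R (star v * v) - star (k * v) * (k * v))"
    unfolding eq using l e by (intro positive_add positive_conjugate positive_scaleR) auto
  then have "norm (star (k * v) * (k * v)) \<le> norm (\<epsilon>\<^sup>2 *\<^sub>R (star v * v))"
    by (rule positive_norm_mono[OF positive_star_mult_self])
  then have "(norm (k * v))\<^sup>2 \<le> (\<epsilon> * norm v)\<^sup>2" by (simp add: cstar_identity power_mult_distrib)
  then have "norm (k * v) \<le> \<epsilon> * norm v" by (rule power2_le_imp_le) (use e in simp)
  moreover have "k * v = h * v - complex_of_real a *\<^sub>C v"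
    by (simp add: k_def left_diff_distrib scaleR_scaleC mult_scaleC_left)
  ultimately show "norm (h * (p * star p * m) - complex_of_real a *\<^sub>C (p * star p * m)) \<le> \<epsilon> * norm (p * star p * m)"
    by (simp add: v_def)
qed

lemma near_on_refine_selfadjoint:
  assumes M: "h \<in> M" "p \<in> M" and h: "star h = h" and p: "p \<noteq> 0" and e: "\<epsilon> > 0"
  obtains f c where "f \<in> M" "p * f \<noteq> 0" "near_on h c \<epsilon> (p * f)"
proof -
  obtain f a where f: "f \<in> M" "p * f \<noteq> 0" "between_on h a (a + \<epsilon>) (p * f)"
    by (rule between_on_refine[OF M h p e]) blast
  have "near_on h (complex_of_real a) \<epsilon> (p * f * star (p * f))"
    by (rule near_on_if_between_on[OF M(1) _ h e f(3)]) (simp add: M f M_intros)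
  moreover have "p * f * star (p * f) \<noteq> 0"
    using f(2) norm_mult_star_self[of "p * f"] by auto
  moreover have "p * (f * star (p * f)) = p * f * star (p * f)" by (simp add: mult.assoc)
  moreover have "f * star (p * f) \<in> M" using f M by (simp add: M_intros)
  ultimately show ?thesis using that by metis
qed

lemma near_on_refine:
  assumes M: "h \<in> M" "p \<in> M" and p: "p \<noteq> 0" and e: "\<epsilon> > 0"
  obtains f c where "f \<in> M" "p * f \<noteq> 0" "near_on h c \<epsilon> (p * f)"
proof -
  obtain u v where uv: "star u = u" "star v = v" "h = u + \<i> *\<^sub>C v"
    "u = (1/2) *\<^sub>C (h + star h)" "v = (-\<i>/2) *\<^sub>C (h - star h)"
    by (rule cartesian_decomposition)
  have uvM: "u \<in> M" "v \<in> M" using M by (simp_all add: uv(4,5) M_intros)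
  have e2: "\<epsilon>/2 > 0" using e by simp
  obtain f c where f: "f \<in> M" "p * f \<noteq> 0" "near_on u c (\<epsilon>/2) (p * f)"
    by (rule near_on_refine_selfadjoint[OF uvM(1) M(2) uv(1) p e2]) blast
  obtain g d where g: "g \<in> M" "p * f * g \<noteq> 0" "near_on v d (\<epsilon>/2) (p * f * g)"
    by (rule near_on_refine_selfadjoint[OF uvM(2) mult_in[OF M(2) f(1)] uv(2) f(2) e2]) blast
  have "near_on (\<i> *\<^sub>C v) (\<i> * d) (\<epsilon>/2) (p * f * g)"
    using g(3) unfolding near_on_def
    by (simp add: mult_scaleC_left scaleC_scaleC[symmetric] scaleC_diff_right[symmetric] norm_scaleC)
  then have "near_on h (c + \<i> * d) \<epsilon> (p * f * g)"
    using near_on_add[OF near_on_mult[OF f(3) g(1)]] by (fastforce simp: uv(3))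
  then show ?thesis using that[of "f * g"] f(1) g(1,2) by (simp add: mult_in mult.assoc)
qed

text \<open>A decreasing sequence of nonempty open sets on which the functions of a dense set become nearly
  constant shrinks to a single point \<open>y\<close>. The value \<open>y h\<close> is the limit of the values of \<open>h\<close> on these
  sets, and whatever has been decided on some \<open>p i\<close> holds at \<open>y\<close>.\<close>

lemma generic_char:
  fixes p d :: "nat \<Rightarrow> 'a"
  assumes p: "\<And>i. p i \<in> M" "\<And>i. p i \<noteq> 0" "\<And>i j. i \<le> j \<Longrightarrow> \<exists>f\<in>M. p j = p i * f"
    and d: "\<And>i. d i \<in> M" "\<And>h e. h \<in> M \<Longrightarrow> e > 0 \<Longrightarrow> \<exists>i. dist (d i) h < e"
    and near: "\<And>i e. e > 0 \<Longrightarrow> \<exists>j c. near_on (d i) c e (p j)"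
  obtains y where "y \<in> X" "\<And>g i. g \<in> M \<Longrightarrow> bounded_below_on g (p i) \<Longrightarrow> y g \<noteq> 0"
    "\<And>g i. g \<in> M \<Longrightarrow> g * p i = 0 \<Longrightarrow> y g = 0"
proof -
  define L where "L h c \<longleftrightarrow> (\<forall>e>0. \<exists>i. near_on h c e (p i))" for h c
  have LD: "\<exists>i. near_on h c e (p i)" if "L h c" "e > 0" for h c e
    using that by (simp add: L_def)
  have mono: "near_on h c e (p j)" if "near_on h c e (p i)" "i \<le> j" for h c e i j
    using near_on_mult[OF that(1)] p(3)[OF that(2)] by auto
  have close: "cmod (c - c') \<le> e + e'" if "near_on h c e (p i)" "near_on h c' e' (p j)" for h c c' e e' i j
    by (rule near_on_unique[OF mono[OF that(1), of "max i j"] mono[OF that(2), of "max i j"] p(2)]) auto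
  have uniq: "c = c'" if cc': "L h c" "L h c'" for h c c'
  proof (rule ccontr)
    assume "c \<noteq> c'"
    then have e: "cmod (c - c') / 3 > 0" by simp
    from LD[OF cc'(1) e] LD[OF cc'(2) e] close e show False by fastforce
  qed
  have ex: "\<exists>c. L h c" if h: "h \<in> M" for h
  proof -
    have n: "\<exists>c i. near_on h c e (p i)" if e: "e > 0" for e
    proof -
      obtain k where k: "dist (d k) h < e / 2" using d(2)[OF h, of "e/2"] e by auto
      obtain j c where j: "near_on (d k) c (e/2) (p j)" using near[of "e/2" k] e by auto
      have "norm (h - d k) \<le> e/2" using k by (simp add: dist_norm norm_minus_commute)
      from near_on_add[OF j near_on_small[OF this]] show ?thesis by auto
    qed
    then have "\<forall>n. \<exists>c i. near_on h c (1 / real (Suc n)) (p i)" by simp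
    then obtain c i where ci: "\<And>n. near_on h (c n) (1 / real (Suc n)) (p (i n))" by metis
    have cl: "cmod (c m - c n) \<le> 1 / real (Suc m) + 1 / real (Suc n)" for m n by (rule close[OF ci ci])
    have small: "\<exists>K. \<forall>n\<ge>K. 1 / real (Suc n) < e" if "e > 0" for e
      using order_tendstoD(2)[OF LIMSEQ_inverse_real_of_nat that]
      by (simp add: inverse_eq_divide eventually_sequentially)
    have "Cauchy c"
    proof (rule CauchyI)
      fix e :: real assume e: "e > 0"
      obtain K where K: "\<And>n. n \<ge> K \<Longrightarrow> 1 / real (Suc n) < e / 2" using small[of "e/2"] e by auto
      have "cmod (c m - c n) < e" if "m \<ge> K" "n \<ge> K" for m n
        using cl[of m n] K[OF that(1)] K[OF that(2)] by linarith
      then show "\<exists>K. \<forall>m\<ge>K. \<forall>n\<ge>K. norm (c m - c n) < e" by blast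
    qed
    then obtain l where l: "c \<longlonglongrightarrow> l" using Cauchy_convergent convergent_def by blast
    have "L h l" unfolding L_def
    proof (intro allI impI)
      fix e :: real assume e: "e > 0"
      obtain K where K: "\<And>n. n \<ge> K \<Longrightarrow> 1 / real (Suc n) < e / 2" using small[of "e/2"] e by auto
      obtain K' where K': "\<And>n. n \<ge> K' \<Longrightarrow> cmod (c n - l) < e/2" using LIMSEQ_D[OF l, of "e/2"] e by auto
      define n where "n = max K K'"
      have "near_on (0 *\<^sub>C 1) (l - c n) (e/2) (p (i n))"
        by (rule near_on_scalar) (use K'[of n] in \<open>simp add: n_def norm_minus_commute\<close>)
      from near_on_add[OF ci this] have "near_on h l (1 / real (Suc n) + e/2) (p (i n))" by simp
      then have "near_on h l e (p (i n))" by (rule near_on_mono) (use K[of n] in \<open>simp add: n_def\<close>)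
      then show "\<exists>i. near_on h l e (p i)" ..
    qed
    then show ?thesis ..
  qed
  define y where "y = restrict (\<lambda>h. THE c. L h c) M"
  have y: "L h (y h)" if "h \<in> M" for h
    using ex[OF that] uniq theI[of "L h"] that unfolding y_def by (metis restrict_apply')
  have yI: "y h = c" if "h \<in> M" "L h c" for h c using uniq[OF y[OF that(1)] that(2)] .
  have two: "\<exists>j. near_on h (y h) e (p j) \<and> near_on g (y g) e (p j)" if M: "h \<in> M" "g \<in> M" and e: "e > 0" for h g e
  proof -
    obtain i where i: "near_on h (y h) e (p i)" using LD[OF y[OF M(1)] e] by blast
    obtain j where j: "near_on g (y g) e (p j)" using LD[OF y[OF M(2)] e] by blast
    show ?thesis using mono[OF i, of "max i j"] mono[OF j, of "max i j"] by auto
  qed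
  have yadd: "y (h + g) = y h + y g" if M: "h \<in> M" "g \<in> M" for h g
  proof (rule yI[OF add_in[OF M]], unfold L_def, intro allI impI)
    fix e :: real assume "e > 0"
    then obtain j where "near_on h (y h) (e/2) (p j)" "near_on g (y g) (e/2) (p j)" using two[OF M, of "e/2"] by auto
    from near_on_add[OF this] show "\<exists>i. near_on (h + g) (y h + y g) e (p i)" by auto
  qed
  have ymult: "y (h * g) = y h * y g" if M: "h \<in> M" "g \<in> M" for h g
  proof (rule yI[OF mult_in[OF M]], unfold L_def, intro allI impI)
    fix e :: real assume e: "e > 0"
    (* near_on_product turns an error of e/K in both factors into less than e. *)
    define K where "K = norm h + cmod (y g) + 1"
    have K: "K > 0" by (simp add: K_def add_nonneg_pos)
    then obtain j where "near_on h (y h) (e/K) (p j)" "near_on g (y g) (e/K) (p j)"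
      using two[OF M, of "e/K"] e by auto
    moreover have eq: "norm h * (e / K) + cmod (y g) * (e / K) = (K - 1) * (e / K)"
      by (simp only: distrib_right[symmetric]) (simp add: K_def)
    ultimately have "near_on (h * g) (y h * y g) ((K - 1) * (e / K)) (p j)"
      using near_on_product by (fastforce simp only: eq[symmetric])
    moreover have "(K - 1) * (e / K) \<le> e" using e K by (simp add: field_simps)
    ultimately show "\<exists>i. near_on (h * g) (y h * y g) e (p i)" using near_on_mono by blast
  qed
  have yconst: "y (c *\<^sub>C 1) = c" for c
    by (rule yI) (simp_all add: M_intros L_def near_on_scalar)
  have yscale: "y (c *\<^sub>C h) = c * y h" if h: "h \<in> M" for c h
    using ymult[OF scaleC_in[OF one_in] h, of c] by (simp add: yconst mult_scaleC_left)
  have "y 1 \<noteq> 0" using yconst[of 1] by simp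
  then have yX: "y \<in> X"
    unfolding gelfand_space_def homomorphism_on_def linear_on_def
    using yadd ymult yscale one_in by (auto simp: scaleC_complex_def y_def)
  have below: "y g \<noteq> 0" if g: "g \<in> M" "bounded_below_on g (p i)" for g i
  proof
    assume 0: "y g = 0"
    obtain \<delta> where \<delta>: "\<delta> > 0" "\<And>m. m \<in> M \<Longrightarrow> \<delta> * norm (p i * m) \<le> norm (g * (p i * m))"
      using g(2) by (auto simp: bounded_below_on_def)
    obtain j where j: "near_on g 0 (\<delta>/2) (p j)" using LD[OF y[OF g(1)], of "\<delta>/2"] \<delta>(1) 0 by auto
    obtain f where f: "f \<in> M" "p (max i j) = p i * f" using p(3)[of i "max i j"] by auto
    have "\<delta> * norm (p (max i j)) \<le> norm (g * p (max i j))" using \<delta>(2)[OF f(1)] f(2) by simp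
    also have "\<dots> \<le> \<delta>/2 * norm (p (max i j))"
      using mono[OF j, of "max i j"] one_in by (force simp: near_on_def)
    finally show False using \<delta>(1) p(2)[of "max i j"] by simp
  qed
  have zero: "y g = 0" if "g \<in> M" "g * p i = 0" for g i
  proof (rule yI[OF that(1)], unfold L_def, intro allI impI)
    fix e :: real assume "e > 0"
    then have "near_on g 0 e (p i)" using that(2) by (simp add: near_on_def flip: mult.assoc)
    then show "\<exists>i. near_on g 0 e (p i)" ..
  qed
  show ?thesis by (rule that[OF yX below zero])
qed

end

lemma separable_subset_sequence:
  fixes D S :: "'a::metric_space set"
  assumes "countable D" "closure D = UNIV" "S \<noteq> {}"
  obtains s :: "nat \<Rightarrow> 'a" where "\<And>i. s i \<in> S" "\<And>x e. x \<in> S \<Longrightarrow> e > 0 \<Longrightarrow> \<exists>i. dist (s i) x < e"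
proof -
  have "D \<noteq> {}" using assms(2) by auto
  define d where "d = from_nat_into D"
  have d: "\<exists>i. dist (d i) x < e" if "e > 0" for x e
  proof -
    have "x \<in> closure D" by (simp add: assms(2))
    then obtain z where "z \<in> D" "dist z x < e" using \<open>e > 0\<close> closure_approachable by blast
    then show ?thesis using from_nat_into_surj[OF assms(1)] d_def by metis
  qed
  (* s k is a point of S within 1/(j+1) of d i, where k encodes (i, j), if there is such a point. *)
  define s where "s k = (let (i, j) = prod_decode k in
    SOME x. x \<in> S \<and> ((\<exists>x\<in>S. dist (d i) x < 1 / real (Suc j)) \<longrightarrow> dist (d i) x < 1 / real (Suc j)))" for k
  have s: "s (prod_encode (i, j)) \<in> S \<and>
    ((\<exists>x\<in>S. dist (d i) x < 1 / real (Suc j)) \<longrightarrow> dist (d i) (s (prod_encode (i, j))) < 1 / real (Suc j))" for i j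
    unfolding s_def prod_encode_inverse Let_def prod.case
    by (rule someI_ex) (use assms(3) in blast)
  show ?thesis
  proof (rule that)
    show "s k \<in> S" for k using s[of "fst (prod_decode k)" "snd (prod_decode k)"] by simp
    fix x and e :: real assume x: "x \<in> S" and e: "e > 0"
    obtain j where j: "1 / real (Suc j) < e / 2" using nat_approx_posE[of "e/2"] e by auto
    obtain i where i: "dist (d i) x < 1 / real (Suc j)" using d[of "1 / real (Suc j)" x] by auto
    have "dist (d i) (s (prod_encode (i, j))) < 1 / real (Suc j)" using s[of i j] x i by blast
    then have "dist (s (prod_encode (i, j))) x < e"
      using dist_triangle3[of "s (prod_encode (i, j))" x "d i"] i j by simp
    then show "\<exists>i. dist (s i) x < e" ..
  qed
qed

context cartan_pair
begin

text \<open>The square \<open>[h, n]\<^sup>* [h, n]\<close> of a commutator (\<open>commutator_square_eq\<close>), in a form that exhibits it as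
  an element of \<open>M\<close>. It vanishes at the fixed points of \<open>\<alpha>\<^sub>n\<close>.\<close>

definition commutator_square :: "'a \<Rightarrow> 'a \<Rightarrow> 'a"
  where "commutator_square n h = star n * ((star h * h) * n) - star n * (star h * n) * h
    - star h * (star n * (h * n)) + star h * (star n * n) * h"

lemma commutator_square_in: "normalizing n \<Longrightarrow> h \<in> M \<Longrightarrow> commutator_square n h \<in> M"
  by (simp add: commutator_square_def M_intros normalizing_conj normalizing_star_mult)

lemma commutator_square_eq: "star (h * n - n * h) * (h * n - n * h) = commutator_square n h"
  by (simp add: commutator_square_def star_simps algebra_simps)

lemma char_commutator_square:
  assumes "y \<in> X" "normalizing n" "fixes_point n y" "h \<in> M"
  shows "y (commutator_square n h) = 0"
  using assms
  by (simp add: commutator_square_def fixes_point_def char_add char_diff char_mult char_star M_intros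
      normalizing_conj normalizing_star_mult)

text \<open>Each alternative rules out that \<open>n\<close> is a witness of nontrivial isotropy at a point where \<open>p\<close>
  does not vanish: the first by \<open>E(n) \<noteq> 0\<close>, the second because the point is not in the domain of
  \<open>\<alpha>\<^sub>n\<close>, the third because \<open>\<alpha>\<^sub>n\<close> moves it.\<close>

definition decides :: "'a \<Rightarrow> 'a \<Rightarrow> bool"
  where "decides n p \<longleftrightarrow> bounded_below_on (E n) p \<or> star n * n * p = 0 \<or>
    (\<exists>h\<in>M. bounded_below_on (commutator_square n h) p)"

lemma decides_mult: "decides n p \<Longrightarrow> f \<in> M \<Longrightarrow> decides n (p * f)"
  unfolding decides_def by (metis bounded_below_on_mult mult.assoc mult_zero_left)

text \<open>If \<open>E(n)\<close> vanishes on \<open>p\<close> but \<open>n p \<noteq> 0\<close>, then \<open>n p\<close> is not in \<open>M\<close>, since otherwise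
  \<open>n p = E(n p) = E(n) p = 0\<close>. By maximality it fails to commute with some \<open>h\<close> in \<open>M\<close>.\<close>

lemma decides_refine:
  assumes n: "normalizing n" and p: "p \<in> M" "p \<noteq> 0"
  obtains f where "f \<in> M" "p * f \<noteq> 0" "decides n (p * f)"
proof (cases "E n * p = 0")
  case False
  then show ?thesis
    using bounded_below_on_refine[OF p(1) E_in False] that by (auto simp: decides_def)
next
  case En: True
  show ?thesis
  proof (cases "star n * n * p = 0")
    case True
    then show ?thesis using that[of 1] p one_in by (simp add: decides_def)
  next
    case False
    have "n * p \<noteq> 0" using False by (auto simp: mult.assoc)
    have "\<exists>h\<in>M. h * (n * p) \<noteq> n * p * h"
    proof (rule ccontr)
      assume "\<not> ?thesis"
      then have "n * p \<in> M" by (intro commuting_in) auto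
      then have "n * p = E n * p" using E_id E_right[OF p(1)] by metis
      then show False using \<open>n * p \<noteq> 0\<close> En by simp
    qed
    then obtain h where h: "h \<in> M" "h * (n * p) \<noteq> n * p * h" by blast
    have "(h * n - n * h) * p \<noteq> 0"
      using h(2) comm[OF p(1) h(1)] by (simp add: left_diff_distrib mult.assoc)
    moreover have "star ((h * n - n * h) * p) * ((h * n - n * h) * p) = star p * (commutator_square n h * p)"
      by (simp add: commutator_square_eq[symmetric] star_mult mult.assoc)
    ultimately have "commutator_square n h * p \<noteq> 0"
      by (metis star_mult_self_eq_0 mult_zero_right)
    then show ?thesis
      using bounded_below_on_refine[OF p(1) commutator_square_in[OF n h(1)]] that h(1)
      by (auto simp: decides_def)
  qed
qed

text \<open>Witnesses of nontrivial isotropy may be perturbed, so that countably many normalizers suffice. If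
  \<open>\<alpha>\<^sub>k(y)\<close> differed from \<open>\<alpha>\<^sub>n(y) = y\<close>, the vectors \<open>\<pi>(k)\<xi>\<close> and \<open>\<pi>(n)\<xi>\<close> would be orthogonal, hence far
  apart; and if \<open>E(k)(y) \<noteq> 0\<close>, then \<open>\<bar>E(k)(y)\<bar> = \<parallel>\<pi>(k)\<xi>\<parallel>\<close>, too much for something close to
  \<open>E(n)(y) = 0\<close>.\<close>

lemma fixes_point_nearby:
  assumes y: "y \<in> X" and n: "normalizing n" "fixes_point n y" "y (E n) = 0" and k: "normalizing k"
    and nk: "dist k n < gns_seminorm (point_state E y) n / 2"
  shows "fixes_point k y \<and> y (E k) = 0"
proof -
  define \<phi> where "\<phi> = point_state E y"
  have s: "state \<phi>" unfolding \<phi>_def by (rule state_point_state[OF y])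
  have \<phi>M: "\<phi> m = y m" if "m \<in> M" for m using that by (simp add: \<phi>_def point_state_on_M)
  define N where "N = gns_seminorm \<phi>"
  have dist: "N (n - k) \<le> dist k n" using gns_seminorm_le_norm[OF s, of "n - k"] by (simp add: N_def dist_norm norm_minus_commute)
  have tri: "N n \<le> N (n - k) + N k" using gns_seminorm_triangle[OF s, of "n - k" k] by (simp add: N_def)
  have Nk: "N k > dist k n" using dist tri nk by (simp add: N_def \<phi>_def)
  then have Nk0: "N k > 0" using zero_le_dist[of k n] by linarith
  have ykk: "y (star k * k) = complex_of_real ((N k)\<^sup>2)"
    using gns_seminorm_sq_complex[OF s, of k] by (simp add: \<phi>M normalizing_star_mult[OF k] N_def)
  then have nz: "y (star k * k) \<noteq> 0" using Nk0 by simp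
  have tn: "transported y n h = y h" if "h \<in> M" for h
    using n(2) that by (simp add: transported_def fixes_point_def)
  have zero: "\<phi> (a * b) = 0" if "N b = 0" for a b
    using gns_Cauchy_Schwarz[OF s, of "star a" b] that by (simp add: N_def star_star)
  have fixed: "transported y k h = y h" if h: "h \<in> M" for h
  proof (rule ccontr)
    assume ne: "transported y k h \<noteq> y h"
    have "N (h * n - y h *\<^sub>C n) = 0"
      using gns_seminorm_normalizer_eigen[OF y n(1) _ h] n(2) tn[OF h] by (simp add: N_def \<phi>_def fixes_point_def)
    then have 1: "\<phi> (star k * (h * n)) = y h * \<phi> (star k * n)"
      using zero[of "h * n - y h *\<^sub>C n" "star k"]
      by (simp add: right_diff_distrib mult_scaleC_right state_diff[OF s] state_scaleC[OF s])
    have "transported y k (star h) = cnj (transported y k h)"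
    proof -
      have "star (star k * (h * k)) = star k * (star h * k)" by (simp add: star_mult star_star mult.assoc)
      then show ?thesis
        using char_star[OF y normalizing_conj[OF k h]] ykk by (simp add: transported_def)
    qed
    moreover have "N (star h * k - transported y k (star h) *\<^sub>C k) = 0"
      using gns_seminorm_normalizer_eigen[OF y k nz star_in[OF h]] by (simp add: N_def \<phi>_def)
    ultimately have "\<phi> (star n * (star h * k)) = cnj (transported y k h) * \<phi> (star n * k)"
      using zero[of "star h * k - transported y k (star h) *\<^sub>C k" "star n"]
      by (simp add: right_diff_distrib mult_scaleC_right state_diff[OF s] state_scaleC[OF s])
    then have "cnj (\<phi> (star n * (star h * k))) = transported y k h * cnj (\<phi> (star n * k))" by simp
    then have 2: "\<phi> (star k * (h * n)) = transported y k h * \<phi> (star k * n)"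
      by (simp add: state_star[OF s, symmetric] star_mult star_star mult.assoc)
    have kn: "\<phi> (star k * n) = 0" using 1 2 ne by simp
    then have nk0: "\<phi> (star n * k) = 0" using state_star[OF s, of "star k * n"] by (simp add: star_mult star_star)
    have "star (n - k) * (n - k) = star n * n - star k * n - star n * k + star k * k"
      by (simp add: star_diff algebra_simps)
    then have "(N (n - k))\<^sup>2 = (N n)\<^sup>2 + (N k)\<^sup>2"
      using kn nk0 by (simp add: N_def gns_seminorm_sq[OF s] state_add[OF s] state_diff[OF s])
    then have "(N k)\<^sup>2 \<le> (N (n - k))\<^sup>2" by simp
    then have "N k \<le> N (n - k)" by (rule power2_le_imp_le) (simp add: N_def gns_seminorm_nonneg[OF s])
    then show False using Nk dist by simp
  qed
  then have fk: "fixes_point k y" using nz by (auto simp: fixes_point_def transported_def field_simps)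
  have "y (E k) = 0"
  proof (rule ccontr)
    assume "y (E k) \<noteq> 0"
    then have "(N k)\<^sup>2 = (cmod (y (E k)))\<^sup>2"
      using char_E_normalizer[OF k y] ykk by (metis of_real_eq_iff)
    then have "N k = cmod (y (E k))" using Nk0 by (simp add: power2_eq_iff_nonneg)
    also have "y (E k) = \<phi> (k - n)"
      using n(3) by (simp add: \<phi>_def point_state_def E_diff char_diff[OF y] E_in)
    also have "cmod \<dots> \<le> dist k n" using state_contractive[OF s, of "k - n"] by (simp add: dist_norm)
    finally show False using Nk by simp
  qed
  with fk show ?thesis ..
qed

text \<open>Starting from an open set on which \<open>g\<close> is bounded away from 0, step \<open>i\<close> decides the \<open>i\<close>-th of a
  dense sequence of normalizers. It also makes one member of a dense sequence in \<open>M\<close> constant up to an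
  error; pairs of a member and an error are enumerated by \<open>prod_decode\<close>.\<close>

theorem trivial_isotropy_dense:
  assumes g: "g \<in> M" "g \<noteq> 0"
  obtains y where "y \<in> trivial_isotropy_points M E" "y g \<noteq> 0"
proof -
  obtain D :: "'a set" where D: "countable D" "closure D = UNIV" using cartan by (auto simp: cartan_subalgebra_def)
  obtain d :: "nat \<Rightarrow> 'a" where d: "\<And>i. d i \<in> M" "\<And>x e. x \<in> M \<Longrightarrow> e > 0 \<Longrightarrow> \<exists>i. dist (d i) x < e"
    by (rule separable_subset_sequence[OF D, of M]) (use one_in in blast)+
  have "{n. normalizing n} \<noteq> {}" using normalizing_in[OF one_in] by blast
  then obtain k :: "nat \<Rightarrow> 'a" where k: "\<And>i. normalizing (k i)" "\<And>x e. normalizing x \<Longrightarrow> e > 0 \<Longrightarrow> \<exists>i. dist (k i) x < e"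
    by (rule separable_subset_sequence[OF D, of "{n. normalizing n}"]) blast+
  obtain f0 where f0: "f0 \<in> M" "f0 \<noteq> 0" "bounded_below_on g f0"
    using bounded_below_on_refine[OF one_in g(1)] g(2) by auto
  define R where "R i p \<longleftrightarrow> decides (k i) p \<and>
    (\<exists>c. near_on (d (fst (prod_decode i))) c (1 / real (Suc (snd (prod_decode i)))) p)" for i :: nat and p
  have step: "\<exists>q. (q \<in> M \<and> q \<noteq> 0) \<and> (\<exists>f\<in>M. q = p * f) \<and> R i q" if p: "p \<in> M \<and> p \<noteq> 0" for p i
  proof -
    obtain f where f: "f \<in> M" "p * f \<noteq> 0" "decides (k i) (p * f)"
      using decides_refine[OF k(1)] p by blast
    obtain f' c where f': "f' \<in> M" "p * f * f' \<noteq> 0"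
      "near_on (d (fst (prod_decode i))) c (1 / real (Suc (snd (prod_decode i)))) (p * f * f')"
      by (rule near_on_refine[OF d(1) _ f(2), of "1 / real (Suc (snd (prod_decode i)))"])
        (use p f in \<open>auto simp: mult_in\<close>)
    have "R i (p * f * f')" using decides_mult[OF f(3) f'(1)] f'(3) by (auto simp: R_def)
    then show ?thesis using p f f' mult_in by (metis mult.assoc)
  qed
  obtain p where p: "\<And>i. p i \<in> M \<and> p i \<noteq> 0" "p 0 = f0"
    "\<And>i. (\<exists>f\<in>M. p (Suc i) = p i * f) \<and> R i (p (Suc i))"
    using dependent_nat_choice[where P="\<lambda>i p. (p \<in> M \<and> p \<noteq> 0) \<and> (i = 0 \<longrightarrow> p = f0)"
        and Q="\<lambda>i p q. (\<exists>f\<in>M. q = p * f) \<and> R i q"] f0 step by (metis old.nat.distinct(1))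
  have p3: "\<exists>f\<in>M. p j = p i * f" if "i \<le> j" for i j
    using that
  proof (induction rule: dec_induct)
    case base then show ?case using one_in by (metis mult.right_neutral)
  next
    case (step j) then show ?case using p(3)[of j] mult_in by (metis mult.assoc)
  qed
  have near: "\<exists>j c. near_on (d i) c e (p j)" if "e > 0" for i e
  proof -
    obtain l where l: "1 / real (Suc l) < e" using nat_approx_posE[OF \<open>e > 0\<close>] by auto
    obtain c where c: "near_on (d i) c (1 / real (Suc l)) (p (Suc (prod_encode (i, l))))"
      using p(3)[of "prod_encode (i, l)"] by (auto simp: R_def)
    then have "near_on (d i) c e (p (Suc (prod_encode (i, l))))"
      by (rule near_on_mono) (use l in simp)
    then show ?thesis by blast
  qed
  obtain y where y: "y \<in> X" "\<And>g i. g \<in> M \<Longrightarrow> bounded_below_on g (p i) \<Longrightarrow> y g \<noteq> 0"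
    "\<And>g i. g \<in> M \<Longrightarrow> g * p i = 0 \<Longrightarrow> y g = 0"
    by (rule generic_char[of p d]) (use p(1) p3 d near in auto)
  have "\<not> nontrivial_isotropy M E y"
  proof
    assume "nontrivial_isotropy M E y"
    then obtain n where n: "normalizing n" "fixes_point n y" "y (E n) = 0"
      using nontrivial_isotropy_iff[OF y(1)] by blast
    define \<phi> where "\<phi> = point_state E y"
    have s: "state \<phi>" unfolding \<phi>_def by (rule state_point_state[OF y(1)])
    have "gns_seminorm \<phi> n \<noteq> 0"
    proof
      assume "gns_seminorm \<phi> n = 0"
      then have "\<phi> (star n * n) = 0" using gns_seminorm_sq_complex[OF s, of n] by simp
      then show False using n(2) by (simp add: \<phi>_def point_state_on_M normalizing_star_mult[OF n(1)] fixes_point_def)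
    qed
    then have "gns_seminorm \<phi> n / 2 > 0" using gns_seminorm_nonneg[OF s, of n] by simp
    then obtain i where i: "dist (k i) n < gns_seminorm \<phi> n / 2" using k(2)[OF n(1)] by blast
    have fixed: "fixes_point (k i) y" and En: "y (E (k i)) = 0"
      using fixes_point_nearby[OF y(1) n k(1) i[unfolded \<phi>_def]] by auto
    have "decides (k i) (p (Suc i))" using p(3)[of i] by (simp add: R_def)
    then consider "bounded_below_on (E (k i)) (p (Suc i))" | "star (k i) * k i * p (Suc i) = 0"
      | h where "h \<in> M" "bounded_below_on (commutator_square (k i) h) (p (Suc i))"
      by (auto simp: decides_def)
    then show False
    proof cases
      case 1 then show False using y(2)[OF E_in] En by blast
    next
      case 2 then show False using y(3)[OF normalizing_star_mult[OF k(1)]] fixed by (auto simp: fixes_point_def)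
    next
      case 3 then show False
        using y(2)[OF commutator_square_in[OF k(1)]] char_commutator_square[OF y(1) k(1) fixed] by blast
    qed
  qed
  then have "y \<in> trivial_isotropy_points M E" using y(1) by (simp add: trivial_isotropy_points_def)
  moreover have "y g \<noteq> 0" using y(2)[OF g(1), of 0] f0(3) p(2) by simp
  ultimately show ?thesis using that by blast
qed

end

section \<open>The GNS representation\<close>

lemma tendsto_zero_le:
  fixes f g :: "nat \<Rightarrow> real"
  assumes "\<And>n. 0 \<le> f n" "\<And>n. f n \<le> g n" "g \<longlonglongrightarrow> 0"
  shows "f \<longlonglongrightarrow> 0"
  by (rule tendsto_sandwich[OF _ _ tendsto_const assms(3)]) (simp_all add: assms(1,2))

locale gns =
  fixes \<phi> :: "'a::unital_cstar_algebra \<Rightarrow> complex"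
  assumes state: "state \<phi>"
begin

abbreviation "N \<equiv> gns_seminorm \<phi>"
abbreviation "H \<equiv> gns_space \<phi>"
abbreviation "C \<equiv> gns_cauchy \<phi>"
abbreviation "cls \<equiv> gns_class \<phi>"

lemmas N_nonneg = gns_seminorm_nonneg[OF state]
  and N_triangle = gns_seminorm_triangle[OF state]
  and N_triangle_diff = gns_seminorm_triangle_diff[OF state]
  and N_zero = gns_seminorm_zero[OF state]
  and N_scaleC = gns_seminorm_scaleC[OF state]
  and N_commute = gns_seminorm_commute[OF state]
  and N_left_mult = gns_seminorm_left_mult[OF state]
  and N_le_norm = gns_seminorm_le_norm[OF state]
  and CS = gns_Cauchy_Schwarz[OF state]

lemma cauchyD: "s \<in> C \<Longrightarrow> e > 0 \<Longrightarrow> \<exists>K. \<forall>m\<ge>K. \<forall>n\<ge>K. N (s m - s n) < e"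
  by (simp add: gns_cauchy_def)

lemma cauchyI: "(\<And>e. e > 0 \<Longrightarrow> \<exists>K. \<forall>m\<ge>K. \<forall>n\<ge>K. N (s m - s n) < e) \<Longrightarrow> s \<in> C"
  by (simp add: gns_cauchy_def)

lemma cauchy_const: "(\<lambda>n. a) \<in> C"
  by (rule cauchyI) (simp add: N_zero)

lemma cauchy_add:
  assumes "s \<in> C" "t \<in> C"
  shows "(\<lambda>n. s n + t n) \<in> C"
proof (rule cauchyI)
  fix e :: real assume e: "e > 0"
  obtain K where K: "\<And>m n. m \<ge> K \<Longrightarrow> n \<ge> K \<Longrightarrow> N (s m - s n) < e/2" using cauchyD[OF assms(1), of "e/2"] e by auto
  obtain L where L: "\<And>m n. m \<ge> L \<Longrightarrow> n \<ge> L \<Longrightarrow> N (t m - t n) < e/2" using cauchyD[OF assms(2), of "e/2"] e by auto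
  have "N ((s m + t m) - (s n + t n)) < e" if "m \<ge> max K L" "n \<ge> max K L" for m n
    using N_triangle[of "s m - s n" "t m - t n"] K[of m n] L[of m n] that by (simp add: algebra_simps)
  then show "\<exists>K. \<forall>m\<ge>K. \<forall>n\<ge>K. N ((s m + t m) - (s n + t n)) < e" by blast
qed

lemma cauchy_bounded_map:
  assumes s: "s \<in> C" and f: "\<And>m n. N (f m - f n) \<le> K * N (s m - s n)" "K \<ge> 0"
  shows "f \<in> C"
proof (rule cauchyI)
  fix e :: real assume e: "e > 0"
  have K: "K + 1 > 0" using f(2) by simp
  obtain L where L: "\<And>m n. m \<ge> L \<Longrightarrow> n \<ge> L \<Longrightarrow> N (s m - s n) < e/(K+1)"
    using cauchyD[OF s, of "e/(K+1)"] e K by auto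
  have "N (f m - f n) < e" if "m \<ge> L" "n \<ge> L" for m n
  proof -
    have "N (f m - f n) \<le> (K+1) * N (s m - s n)"
      using f(1)[of m n] N_nonneg[of "s m - s n"] by (simp add: distrib_right)
    also have "\<dots> < e" using L[OF that] K by (simp add: field_simps)
    finally show ?thesis .
  qed
  then show "\<exists>L. \<forall>m\<ge>L. \<forall>n\<ge>L. N (f m - f n) < e" by blast
qed

lemma cauchy_scaleC: "s \<in> C \<Longrightarrow> (\<lambda>n. c *\<^sub>C s n) \<in> C"
  by (rule cauchy_bounded_map[of s _ "cmod c"]) (simp_all add: N_scaleC scaleC_diff_right[symmetric])

lemma cauchy_left_mult: "s \<in> C \<Longrightarrow> (\<lambda>n. a * s n) \<in> C"
  by (rule cauchy_bounded_map[of s _ "norm a"]) (simp_all add: N_left_mult right_diff_distrib[symmetric])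

lemma cauchy_bounded:
  assumes "s \<in> C"
  obtains B where "B > 0" "\<And>n. N (s n) \<le> B"
proof -
  obtain K where K: "\<And>m n. m \<ge> K \<Longrightarrow> n \<ge> K \<Longrightarrow> N (s m - s n) < 1" using cauchyD[OF assms, of 1] by auto
  define B where "B = (\<Sum>i\<le>K. N (s i)) + 1"
  have le: "N (s i) \<le> (\<Sum>i\<le>K. N (s i))" if "i \<le> K" for i
    by (rule member_le_sum) (use that in \<open>auto simp: N_nonneg\<close>)
  have "N (s n) \<le> B" for n
  proof (cases "n \<le> K")
    case True then show ?thesis using le[of n] by (simp add: B_def)
  next
    case False
    then show ?thesis using N_triangle[of "s n - s K" "s K"] K[of n K] le[of K] by (simp add: B_def)
  qed
  moreover have "B > 0" using le[of K] N_nonneg[of "s K"] by (simp add: B_def)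
  ultimately show ?thesis using that by blast
qed

lemma equiv_iff:
  "(s, t) \<in> gns_equiv \<phi> \<longleftrightarrow> s \<in> C \<and> t \<in> C \<and> (\<lambda>n. N (s n - t n)) \<longlonglongrightarrow> 0"
  by (simp add: gns_equiv_def)

lemma equiv_gns_equiv: "equiv C (gns_equiv \<phi>)"
proof (rule equivI)
  show "gns_equiv \<phi> \<subseteq> C \<times> C" by (auto simp: equiv_iff)
  show "refl_on C (gns_equiv \<phi>)" by (auto simp: refl_on_def equiv_iff N_zero)
  show "sym (gns_equiv \<phi>)" by (auto simp: sym_def equiv_iff N_commute)
  show "trans (gns_equiv \<phi>)"
  proof (rule transI)
    fix r s t assume rs: "(r, s) \<in> gns_equiv \<phi>" and st: "(s, t) \<in> gns_equiv \<phi>"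
    have "(\<lambda>n. N (r n - s n)) \<longlonglongrightarrow> 0" "(\<lambda>n. N (s n - t n)) \<longlonglongrightarrow> 0"
      using rs st unfolding equiv_iff by blast+
    from tendsto_add[OF this] have "(\<lambda>n. N (r n - s n) + N (s n - t n)) \<longlonglongrightarrow> 0" by simp
    then have "(\<lambda>n. N (r n - t n)) \<longlonglongrightarrow> 0"
      by (rule tendsto_zero_le[OF N_nonneg N_triangle_diff])
    then show "(r, t) \<in> gns_equiv \<phi>" using rs st by (auto simp: equiv_iff)
  qed
qed

lemma cls_eq_iff: "s \<in> C \<Longrightarrow> t \<in> C \<Longrightarrow> cls s = cls t \<longleftrightarrow> (\<lambda>n. N (s n - t n)) \<longlonglongrightarrow> 0"
  unfolding gns_class_def using eq_equiv_class_iff[OF equiv_gns_equiv, of s t] by (simp add: equiv_iff)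

lemma cls_in: "s \<in> C \<Longrightarrow> cls s \<in> hcarrier H"
  by (simp add: gns_space_def gns_class_def quotientI)

lemma carrierE:
  assumes "u \<in> hcarrier H"
  obtains s where "s \<in> C" "u = cls s"
  using assms by (auto simp: gns_space_def gns_class_def elim: quotientE)

lemma gns_seq_cls:
  assumes "s \<in> C"
  shows "gns_seq (cls s) \<in> C" "(\<lambda>n. N (gns_seq (cls s) n - s n)) \<longlonglongrightarrow> 0"
proof -
  have "s \<in> cls s" using assms by (simp add: gns_class_def equiv_iff N_zero)
  then have "gns_seq (cls s) \<in> cls s" unfolding gns_seq_def by (rule someI[where P="\<lambda>r. r \<in> cls s"])
  then have "(s, gns_seq (cls s)) \<in> gns_equiv \<phi>" by (simp add: gns_class_def)
  then show "gns_seq (cls s) \<in> C" "(\<lambda>n. N (gns_seq (cls s) n - s n)) \<longlonglongrightarrow> 0"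
    by (auto simp: equiv_iff N_commute)
qed

lemma hzero_eq: "hzero H = cls (\<lambda>n. 0)"
  by (simp add: gns_space_def)

lemma hadd_cls:
  assumes s: "s \<in> C" and t: "t \<in> C"
  shows "hadd H (cls s) (cls t) = cls (\<lambda>n. s n + t n)"
proof -
  let ?s = "gns_seq (cls s)" and ?t = "gns_seq (cls t)"
  have "(\<lambda>n. N (?s n - s n) + N (?t n - t n)) \<longlonglongrightarrow> 0"
    using tendsto_add[OF gns_seq_cls(2)[OF s] gns_seq_cls(2)[OF t]] by simp
  moreover have "N ((?s n + ?t n) - (s n + t n)) \<le> N (?s n - s n) + N (?t n - t n)" for n
    using N_triangle[of "?s n - s n" "?t n - t n"] by (simp add: algebra_simps)
  ultimately have "(\<lambda>n. N ((?s n + ?t n) - (s n + t n))) \<longlonglongrightarrow> 0"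
    by (intro tendsto_zero_le[OF N_nonneg])
  then have "cls (\<lambda>n. ?s n + ?t n) = cls (\<lambda>n. s n + t n)"
    by (subst cls_eq_iff) (auto intro: cauchy_add gns_seq_cls s t)
  then show ?thesis by (simp add: gns_space_def)
qed

text \<open>Operations on classes are defined through a chosen representative; this removes the choice.\<close>

lemma cls_bounded_map:
  assumes s: "s \<in> C" and f: "\<And>m n. N (f (gns_seq (cls s) n) - f (s n)) \<le> K * N (gns_seq (cls s) n - s n)"
    and fC: "(\<lambda>n. f (gns_seq (cls s) n)) \<in> C" "(\<lambda>n. f (s n)) \<in> C"
  shows "cls (\<lambda>n. f (gns_seq (cls s) n)) = cls (\<lambda>n. f (s n))"
proof -
  have "(\<lambda>n. K * N (gns_seq (cls s) n - s n)) \<longlonglongrightarrow> 0"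
    using tendsto_mult_left[OF gns_seq_cls(2)[OF s], of K] by simp
  then have "(\<lambda>n. N (f (gns_seq (cls s) n) - f (s n))) \<longlonglongrightarrow> 0"
    by (rule tendsto_zero_le[OF N_nonneg f])
  then show ?thesis by (simp add: cls_eq_iff fC)
qed

lemma hscale_cls: "s \<in> C \<Longrightarrow> hscale H c (cls s) = cls (\<lambda>n. c *\<^sub>C s n)"
  using cls_bounded_map[of s "\<lambda>x. c *\<^sub>C x" "cmod c"]
  by (simp add: gns_space_def N_scaleC scaleC_diff_right[symmetric] cauchy_scaleC gns_seq_cls)

lemma gns_rep_cls: "s \<in> C \<Longrightarrow> gns_rep \<phi> a (cls s) = cls (\<lambda>n. a * s n)"
  using cls_bounded_map[of s "\<lambda>x. a * x" "norm a"]
  by (simp add: gns_rep_def N_left_mult right_diff_distrib[symmetric] cauchy_left_mult gns_seq_cls)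

lemma inner_diff_le:
  "cmod (\<phi> (star t * s) - \<phi> (star t' * s')) \<le> N s * N (t - t') + N (s - s') * N t'"
proof -
  have "star t * s - star t' * s' = star (t - t') * s + star t' * (s - s')"
    by (simp add: star_diff algebra_simps)
  then have "\<phi> (star t * s) - \<phi> (star t' * s') = \<phi> (star (t - t') * s) + \<phi> (star t' * (s - s'))"
    by (metis state state_add state_diff)
  also have "cmod \<dots> \<le> cmod (\<phi> (star (t - t') * s)) + cmod (\<phi> (star t' * (s - s')))"
    by (rule norm_triangle_ineq)
  also have "\<dots> \<le> N s * N (t - t') + N (s - s') * N t'" by (intro add_mono CS)
  finally show ?thesis .
qed

lemma inner_convergent:
  assumes s: "s \<in> C" and t: "t \<in> C"
  shows "convergent (\<lambda>n. \<phi> (star (t n) * s n))"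
proof (rule Cauchy_convergent, rule CauchyI)
  fix e :: real assume e: "e > 0"
  obtain A where A: "A > 0" "\<And>n. N (s n) \<le> A" by (rule cauchy_bounded[OF s]) blast
  obtain B where B: "B > 0" "\<And>n. N (t n) \<le> B" by (rule cauchy_bounded[OF t]) blast
  obtain K where K: "\<And>m n. m \<ge> K \<Longrightarrow> n \<ge> K \<Longrightarrow> N (s m - s n) < e/(2*B)" using cauchyD[OF s, of "e/(2*B)"] e B by auto
  obtain L where L: "\<And>m n. m \<ge> L \<Longrightarrow> n \<ge> L \<Longrightarrow> N (t m - t n) < e/(2*A)" using cauchyD[OF t, of "e/(2*A)"] e A by auto
  have "cmod (\<phi> (star (t m) * s m) - \<phi> (star (t n) * s n)) < e" if "m \<ge> max K L" "n \<ge> max K L" for m n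
  proof -
    have "N (s m) * N (t m - t n) \<le> A * N (t m - t n)" using A(2) N_nonneg by (rule mult_right_mono)
    also have "\<dots> < e / 2" using L[of m n] that A(1) by (simp add: field_simps)
    finally have 1: "N (s m) * N (t m - t n) < e / 2" .
    have "N (s m - s n) * N (t n) \<le> N (s m - s n) * B" using B(2) N_nonneg by (rule mult_left_mono)
    also have "\<dots> < e / 2" using K[of m n] that B(1) by (simp add: field_simps)
    finally show ?thesis using inner_diff_le[of "t m" "s m" "t n" "s n"] 1 by simp
  qed
  then show "\<exists>K. \<forall>m\<ge>K. \<forall>n\<ge>K. norm (\<phi> (star (t m) * s m) - \<phi> (star (t n) * s n)) < e" by blast
qed

lemma hinner_cls:
  assumes s: "s \<in> C" and t: "t \<in> C"
  shows "(\<lambda>n. \<phi> (star (t n) * s n)) \<longlonglongrightarrow> hinner H (cls s) (cls t)"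
proof -
  let ?s = "gns_seq (cls s)" and ?t = "gns_seq (cls t)"
  have lim: "(\<lambda>n. \<phi> (star (?t n) * ?s n)) \<longlonglongrightarrow> hinner H (cls s) (cls t)"
    using inner_convergent[OF gns_seq_cls(1)[OF s] gns_seq_cls(1)[OF t]]
    by (simp add: gns_space_def convergent_LIMSEQ_iff)
  obtain A where A: "A > 0" "\<And>n. N (s n) \<le> A" by (rule cauchy_bounded[OF s]) blast
  obtain B where B: "B > 0" "\<And>n. N (?t n) \<le> B" by (rule cauchy_bounded[OF gns_seq_cls(1)[OF t]]) blast
  have lim0: "(\<lambda>n. A * N (?t n - t n) + N (?s n - s n) * B) \<longlonglongrightarrow> 0"
    using tendsto_add[OF tendsto_mult_left[OF gns_seq_cls(2)[OF t], of A]
        tendsto_mult_right[OF gns_seq_cls(2)[OF s], of B]] by simp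
  have bound: "norm (\<phi> (star (t n) * s n) - \<phi> (star (?t n) * ?s n)) \<le> A * N (?t n - t n) + N (?s n - s n) * B" for n
  proof -
    have "norm (\<phi> (star (t n) * s n) - \<phi> (star (?t n) * ?s n)) \<le> N (s n) * N (t n - ?t n) + N (s n - ?s n) * N (?t n)"
      by (rule inner_diff_le)
    also have "\<dots> \<le> A * N (t n - ?t n) + N (s n - ?s n) * B"
      by (intro add_mono mult_right_mono mult_left_mono A B N_nonneg)
    finally show ?thesis by (simp add: N_commute)
  qed
  have "(\<lambda>n. \<phi> (star (t n) * s n) - \<phi> (star (?t n) * ?s n)) \<longlonglongrightarrow> 0"
    by (rule tendsto_norm_zero_cancel[OF tendsto_zero_le[OF norm_ge_zero bound lim0]])
  from tendsto_add[OF this lim] show ?thesis by simp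
qed

lemma hnorm_cls:
  assumes s: "s \<in> C"
  shows "(\<lambda>n. N (s n)) \<longlonglongrightarrow> hnorm H (cls s)"
  unfolding hnorm_def gns_seminorm_def by (intro tendsto_intros hinner_cls s)

lemma hadd_minus_cls:
  assumes "s \<in> C" "t \<in> C"
  shows "hadd H (cls s) (hscale H (- 1) (cls t)) = cls (\<lambda>n. s n - t n)" "(\<lambda>n. s n - t n) \<in> C"
  using hadd_cls[OF assms(1) cauchy_scaleC[OF assms(2), of "- 1"]]
    cauchy_add[OF assms(1) cauchy_scaleC[OF assms(2), of "- 1"]] assms
  by (simp_all add: hscale_cls)

lemma hdist_cls:
  assumes "s \<in> C" "t \<in> C"
  shows "(\<lambda>n. N (s n - t n)) \<longlonglongrightarrow> hdist H (cls s) (cls t)"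
  using hnorm_cls[OF hadd_minus_cls(2)[OF assms]] by (simp add: hdist_def hadd_minus_cls(1)[OF assms])

text \<open>The limit is the diagonal sequence \<open>d m = s m (k m)\<close>, where \<open>k m\<close> is so large that the \<open>m\<close>-th
  representative has settled up to \<open>1/(m+1)\<close>.\<close>

lemma gns_complete:
  assumes u: "\<And>n. u n \<in> hcarrier H" and cau: "\<forall>e>0. \<exists>K. \<forall>m\<ge>K. \<forall>n\<ge>K. hdist H (u m) (u n) < e"
  shows "\<exists>v\<in>hcarrier H. (\<lambda>n. hdist H (u n) v) \<longlonglongrightarrow> 0"
proof -
  have "\<forall>n. \<exists>s. s \<in> C \<and> u n = cls s" using carrierE[OF u] by metis
  then obtain s where s: "\<And>n. s n \<in> C" "\<And>n. u n = cls (s n)" by metis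
  have "\<forall>m. \<exists>k. \<forall>i\<ge>k. \<forall>j\<ge>k. N (s m i - s m j) < 1 / real (Suc m)"
    using cauchyD[OF s(1)] by simp
  then obtain k where k: "\<And>m i j. i \<ge> k m \<Longrightarrow> j \<ge> k m \<Longrightarrow> N (s m i - s m j) < 1 / real (Suc m)" by metis
  define d where "d m = s m (k m)" for m
  have near: "N (s m i - d m) < 1 / real (Suc m)" if "i \<ge> k m" for m i
    using k[of m i "k m"] that by (simp add: d_def)
  have small: "\<exists>K. \<forall>m\<ge>K. 1 / real (Suc m) < e" if "e > 0" for e
  proof -
    have "\<forall>\<^sub>F n in sequentially. 1 / real (Suc n) < e"
      using order_tendstoD(2)[OF LIMSEQ_inverse_real_of_nat that] by (simp add: inverse_eq_divide)
    then show ?thesis by (simp add: eventually_sequentially)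
  qed
  have d: "d \<in> C"
  proof (rule cauchyI)
    fix e :: real assume e: "e > 0"
    obtain K where K: "\<And>m n. m \<ge> K \<Longrightarrow> n \<ge> K \<Longrightarrow> hdist H (u m) (u n) < e/3" using cau e by (metis divide_pos_pos zero_less_numeral)
    obtain L where L: "\<And>m. m \<ge> L \<Longrightarrow> 1 / real (Suc m) < e/3" using small[of "e/3"] e by auto
    have "N (d m - d n) < e" if m: "m \<ge> max K L" and n: "n \<ge> max K L" for m n
    proof -
      have "(\<lambda>i. N (s m i - s n i)) \<longlonglongrightarrow> hdist H (u m) (u n)" using hdist_cls[OF s(1) s(1)] s(2) by simp
      then have "\<forall>\<^sub>F i in sequentially. N (s m i - s n i) < e/3"
        by (rule order_tendstoD(2)) (use K m n in simp)
      moreover have "\<forall>\<^sub>F i in sequentially. i \<ge> max (k m) (k n)" by (rule eventually_ge_at_top)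
      ultimately have "\<forall>\<^sub>F i in sequentially. N (s m i - s n i) < e/3 \<and> i \<ge> max (k m) (k n)" by (rule eventually_conj)
      then obtain i where i: "N (s m i - s n i) < e/3" "i \<ge> max (k m) (k n)" by (auto simp: eventually_sequentially)
      have "N (d m - d n) \<le> N (d m - s m i) + (N (s m i - s n i) + N (s n i - d n))"
        using N_triangle_diff[of "d m" "d n" "s m i"] N_triangle_diff[of "s m i" "d n" "s n i"] by simp
      also have "\<dots> < e/3 + (e/3 + e/3)"
        using near[of m i] near[of n i] i L[of m] L[of n] m n N_commute[of "d m" "s m i"] by simp
      finally show ?thesis by simp
    qed
    then show "\<exists>K. \<forall>m\<ge>K. \<forall>n\<ge>K. N (d m - d n) < e" by blast
  qed
  have "(\<lambda>n. hdist H (u n) (cls d)) \<longlonglongrightarrow> 0"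
  proof (rule LIMSEQ_I)
    fix e :: real assume e: "e > 0"
    obtain K where K: "\<And>m n. m \<ge> K \<Longrightarrow> n \<ge> K \<Longrightarrow> N (d m - d n) < e/3" using cauchyD[OF d, of "e/3"] e by auto
    obtain L where L: "\<And>m. m \<ge> L \<Longrightarrow> 1 / real (Suc m) < e/3" using small[of "e/3"] e by auto
    have "norm (hdist H (u m) (cls d) - 0) < e" if m: "m \<ge> max K L" for m
    proof -
      have lim: "(\<lambda>i. N (s m i - d i)) \<longlonglongrightarrow> hdist H (u m) (cls d)" using hdist_cls[OF s(1) d] s(2) by simp
      have "N (s m i - d i) \<le> 2*e/3" if i: "i \<ge> max (k m) K" for i
        using N_triangle_diff[of "s m i" "d i" "d m"] near[of m i] K[of m i] L[of m] i m by simp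
      then have "hdist H (u m) (cls d) \<le> 2*e/3" by (intro LIMSEQ_le_const2[OF lim]) blast
      moreover have "hdist H (u m) (cls d) \<ge> 0" by (intro LIMSEQ_le_const[OF lim]) (auto simp: N_nonneg)
      ultimately show ?thesis using e by simp
    qed
    then show "\<exists>no. \<forall>n\<ge>no. norm (hdist H (u n) (cls d) - 0) < e" by blast
  qed
  then show ?thesis using cls_in[OF d] by blast
qed

sublocale hilbert_space H
proof
  fix u v w c d' assume uvw: "u \<in> hcarrier H" "v \<in> hcarrier H" "w \<in> hcarrier H"
  obtain r where r: "r \<in> C" "u = cls r" using uvw by (auto elim: carrierE)
  obtain s where s: "s \<in> C" "v = cls s" using uvw by (auto elim: carrierE)
  obtain t where t: "t \<in> C" "w = cls t" using uvw by (auto elim: carrierE)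
  note [simp] = r s t hadd_cls hscale_cls cauchy_add cauchy_scaleC cls_in
  show "hadd H u v \<in> hcarrier H" "hscale H c u \<in> hcarrier H" by simp_all
  show "hadd H (hadd H u v) w = hadd H u (hadd H v w)" by (simp add: add.assoc)
  show "hadd H u v = hadd H v u" by (simp add: add.commute)
  show "hadd H (hzero H) u = u" by (simp add: hzero_eq cauchy_const)
  show "hadd H u (hscale H (- 1) u) = hzero H"
    unfolding r(2) hadd_minus_cls(1)[OF r(1) r(1)] hzero_eq by (simp only: diff_self)
  show "hscale H c (hadd H u v) = hadd H (hscale H c u) (hscale H c v)" by (simp add: scaleC_add_right)
  show "hscale H (c + d') u = hadd H (hscale H c u) (hscale H d' u)" by (simp add: scaleC_add_left)
  show "hscale H c (hscale H d' u) = hscale H (c * d') u" by (simp add: scaleC_scaleC)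
  show "hscale H 1 u = u" by simp
  show "hinner H (hadd H u v) w = hinner H u w + hinner H v w"
  proof (rule LIMSEQ_unique)
    show "(\<lambda>n. \<phi> (star (t n) * (r n + s n))) \<longlonglongrightarrow> hinner H (hadd H u v) w"
      using hinner_cls[of "\<lambda>n. r n + s n" t] by simp
    show "(\<lambda>n. \<phi> (star (t n) * (r n + s n))) \<longlonglongrightarrow> hinner H u w + hinner H v w"
      using tendsto_add[OF hinner_cls[of r t] hinner_cls[of s t]] by (simp add: distrib_left state_add[OF state])
  qed
  show "hinner H (hscale H c u) v = c * hinner H u v"
  proof (rule LIMSEQ_unique)
    show "(\<lambda>n. \<phi> (star (s n) * (c *\<^sub>C r n))) \<longlonglongrightarrow> hinner H (hscale H c u) v"
      using hinner_cls[of "\<lambda>n. c *\<^sub>C r n" s] by simp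
    show "(\<lambda>n. \<phi> (star (s n) * (c *\<^sub>C r n))) \<longlonglongrightarrow> c * hinner H u v"
      using tendsto_mult_left[OF hinner_cls[of r s], of c] by (simp add: mult_scaleC_right state_scaleC[OF state])
  qed
  show "hinner H v u = cnj (hinner H u v)"
  proof (rule LIMSEQ_unique)
    show "(\<lambda>n. \<phi> (star (r n) * s n)) \<longlonglongrightarrow> hinner H v u" using hinner_cls[of s r] by simp
    have "cnj (\<phi> (star (s n) * r n)) = \<phi> (star (r n) * s n)" for n
      by (simp add: state_star[OF state, symmetric] star_mult star_star)
    then show "(\<lambda>n. \<phi> (star (r n) * s n)) \<longlonglongrightarrow> cnj (hinner H u v)"
      using tendsto_cnj[OF hinner_cls[of r s]] by simp
  qed
  show "0 \<le> Re (hinner H u u)"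
  proof (rule LIMSEQ_le_const)
    show "(\<lambda>n. Re (\<phi> (star (r n) * r n))) \<longlonglongrightarrow> Re (hinner H u u)"
      using tendsto_Re[OF hinner_cls[of r r]] by simp
  qed (auto simp: state_Re_nonneg[OF state])
  show "u = hzero H" if "hinner H u u = 0"
  proof -
    have "(\<lambda>n. N (r n)) \<longlonglongrightarrow> 0" using hnorm_cls[of r] that by (simp add: hnorm_def)
    then show ?thesis by (simp add: hzero_eq cls_eq_iff cauchy_const)
  qed
next
  show "hzero H \<in> hcarrier H" by (simp add: hzero_eq cls_in cauchy_const)
next
  fix u :: "nat \<Rightarrow> (nat \<Rightarrow> 'a) set"
  assume "\<And>n. u n \<in> hcarrier H" "\<forall>e>0. \<exists>K. \<forall>m\<ge>K. \<forall>n\<ge>K. hdist H (u m) (u n) < e"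
  then show "\<exists>v\<in>hcarrier H. (\<lambda>n. hdist H (u n) v) \<longlonglongrightarrow> 0" by (rule gns_complete)
qed

lemma gns_rep_in: "u \<in> hcarrier H \<Longrightarrow> gns_rep \<phi> a u \<in> hcarrier H"
  by (auto elim!: carrierE simp: gns_rep_cls cls_in cauchy_left_mult)

lemma hnorm_gns_rep_le:
  assumes "u \<in> hcarrier H"
  shows "hnorm H (gns_rep \<phi> a u) \<le> norm a * hnorm H u"
proof -
  obtain s where s: "s \<in> C" "u = cls s" using assms by (auto elim: carrierE)
  show ?thesis
  proof (rule LIMSEQ_le)
    show "(\<lambda>n. N (a * s n)) \<longlonglongrightarrow> hnorm H (gns_rep \<phi> a u)"
      using hnorm_cls[OF cauchy_left_mult[OF s(1), of a]] by (simp add: s gns_rep_cls)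
    show "(\<lambda>n. norm a * N (s n)) \<longlonglongrightarrow> norm a * hnorm H u"
      unfolding s(2) by (intro tendsto_mult_left hnorm_cls s)
  qed (auto simp: N_left_mult)
qed

lemma bounded_operator_gns_rep: "bounded_operator H (gns_rep \<phi> a)"
  unfolding bounded_operator_def
proof (intro conjI ballI allI)
  fix u v c assume "u \<in> hcarrier H" "v \<in> hcarrier H"
  then obtain s t where "s \<in> C" "u = cls s" "t \<in> C" "v = cls t" by (metis carrierE)
  then show "gns_rep \<phi> a (hadd H u v) = hadd H (gns_rep \<phi> a u) (gns_rep \<phi> a v)"
    "gns_rep \<phi> a (hscale H c u) = hscale H c (gns_rep \<phi> a u)"
    by (simp_all add: hadd_cls hscale_cls gns_rep_cls cauchy_add cauchy_scaleC cauchy_left_mult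
        distrib_left mult_scaleC_right)
next
  show "\<exists>K. \<forall>u\<in>hcarrier H. hnorm H (gns_rep \<phi> a u) \<le> K * hnorm H u" using hnorm_gns_rep_le by blast
qed (rule gns_rep_in)

lemma hsum_cls:
  assumes "\<And>k. k < n \<Longrightarrow> s k \<in> C" "\<And>k. k < n \<Longrightarrow> f k = cls (s k)"
  shows "hsum H f n = cls (\<lambda>p. \<Sum>k<n. s k p) \<and> (\<lambda>p. \<Sum>k<n. s k p) \<in> C"
  using assms
proof (induction n)
  case 0 then show ?case by (simp add: hzero_eq cauchy_const)
next
  case (Suc n) then show ?case by (simp add: hadd_cls cauchy_add)
qed

end

text \<open>The entries of a column of norm at most 1 have norm at most 1; so the supremum in the
  definition of \<^const>\<open>matrix_norm\<close> is over a bounded set.\<close>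

lemma norm_le_column_norm:
  fixes x :: "nat \<Rightarrow> 'a::unital_cstar_algebra"
  assumes "k < n"
  shows "norm (x k) \<le> column_norm n x"
proof -
  have "(\<Sum>i<n. star (x i) * x i) - star (x k) * x k = (\<Sum>i\<in>{..<n} - {k}. star (x i) * x i)"
    using assms by (simp add: sum_diff1)
  then have "norm (star (x k) * x k) \<le> norm (\<Sum>i<n. star (x i) * x i)"
    by (intro positive_norm_mono) (auto intro!: positive_sum positive_star_mult_self)
  then show ?thesis by (simp add: column_norm_def cstar_identity real_le_rsqrt)
qed

lemma column_norm_nonneg: "column_norm n x \<ge> 0"
  by (simp add: column_norm_def)

lemma column_norm_matrix_le:
  assumes "column_norm n x \<le> 1"
  shows "column_norm n (\<lambda>i. \<Sum>k<n. a i k * x k) \<le> matrix_norm n (a :: nat \<Rightarrow> nat \<Rightarrow> 'a::unital_cstar_algebra)"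
proof -
  have "column_norm n (\<lambda>i. \<Sum>k<n. a i k * x k) \<le> sqrt (\<Sum>i<n. (\<Sum>k<n. norm (a i k))\<^sup>2)"
    if x: "column_norm n x \<le> 1" for x
  proof -
    have "norm (\<Sum>k<n. a i k * x k) \<le> (\<Sum>k<n. norm (a i k))" for i
    proof (rule order_trans[OF norm_sum], rule sum_mono)
      fix k assume "k \<in> {..<n}"
      then have "norm (x k) \<le> 1" using norm_le_column_norm[of k n x] x by simp
      then show "norm (a i k * x k) \<le> norm (a i k)"
        using norm_mult_ineq[of "a i k" "x k"] mult_left_le[of "norm (x k)" "norm (a i k)"] by simp
    qed
    then have "norm (\<Sum>i<n. star (\<Sum>k<n. a i k * x k) * (\<Sum>k<n. a i k * x k)) \<le> (\<Sum>i<n. (\<Sum>k<n. norm (a i k))\<^sup>2)"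
      by (intro order_trans[OF norm_sum] sum_mono) (simp add: cstar_identity power_mono)
    then show ?thesis by (simp add: column_norm_def)
  qed
  then have "bdd_above {column_norm n (\<lambda>i. \<Sum>k<n. a i k * x k) | x. column_norm n x \<le> 1}"
    by (intro bdd_aboveI) auto
  then show ?thesis unfolding matrix_norm_def using assms by (intro cSup_upper) auto
qed

lemma matrix_norm_nonneg: "matrix_norm n a \<ge> 0"
  using column_norm_matrix_le[of n "\<lambda>i. 0" a] column_norm_nonneg[of n "\<lambda>i. \<Sum>k<n. a i k * 0"]
  by (simp add: column_norm_def)

lemma matrix_norm_1: "matrix_norm 1 a = norm (a 0 0 :: 'a::unital_cstar_algebra)"
proof (rule antisym)
  have c1: "column_norm (Suc 0) x = norm (x 0)" for x :: "nat \<Rightarrow> 'a"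
    by (simp add: column_norm_def cstar_identity)
  show "matrix_norm 1 a \<le> norm (a 0 0)"
    unfolding matrix_norm_def
  proof (rule cSup_least)
    have "column_norm 1 (\<lambda>_. 0 :: 'a) \<le> 1" by (simp add: column_norm_def)
    then show "{column_norm 1 (\<lambda>i. \<Sum>k<1. a i k * x k) |x. column_norm 1 x \<le> 1} \<noteq> {}" by blast
    fix v assume "v \<in> {column_norm 1 (\<lambda>i. \<Sum>k<1. a i k * x k) |x. column_norm 1 x \<le> 1}"
    then obtain x where "v = norm (a 0 0 * x 0)" "norm (x 0) \<le> 1" by (auto simp: c1)
    then show "v \<le> norm (a 0 0)" using norm_mult_ineq[of "a 0 0" "x 0"] mult_left_le[of "norm (x 0)" "norm (a 0 0)"] by simp
  qed
  show "norm (a 0 0) \<le> matrix_norm 1 a"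
    using column_norm_matrix_le[of 1 "\<lambda>_. 1" a] by (simp add: c1)
qed

text \<open>With \<open>s = \<Sum>\<^sub>k x\<^sub>k\<^sup>* x\<^sub>k\<close> and \<open>c = (s + \<epsilon>)\<^bsup>-1/2\<^esup>\<close>, the column \<open>(x\<^sub>k c)\<^sub>k\<close> has norm at most 1. This bounds
  \<open>c t c\<close>, where \<open>t = \<Sum>\<^sub>i y\<^sub>i\<^sup>* y\<^sub>i\<close> for the image \<open>y\<close> of \<open>x\<close>, and multiplying back by \<open>r = c\<^sup>-\<^sup>1\<close> on both
  sides gives \<open>t \<le> K\<^sup>2 (s + \<epsilon>)\<close>. The \<open>\<epsilon>\<close> is there because \<open>s\<close> need not be invertible.\<close>

lemma (in gns) matrix_bound:
  fixes a :: "nat \<Rightarrow> nat \<Rightarrow> 'a"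
  shows "(\<Sum>i<n. (N (\<Sum>k<n. a i k * x k))\<^sup>2) \<le> (matrix_norm n a)\<^sup>2 * (\<Sum>k<n. (N (x k))\<^sup>2)"
proof -
  define K where "K = matrix_norm n a"
  have K: "K \<ge> 0" by (simp add: K_def matrix_norm_nonneg)
  define y where "y i = (\<Sum>k<n. a i k * x k)" for i
  define s where "s = (\<Sum>k<n. star (x k) * x k)"
  define t where "t = (\<Sum>i<n. star (y i) * y i)"
  have ps: "positive s" unfolding s_def by (intro positive_sum positive_star_mult_self)
  have \<phi>s: "Re (\<phi> s) = (\<Sum>k<n. (N (x k))\<^sup>2)" "Re (\<phi> t) = (\<Sum>i<n. (N (y i))\<^sup>2)"
    by (simp_all add: s_def t_def state_sum[OF state] gns_seminorm_sq[OF state])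
  have main: "Re (\<phi> t) \<le> K\<^sup>2 * (Re (\<phi> s) + \<epsilon>)" if \<epsilon>: "\<epsilon> > 0" for \<epsilon>
  proof -
    obtain i where i: "i * (s + \<epsilon> *\<^sub>R 1) = 1" "(s + \<epsilon> *\<^sub>R 1) * i = 1" "\<And>d. d * s = s * d \<Longrightarrow> d * i = i * d"
      by (rule positive_plus_pos_invertible[OF ps \<epsilon>]) blast
    have "positive (s + \<epsilon> *\<^sub>R 1)" using ps \<epsilon> by (intro positive_add positive_scaleR) auto
    then obtain r where r: "star r = r" "r * r = s + \<epsilon> *\<^sub>R 1" by (rule positive_root)
    have "r * (s + \<epsilon> *\<^sub>R 1) = (s + \<epsilon> *\<^sub>R 1) * r" by (simp add: r(2)[symmetric] mult.assoc)
    then have "r * s = s * r" by (simp add: ring_distribs)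
    then have ri: "r * i = i * r" by (rule i(3))
    have si: "star i = i"
    proof -
      have "(s + \<epsilon> *\<^sub>R 1) * star i = star (i * (s + \<epsilon> *\<^sub>R 1))"
        by (simp add: star_mult star_add star_scaleR positive_selfadjoint[OF ps])
      then have "(s + \<epsilon> *\<^sub>R 1) * star i = 1" by (simp add: i(1))
      then have "i * ((s + \<epsilon> *\<^sub>R 1) * star i) = i" by simp
      then have "i * (s + \<epsilon> *\<^sub>R 1) * star i = i" by (simp only: mult.assoc)
      then show ?thesis by (simp only: i(1) mult_1)
    qed
    define c where "c = r * i"
    have sc: "star c = c" by (simp add: c_def star_mult r(1) si ri)
    have rc: "r * c = 1" using i(2) by (simp add: c_def r(2) flip: mult.assoc)
    have cr: "c * r = 1" using arg_cong[OF rc, of star] by (simp add: star_mult r(1) sc)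
    have sum_c: "(\<Sum>k<n. star (z k * c) * (z k * c)) = c * (\<Sum>k<n. star (z k) * z k) * c" for z
      by (simp add: star_mult sc sum_distrib_left sum_distrib_right mult.assoc)
    have "c * (r * r) * c = (c * r) * (r * c)" by (simp only: mult.assoc)
    then have "c * (s + \<epsilon> *\<^sub>R 1) * c = 1" by (simp add: r(2) rc cr)
    then have "1 - c * s * c = \<epsilon> *\<^sub>R (star c * c)" by (simp add: sc ring_distribs diff_eq_eq add.commute)
    then have "positive (1 - c * s * c)" using \<epsilon> by (simp add: positive_scaleR positive_star_mult_self)
    moreover have "positive (c * s * c)" using positive_conjugate[OF ps, of c] by (simp add: sc)
    ultimately have "norm (c * s * c) \<le> 1" using positive_norm_mono by fastforce
    then have "column_norm n (\<lambda>k. x k * c) \<le> 1" unfolding column_norm_def sum_c s_def[symmetric] by simp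
    from column_norm_matrix_le[OF this, of a]
    have "column_norm n (\<lambda>i. y i * c) \<le> K"
      by (simp add: K_def y_def sum_distrib_right mult.assoc)
    then have "norm (c * t * c) \<le> K\<^sup>2"
      unfolding column_norm_def sum_c t_def[symmetric] using K by (metis real_sqrt_le_iff real_sqrt_abs abs_of_nonneg)
    moreover have "star t = t" by (simp add: t_def star_sum star_mult star_star)
    ultimately have "positive (K\<^sup>2 *\<^sub>R 1 - c * t * c)"
      by (intro positive_norm_diff) (simp_all add: star_mult sc mult.assoc)
    then have "positive (star r * (K\<^sup>2 *\<^sub>R 1 - c * t * c) * r)" by (rule positive_conjugate)
    also have "star r * (K\<^sup>2 *\<^sub>R 1 - c * t * c) * r = K\<^sup>2 *\<^sub>R (r * r) - (r * c) * t * (c * r)"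
      by (simp add: r(1) left_diff_distrib right_diff_distrib mult.assoc)
    also have "\<dots> = K\<^sup>2 *\<^sub>R (s + \<epsilon> *\<^sub>R 1) - t" by (simp only: rc cr r(2) mult_1 mult_1_right)
    finally have "Re (\<phi> (K\<^sup>2 *\<^sub>R (s + \<epsilon> *\<^sub>R 1) - t)) \<ge> 0" using state_positive[OF state] by blast
    then show ?thesis
      by (simp only: state_diff[OF state] state_scaleR[OF state] state_add[OF state] state_one[OF state]) simp
  qed
  have "((\<lambda>\<epsilon>. K\<^sup>2 * (Re (\<phi> s) + \<epsilon>)) \<longlongrightarrow> K\<^sup>2 * (Re (\<phi> s) + 0)) (at_right 0)"
    by (intro tendsto_intros)
  then have "Re (\<phi> t) \<le> K\<^sup>2 * (Re (\<phi> s) + 0)"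
    by (rule tendsto_lowerbound) (auto simp: eventually_at_right_less intro: eventually_mono[OF eventually_at_right_less main])
  then show ?thesis by (simp add: \<phi>s K_def y_def)
qed

context gns
begin

lemma operator_matrix_norm_gns_rep_le:
  "operator_matrix_norm H n (\<lambda>i k. gns_rep \<phi> (a i k)) \<le> matrix_norm n a"
  unfolding operator_matrix_norm_def
proof (rule cSup_least)
  have "(\<forall>k<n. hzero H \<in> hcarrier H) \<and> (\<Sum>k<n. (hnorm H (hzero H))\<^sup>2) \<le> 1"
    using hnorm_cls[OF cauchy_const[of 0]]
    by (simp add: N_zero hzero_eq LIMSEQ_const_iff cls_in cauchy_const)
  then show "{sqrt (\<Sum>i<n. (hnorm H (hsum H (\<lambda>k. gns_rep \<phi> (a i k) (u k)) n))\<^sup>2) |u.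
     (\<forall>k<n. u k \<in> hcarrier H) \<and> (\<Sum>k<n. (hnorm H (u k))\<^sup>2) \<le> 1} \<noteq> {}"
    by (auto intro!: exI[of _ "\<lambda>_. hzero H"])
next
  fix v assume "v \<in> {sqrt (\<Sum>i<n. (hnorm H (hsum H (\<lambda>k. gns_rep \<phi> (a i k) (u k)) n))\<^sup>2) |u.
     (\<forall>k<n. u k \<in> hcarrier H) \<and> (\<Sum>k<n. (hnorm H (u k))\<^sup>2) \<le> 1}"
  then obtain u where u: "\<And>k. k < n \<Longrightarrow> u k \<in> hcarrier H" "(\<Sum>k<n. (hnorm H (u k))\<^sup>2) \<le> 1"
    and v: "v = sqrt (\<Sum>i<n. (hnorm H (hsum H (\<lambda>k. gns_rep \<phi> (a i k) (u k)) n))\<^sup>2)" by auto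
  have "\<forall>k. \<exists>s. k < n \<longrightarrow> s \<in> C \<and> u k = cls s" using carrierE[OF u(1)] by metis
  then obtain s where s: "\<And>k. k < n \<Longrightarrow> s k \<in> C" "\<And>k. k < n \<Longrightarrow> u k = cls (s k)" by metis
  have hs: "hsum H (\<lambda>k. gns_rep \<phi> (a i k) (u k)) n = cls (\<lambda>p. \<Sum>k<n. a i k * s k p)
      \<and> (\<lambda>p. \<Sum>k<n. a i k * s k p) \<in> C" for i
    by (rule hsum_cls) (simp_all add: s gns_rep_cls cauchy_left_mult)
  have "(\<lambda>p. \<Sum>i<n. (N (\<Sum>k<n. a i k * s k p))\<^sup>2) \<longlonglongrightarrow> (\<Sum>i<n. (hnorm H (hsum H (\<lambda>k. gns_rep \<phi> (a i k) (u k)) n))\<^sup>2)"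
    using hs by (intro tendsto_sum tendsto_power) (simp add: hnorm_cls)
  moreover have "(\<lambda>p. (matrix_norm n a)\<^sup>2 * (\<Sum>k<n. (N (s k p))\<^sup>2)) \<longlonglongrightarrow> (matrix_norm n a)\<^sup>2 * (\<Sum>k<n. (hnorm H (u k))\<^sup>2)"
    by (intro tendsto_mult_left tendsto_sum tendsto_power) (simp add: s hnorm_cls)
  ultimately have "(\<Sum>i<n. (hnorm H (hsum H (\<lambda>k. gns_rep \<phi> (a i k) (u k)) n))\<^sup>2)
      \<le> (matrix_norm n a)\<^sup>2 * (\<Sum>k<n. (hnorm H (u k))\<^sup>2)"
    by (rule LIMSEQ_le) (simp add: matrix_bound)
  also have "\<dots> \<le> (matrix_norm n a)\<^sup>2 * 1" using u(2) by (rule mult_left_mono) simp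
  finally show "v \<le> matrix_norm n a" unfolding v by (intro real_le_lsqrt) (auto simp: matrix_norm_nonneg)
qed

theorem representation_gns_rep: "representation UNIV H (gns_rep \<phi>)"
  unfolding representation_def
proof (intro conjI ballI allI impI)
  show "hilbert_space H" by unfold_locales
  show "bounded_operator H (gns_rep \<phi> a)" for a by (rule bounded_operator_gns_rep)
  fix a b c u assume "u \<in> hcarrier H"
  then obtain s where s: "s \<in> C" "u = cls s" by (rule carrierE)
  then show "gns_rep \<phi> (a + b) u = hadd H (gns_rep \<phi> a u) (gns_rep \<phi> b u)"
    "gns_rep \<phi> (c *\<^sub>C a) u = hscale H c (gns_rep \<phi> a u)"
    "gns_rep \<phi> (a * b) u = gns_rep \<phi> a (gns_rep \<phi> b u)"
    by (simp_all add: gns_rep_cls hadd_cls hscale_cls cauchy_left_mult distrib_right mult_scaleC_left mult.assoc)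
next
  show "operator_matrix_norm H n (\<lambda>i k. gns_rep \<phi> (a i k)) \<le> matrix_norm n a" for n a
    by (rule operator_matrix_norm_gns_rep_le)
qed

abbreviation vec :: "'a \<Rightarrow> (nat \<Rightarrow> 'a) set" where "vec a \<equiv> cls (\<lambda>n. a)"

lemma vec_in: "vec a \<in> hcarrier H"
  by (simp add: cls_in cauchy_const)

lemma gns_rep_vec: "gns_rep \<phi> a (vec b) = vec (a * b)"
  by (simp add: gns_rep_cls cauchy_const)

lemma hinner_vec: "hinner H (vec a) (vec b) = \<phi> (star b * a)"
  using hinner_cls[OF cauchy_const[of a] cauchy_const[of b]] by (simp add: LIMSEQ_const_iff)

lemma hnorm_vec: "hnorm H (vec a) = N a"
  by (simp add: hnorm_def hinner_vec gns_seminorm_def)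

lemma vec_eq_iff: "vec a = vec b \<longleftrightarrow> N (a - b) = 0"
  by (simp add: cls_eq_iff cauchy_const LIMSEQ_const_iff)

lemma hscale_vec: "hscale H c (vec a) = vec (c *\<^sub>C a)"
  by (simp add: hscale_cls cauchy_const)

lemma vec_dense:
  assumes "u \<in> hcarrier H"
  obtains s where "(\<lambda>n. hdist H (vec (s n)) u) \<longlonglongrightarrow> 0"
proof -
  obtain s where s: "s \<in> C" "u = cls s" using assms by (rule carrierE)
  have "(\<lambda>n. hdist H (vec (s n)) u) \<longlonglongrightarrow> 0"
  proof (rule LIMSEQ_I)
    fix e :: real assume e: "e > 0"
    obtain K where K: "\<And>m n. m \<ge> K \<Longrightarrow> n \<ge> K \<Longrightarrow> N (s m - s n) < e/2" using cauchyD[OF s(1), of "e/2"] e by auto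
    have "norm (hdist H (vec (s n)) u - 0) < e" if "n \<ge> K" for n
    proof -
      have lim: "(\<lambda>i. N (s n - s i)) \<longlonglongrightarrow> hdist H (vec (s n)) u"
        using hdist_cls[OF cauchy_const s(1)] s(2) by simp
      have "hdist H (vec (s n)) u \<le> e/2" by (rule LIMSEQ_le_const2[OF lim]) (use K that in \<open>force intro: less_imp_le\<close>)
      moreover have "hdist H (vec (s n)) u \<ge> 0" by (rule LIMSEQ_le_const[OF lim]) (simp add: N_nonneg)
      ultimately show ?thesis using e by simp
    qed
    then show "\<exists>no. \<forall>n\<ge>no. norm (hdist H (vec (s n)) u - 0) < e" by blast
  qed
  then show ?thesis by (rule that)
qed

lemma hinner_gns_rep:
  assumes "u \<in> hcarrier H" "v \<in> hcarrier H"
  shows "hinner H (gns_rep \<phi> a u) v = hinner H u (gns_rep \<phi> (star a) v)"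
proof -
  obtain s where s: "s \<in> C" "u = cls s" using assms by (auto elim: carrierE)
  obtain t where t: "t \<in> C" "v = cls t" using assms by (auto elim: carrierE)
  show ?thesis
  proof (rule LIMSEQ_unique)
    show "(\<lambda>n. \<phi> (star (t n) * (a * s n))) \<longlonglongrightarrow> hinner H (gns_rep \<phi> a u) v"
      using hinner_cls[OF cauchy_left_mult[OF s(1), of a] t(1)] s t by (simp add: gns_rep_cls)
    show "(\<lambda>n. \<phi> (star (t n) * (a * s n))) \<longlonglongrightarrow> hinner H u (gns_rep \<phi> (star a) v)"
      using hinner_cls[OF s(1) cauchy_left_mult[OF t(1), of "star a"]] s t
      by (simp add: gns_rep_cls star_mult star_star mult.assoc)
  qed
qed

lemma hzero_vec: "hzero H = vec 0"
  by (rule hzero_eq)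

lemma operator_values_le_norm:
  "v \<in> {hnorm H (gns_rep \<phi> a u) | u. u \<in> hcarrier H \<and> hnorm H u \<le> 1} \<Longrightarrow> v \<le> norm a"
  using hnorm_gns_rep_le[of _ a] mult_left_le[of _ "norm a"] by (fastforce intro: order_trans)

lemma operator_norm_gns_rep_le: "operator_norm H (gns_rep \<phi> a) \<le> norm a"
  unfolding operator_norm_def
proof (rule cSup_least)
  have "hnorm H (vec 0) \<le> 1" by (simp add: hnorm_vec N_zero)
  then show "{hnorm H (gns_rep \<phi> a u) |u. u \<in> hcarrier H \<and> hnorm H u \<le> 1} \<noteq> {}" using vec_in by blast
qed (rule operator_values_le_norm)

lemma seminorm_le_operator_norm: "N (a * x) \<le> operator_norm H (gns_rep \<phi> a) * N x"
proof (cases "N x = 0")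
  case True
  then show ?thesis using N_left_mult[of a x] by simp
next
  case False
  then have x: "N x > 0" using N_nonneg[of x] by simp
  define z where "z = complex_of_real (1 / N x) *\<^sub>C x"
  have "hnorm H (vec z) \<le> 1" using x by (simp add: hnorm_vec z_def N_scaleC norm_divide)
  then have "hnorm H (gns_rep \<phi> a (vec z)) \<le> operator_norm H (gns_rep \<phi> a)"
    unfolding operator_norm_def by (intro cSup_upper bdd_aboveI[of _ "norm a"] operator_values_le_norm) (use vec_in in blast)+
  moreover have "hnorm H (gns_rep \<phi> a (vec z)) = N (a * x) / N x"
    using x by (simp add: gns_rep_vec hnorm_vec z_def mult_scaleC_right N_scaleC norm_divide)
  ultimately show ?thesis using x by (simp add: field_simps)
qed

end

section \<open>Orthogonal projections\<close>

lemma parallelogram_estimate: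
  fixes D p q r e f :: real
  assumes "p < D + e" "q < D + f" "D \<le> r"
  shows "2 * p + 2 * q - 4 * r < 2 * e + 2 * f"
  using assms by linarith

context hilbert_space
begin

lemma inner_add_right:
  "\<lbrakk>u \<in> hcarrier H; v \<in> hcarrier H; w \<in> hcarrier H\<rbrakk> \<Longrightarrow> hinner H w (hadd H u v) = hinner H w u + hinner H w v"
  using inner_commute[of "hadd H u v" w] inner_commute[of u w] inner_commute[of v w]
  by (simp add: add_closed inner_add_left)

lemma inner_scale_right:
  "\<lbrakk>u \<in> hcarrier H; v \<in> hcarrier H\<rbrakk> \<Longrightarrow> hinner H u (hscale H c v) = cnj c * hinner H u v"
  using inner_commute[of "hscale H c v" u] inner_commute[of v u]
  by (simp add: scale_closed inner_scale_left)

lemmas inner_simps = inner_add_left inner_scale_left inner_add_right inner_scale_right add_closed scale_closed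

lemma inner_self_Im: "u \<in> hcarrier H \<Longrightarrow> Im (hinner H u u) = 0"
  using inner_commute[of u u] by (simp add: complex_eq_iff)

lemma inner_zero_left: "u \<in> hcarrier H \<Longrightarrow> hinner H (hzero H) u = 0"
  using inner_add_left[of "hzero H" "hzero H" u] add_zero[of "hzero H"] by (simp add: zero_closed)

lemma eq_if_diff_zero:
  assumes "u \<in> hcarrier H" "v \<in> hcarrier H" "hadd H u (hscale H (- 1) v) = hzero H"
  shows "u = v"
proof -
  have v': "hscale H (- 1) v \<in> hcarrier H" using assms by (simp add: scale_closed)
  have "u = hadd H (hzero H) u" using assms by (simp add: add_zero)
  also have "hzero H = hadd H v (hscale H (- 1) v)" using assms by (simp add: add_inverse)
  also have "hadd H (hadd H v (hscale H (- 1) v)) u = hadd H v (hadd H u (hscale H (- 1) v))"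
    using assms v' add_commute[of "hscale H (- 1) v" u] by (simp add: add_assoc)
  also have "\<dots> = v" using assms add_commute[of v "hzero H"] add_zero[of v] by (simp add: zero_closed)
  finally show ?thesis .
qed

lemma hdist_sq:
  assumes "u \<in> hcarrier H" "v \<in> hcarrier H"
  shows "(hdist H u v)\<^sup>2 = Re (hinner H u u) - 2 * Re (hinner H u v) + Re (hinner H v v)"
proof -
  have "(hdist H u v)\<^sup>2 = Re (hinner H (hadd H u (hscale H (- 1) v)) (hadd H u (hscale H (- 1) v)))"
    unfolding hdist_def hnorm_def using assms by (simp add: inner_ge_zero add_closed scale_closed)
  also have "\<dots> = Re (hinner H u u) - 2 * Re (hinner H u v) + Re (hinner H v v)"
    using assms inner_commute[of u v] by (simp add: inner_simps)
  finally show ?thesis .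
qed

lemma hdist_zero_imp_eq: "u \<in> hcarrier H \<Longrightarrow> v \<in> hcarrier H \<Longrightarrow> hdist H u v = 0 \<Longrightarrow> u = v"
proof -
  assume uv: "u \<in> hcarrier H" "v \<in> hcarrier H" "hdist H u v = 0"
  let ?d = "hadd H u (hscale H (- 1) v)"
  have d: "?d \<in> hcarrier H" using uv by (simp add: add_closed scale_closed)
  have "Re (hinner H ?d ?d) = 0" using uv(3) by (simp add: hdist_def hnorm_def)
  then have "hinner H ?d ?d = 0" using inner_self_Im[OF d] by (simp add: complex_eq_iff)
  then have "?d = hzero H" by (rule inner_eq_zero[OF d])
  then show "u = v" using eq_if_diff_zero uv by blast
qed

lemma Cauchy_Schwarz:
  assumes "u \<in> hcarrier H" "v \<in> hcarrier H"
  shows "cmod (hinner H u v) \<le> hnorm H u * hnorm H v"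
proof -
  have "(cmod (hinner H u v))\<^sup>2 \<le> Re (hinner H u u) * Re (hinner H v v)"
  proof (rule quadratic_bound)
    fix c
    let ?w = "hadd H u (hscale H (- c) v)"
    have "hinner H ?w ?w = hinner H u u - cnj c * hinner H u v - c * cnj (hinner H u v) + c * cnj c * hinner H v v"
      using assms inner_commute[of u v] by (simp add: inner_simps algebra_simps)
    also have "Re \<dots> = Re (hinner H u u) - 2 * Re (cnj c * hinner H u v) + (cmod c)\<^sup>2 * Re (hinner H v v)"
      using inner_self_Im[OF assms(2)]
      by (simp add: cmod_mult_self power2_eq_square algebra_simps)
    finally show "0 \<le> Re (hinner H u u) - 2 * Re (cnj c * hinner H u v) + (cmod c)\<^sup>2 * Re (hinner H v v)"
      using inner_ge_zero[of ?w] assms by (simp add: inner_simps)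
  qed (simp add: assms inner_ge_zero)
  then show ?thesis by (simp add: hnorm_def real_sqrt_mult[symmetric] real_le_rsqrt)
qed

lemma tendsto_hinner:
  assumes s: "\<And>n. s n \<in> hcarrier H" and u: "u \<in> hcarrier H" and w: "w \<in> hcarrier H"
    and lim: "(\<lambda>n. hdist H (s n) u) \<longlonglongrightarrow> 0"
  shows "(\<lambda>n. hinner H (s n) w) \<longlonglongrightarrow> hinner H u w"
proof -
  have "cmod (hinner H (s n) w - hinner H u w) \<le> hdist H (s n) u * hnorm H w" for n
    using Cauchy_Schwarz[of "hadd H (s n) (hscale H (- 1) u)" w] s[of n] u w
    by (simp add: inner_simps hdist_def)
  moreover have "(\<lambda>n. hdist H (s n) u * hnorm H w) \<longlonglongrightarrow> 0"
    using tendsto_mult_right[OF lim, of "hnorm H w"] by simp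
  ultimately have "(\<lambda>n. hinner H (s n) w - hinner H u w) \<longlonglongrightarrow> 0"
    by (rule tendsto_norm_zero_cancel[OF tendsto_zero_le[OF norm_ge_zero]])
  then show ?thesis by (rule LIM_zero_cancel)
qed

text \<open>A sequence in \<open>S\<close> minimizing the distance to \<open>u\<close> is Cauchy by the parallelogram law. Comparing its
  members with their translates by \<open>c w\<close> bounds a linear term in \<open>c\<close> by a quadratic one, which forces
  \<open>u - v\<close> to be orthogonal to \<open>w\<close>.\<close>

theorem orthogonal_projection:
  assumes S: "closed_subspace H S" and u: "u \<in> hcarrier H"
  obtains v where "v \<in> S" "\<And>w. w \<in> S \<Longrightarrow> hinner H u w = hinner H v w"
proof -
  have SH: "w \<in> hcarrier H" if "w \<in> S" for w using S that by (auto simp: closed_subspace_def)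
  have S0: "hzero H \<in> S" and Sadd: "\<And>u v. u \<in> S \<Longrightarrow> v \<in> S \<Longrightarrow> hadd H u v \<in> S"
    and Sscale: "\<And>c u. u \<in> S \<Longrightarrow> hscale H c u \<in> S"
    using S by (auto simp: closed_subspace_def)
  define D where "D = Inf ((\<lambda>w. (hdist H u w)\<^sup>2) ` S)"
  have bdd: "bdd_below ((\<lambda>w. (hdist H u w)\<^sup>2) ` S)" by (rule bdd_belowI[of _ 0]) auto
  have D: "D \<le> (hdist H u w)\<^sup>2" if "w \<in> S" for w
    unfolding D_def by (rule cInf_lower[OF imageI[OF that] bdd])
  have "\<exists>w\<in>S. (hdist H u w)\<^sup>2 < D + 1 / real (Suc n)" for n
  proof -
    have "Inf ((\<lambda>w. (hdist H u w)\<^sup>2) ` S) < D + 1 / real (Suc n)" by (simp add: D_def)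
    then show ?thesis using cInf_lessD[of "(\<lambda>w. (hdist H u w)\<^sup>2) ` S"] S0 by blast
  qed
  then obtain s where s: "\<And>n. s n \<in> S" "\<And>n. (hdist H u (s n))\<^sup>2 < D + 1 / real (Suc n)" by metis
  have par: "(hdist H (s m) (s n))\<^sup>2 < 2 / real (Suc m) + 2 / real (Suc n)" for m n
  proof -
    let ?c = "hscale H (1/2) (hadd H (s m) (s n))"
    have c: "?c \<in> S" by (intro Sscale Sadd s)
    note sH = SH[OF s(1)[of m]] SH[OF s(1)[of n]]
    have "(hdist H (s m) (s n))\<^sup>2 = 2 * (hdist H u (s m))\<^sup>2 + 2 * (hdist H u (s n))\<^sup>2 - 4 * (hdist H u ?c)\<^sup>2"
      using u sH inner_commute[OF sH] by (simp add: hdist_sq inner_simps algebra_simps)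
    also have "\<dots> < 2 * (1 / real (Suc m)) + 2 * (1 / real (Suc n))"
      by (rule parallelogram_estimate[OF s(2) s(2) D[OF c]])
    finally show ?thesis by simp
  qed
  have "\<exists>v\<in>hcarrier H. (\<lambda>n. hdist H (s n) v) \<longlonglongrightarrow> 0"
  proof (rule complete[OF SH[OF s(1)]], intro allI impI)
    fix e :: real assume e: "e > 0"
    obtain K where K: "1 / real (Suc K) < e\<^sup>2 / 4" using nat_approx_posE[of "e\<^sup>2/4"] e by auto
    have "hdist H (s m) (s n) < e" if "m \<ge> K" "n \<ge> K" for m n
    proof (rule power2_less_imp_less)
      have "1 / real (Suc m) \<le> 1 / real (Suc K)" "1 / real (Suc n) \<le> 1 / real (Suc K)"
        using that by (simp_all add: frac_le)
      then show "(hdist H (s m) (s n))\<^sup>2 < e\<^sup>2" using par[of m n] K by simp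
    qed (use e in simp)
    then show "\<exists>K. \<forall>m\<ge>K. \<forall>n\<ge>K. hdist H (s m) (s n) < e" by blast
  qed
  then obtain v where v: "v \<in> hcarrier H" "(\<lambda>n. hdist H (s n) v) \<longlonglongrightarrow> 0" by blast
  have vS: "v \<in> S" using S v s(1) unfolding closed_subspace_def by blast
  have "hinner H u w = hinner H v w" if w: "w \<in> S" for w
  proof -
    define k where "k n = hinner H u w - hinner H (s n) w" for n
    have lim: "k \<longlonglongrightarrow> hinner H u w - hinner H v w"
      unfolding k_def by (intro tendsto_intros tendsto_hinner SH s v w)
    have "0 \<le> 0 - 2 * Re (cnj c * (hinner H u w - hinner H v w)) + (cmod c)\<^sup>2 * Re (hinner H w w)" for c
    proof (rule LIMSEQ_le[of "\<lambda>n. - (1 / real (Suc n))"])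
      show "(\<lambda>n. - (1 / real (Suc n))) \<longlonglongrightarrow> 0"
        using tendsto_minus[OF LIMSEQ_inverse_real_of_nat] by (simp add: inverse_eq_divide)
      show "(\<lambda>n. 0 - 2 * Re (cnj c * k n) + (cmod c)\<^sup>2 * Re (hinner H w w))
        \<longlonglongrightarrow> 0 - 2 * Re (cnj c * (hinner H u w - hinner H v w)) + (cmod c)\<^sup>2 * Re (hinner H w w)"
        by (intro tendsto_intros lim)
      have "- (1 / real (Suc n)) \<le> 0 - 2 * Re (cnj c * k n) + (cmod c)\<^sup>2 * Re (hinner H w w)" for n
      proof -
        let ?w = "hadd H (s n) (hscale H c w)"
        note sH = SH[OF s(1)[of n]] SH[OF w]
        have wH: "?w \<in> hcarrier H" using sH by (simp add: inner_simps)
        have "(hdist H u ?w)\<^sup>2 = (hdist H u (s n))\<^sup>2 - 2 * Re (cnj c * k n) + (cmod c)\<^sup>2 * Re (hinner H w w)"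
          unfolding hdist_sq[OF u wH] hdist_sq[OF u sH(1)]
          using u sH inner_commute[OF sH] inner_self_Im[OF sH(2)]
          by (simp add: inner_simps k_def cmod_mult_self power2_eq_square algebra_simps)
        moreover have "D \<le> (hdist H u ?w)\<^sup>2" by (intro D Sadd Sscale s w)
        ultimately show ?thesis using s(2)[of n] by linarith
      qed
      then show "\<exists>N. \<forall>n\<ge>N. - (1 / real (Suc n)) \<le> 0 - 2 * Re (cnj c * k n) + (cmod c)\<^sup>2 * Re (hinner H w w)" by blast
    qed
    then have "(cmod (hinner H u w - hinner H v w))\<^sup>2 \<le> 0 * Re (hinner H w w)"
      by (rule quadratic_bound) (simp add: inner_ge_zero SH w)
    then show ?thesis by simp
  qed
  then show ?thesis using that vS by blast
qed

end


section \<open>The representation at a point with trivial isotropy\<close>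

lemma (in cartan_pair) transported_star:
  assumes y: "y \<in> X" and n: "normalizing n" and h: "h \<in> M"
  shows "transported y n (star h) = cnj (transported y n h)"
proof -
  have "star (star n * (h * n)) = star n * (star h * n)" by (simp add: star_mult star_star mult.assoc)
  moreover have "cnj (y (star n * n)) = y (star n * n)"
    using char_star_normalizer_pos[OF y n] by (simp add: complex_eq_iff)
  ultimately show ?thesis
    using char_star[OF y normalizing_conj[OF n h]] by (simp add: transported_def)
qed

locale trivial_isotropy_point = cartan_pair M E
  for M :: "'a::unital_cstar_algebra set" and E +
  fixes y assumes trivial: "y \<in> trivial_isotropy_points M E"
begin

lemma y_in: "y \<in> X"
  using trivial by (simp add: trivial_isotropy_points_def)

sublocale gns "point_state E y"
  by unfold_locales (rule state_point_state[OF y_in])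

abbreviation "\<rho> \<equiv> point_state E y"
abbreviation "rep \<equiv> gns_rep \<rho>"

text \<open>The normalizers with \<open>\<pi>(n)\<xi> \<noteq> 0\<close>.\<close>

definition active :: "'a \<Rightarrow> bool" where "active n \<longleftrightarrow> normalizing n \<and> y (star n * n) \<noteq> 0"

lemma rho_M: "m \<in> M \<Longrightarrow> \<rho> m = y m"
  by (rule point_state_on_M)

lemma inactive: "normalizing n \<Longrightarrow> \<not> active n \<Longrightarrow> N n = 0"
  by (simp add: active_def gns_seminorm_def rho_M normalizing_star_mult)

lemma active_one: "active 1"
  by (simp add: active_def normalizing_in one_in char_one[OF y_in])

lemma rep_eigen:
  assumes "active n" "h \<in> M"
  shows "rep h (vec n) = hscale H (transported y n h) (vec n)"
  using gns_seminorm_normalizer_eigen[OF y_in _ _ assms(2), of n] assms(1)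
  by (simp add: gns_rep_vec hscale_vec vec_eq_iff active_def)

text \<open>This is the only use of trivial isotropy: a normalizer that fixes \<open>y\<close> acts on \<open>\<xi>\<close> as a scalar.\<close>

lemma fixing_seminorm:
  assumes k: "normalizing k" and f: "fixes_point k y"
  shows "N (k - y (E k) *\<^sub>C 1) = 0"
proof -
  define c where "c = y (E k)"
  have "c \<noteq> 0"
    using trivial k f nontrivial_isotropy_iff[OF y_in] by (auto simp: trivial_isotropy_points_def c_def)
  then have "y (star k * k) = complex_of_real ((cmod c)\<^sup>2)"
    using char_E_normalizer[OF k y_in] by (simp add: c_def)
  then have kk: "\<rho> (star k * k) = cnj c * c"
    by (simp only: rho_M[OF normalizing_star_mult[OF k]] complex_norm_square mult.commute)
  have "\<rho> k = c" by (simp add: point_state_def c_def)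
  then have k': "\<rho> k = c" "\<rho> (star k) = cnj c" by (simp_all add: state_star[OF state])
  have "star (k - c *\<^sub>C 1) * (k - c *\<^sub>C 1) = star k * k - c *\<^sub>C star k - cnj c *\<^sub>C k + (cnj c * c) *\<^sub>C 1"
    by (simp add: star_simps left_diff_distrib right_diff_distrib mult_scaleC_left mult_scaleC_right
        scaleC_scaleC scaleC_diff_right mult.commute[of "cnj c" c])
  then have "\<rho> (star (k - c *\<^sub>C 1) * (k - c *\<^sub>C 1)) = 0"
    by (simp add: state_add[OF state] state_diff[OF state] state_scaleC[OF state] state_one[OF state] k' kk)
  then show ?thesis by (simp add: gns_seminorm_def c_def)
qed

lemma transported_mult:
  "active n \<Longrightarrow> h \<in> M \<Longrightarrow> transported y n h * y (star n * n) = y (star n * (h * n))"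
  by (simp add: transported_def active_def)

lemma fixes_point_product:
  assumes n: "active n" and m: "active m" and eq: "\<And>h. h \<in> M \<Longrightarrow> transported y n h = transported y m h"
  shows "fixes_point (star n * m) y"
proof -
  have nn: "normalizing n" "normalizing m" using n m by (simp_all add: active_def)
  have key: "y (star (star n * m) * (h * (star n * m))) = y h * (y (star n * n) * y (star m * m))" if h: "h \<in> M" for h
  proof -
    have nhn: "n * (h * star n) \<in> M" by (rule normalizing_conj'[OF nn(1) h])
    have "star (star n * m) * (h * (star n * m)) = star m * ((n * (h * star n)) * m)"
      by (simp add: star_mult star_star mult.assoc)
    then have "y (star (star n * m) * (h * (star n * m))) = transported y n (n * (h * star n)) * y (star m * m)"
      using transported_mult[OF m nhn] eq[OF nhn] by simp
    also have "transported y n (n * (h * star n)) = y h * y (star n * n)"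
    proof -
      have "star n * ((n * (h * star n)) * n) = (star n * n) * (h * (star n * n))" by (simp add: mult.assoc)
      then have "y (star n * ((n * (h * star n)) * n)) = y (star n * n) * (y h * y (star n * n))"
        using y_in by (simp add: char_mult normalizing_star_mult[OF nn(1)] h mult_in)
      then show ?thesis using n by (simp add: transported_def active_def)
    qed
    finally show ?thesis by simp
  qed
  have "y (star (star n * m) * (star n * m)) = y (star n * n) * y (star m * m)"
    using key[OF one_in] char_one[OF y_in] by simp
  then show ?thesis using key n m by (simp add: fixes_point_def active_def)
qed

text \<open>The normalizer \<open>n\<^sup>* m\<close> fixes \<open>y\<close>, so \<open>\<pi>(n\<^sup>* m)\<xi> = c\<xi>\<close> and \<open>\<pi>(n n\<^sup>*) \<pi>(m)\<xi> = c \<pi>(n)\<xi>\<close>; and \<open>n n\<^sup>*\<close> acts on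
  \<open>\<pi>(m)\<xi>\<close> as the scalar by which it acts on \<open>\<pi>(n)\<xi>\<close>, which is not 0.\<close>

lemma same_character_parallel:
  assumes n: "active n" and m: "active m" and eq: "\<And>h. h \<in> M \<Longrightarrow> transported y n h = transported y m h"
  obtains c where "vec m = hscale H c (vec n)"
proof -
  have nn: "normalizing n" "normalizing m" "y (star n * n) \<noteq> 0" using n m by (simp_all add: active_def)
  define k where "k = star n * m"
  define c where "c = y (E k)"
  have "normalizing k" by (simp add: k_def normalizing_mult normalizing_star nn)
  then have "vec k = vec (c *\<^sub>C 1)"
    using fixing_seminorm fixes_point_product[OF n m eq] by (simp add: vec_eq_iff c_def k_def)
  then have "rep n (vec k) = rep n (vec (c *\<^sub>C 1))" by simp
  then have 1: "vec (n * star n * m) = hscale H c (vec n)"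
    by (simp add: gns_rep_vec hscale_vec k_def mult_scaleC_right mult.assoc)
  have nnM: "n * star n \<in> M" by (rule normalizing_mult_star[OF nn(1)])
  have "transported y m (n * star n) = transported y n (n * star n)" by (rule eq[OF nnM, symmetric])
  also have "star n * ((n * star n) * n) = (star n * n) * (star n * n)" by (simp add: mult.assoc)
  then have "transported y n (n * star n) = y (star n * n)"
    using nn(3) by (simp add: transported_def char_mult[OF y_in] normalizing_star_mult[OF nn(1)])
  finally have "vec (n * star n * m) = hscale H (y (star n * n)) (vec m)"
    using rep_eigen[OF m nnM] by (simp add: gns_rep_vec)
  then have "hscale H (1 / y (star n * n)) (hscale H (y (star n * n)) (vec m))
      = hscale H (1 / y (star n * n)) (hscale H c (vec n))" using 1 by simp
  then have "vec m = hscale H (1 / y (star n * n) * c) (vec n)"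
    using nn(3) by (simp add: scale_scale vec_in scale_one)
  then show ?thesis by (rule that)
qed

text \<open>The vectors \<open>\<pi>(n)\<xi>\<close> are total, by \<open>normalizer_induct\<close> and the density of the vectors \<open>\<pi>(a)\<xi>\<close>.\<close>

lemma vec_separating:
  assumes u: "u \<in> hcarrier H" and v: "v \<in> hcarrier H"
    and eq: "\<And>n. active n \<Longrightarrow> hinner H u (vec n) = hinner H v (vec n)"
  shows "u = v"
proof -
  have bl: "bounded_linear (\<lambda>a. hinner H w (vec a))" if w: "w \<in> hcarrier H" for w
  proof (rule bounded_linear_intro[where K="hnorm H w"])
    fix a b and r :: real
    have "vec (a + b) = hadd H (vec a) (vec b)" by (simp add: hadd_cls cauchy_const)
    then show "hinner H w (vec (a + b)) = hinner H w (vec a) + hinner H w (vec b)"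
      using w by (simp add: inner_simps vec_in)
    have "vec (r *\<^sub>R a) = hscale H (complex_of_real r) (vec a)" by (simp add: hscale_vec scaleR_scaleC)
    then show "hinner H w (vec (r *\<^sub>R a)) = r *\<^sub>R hinner H w (vec a)"
      using w by (simp add: inner_simps vec_in scaleR_conv_of_real)
    have "cmod (hinner H w (vec a)) \<le> hnorm H w * hnorm H (vec a)" by (rule Cauchy_Schwarz[OF w vec_in])
    also have "\<dots> \<le> hnorm H w * norm a"
      using N_le_norm[of a] inner_ge_zero[OF w] by (intro mult_left_mono) (simp_all add: hnorm_vec hnorm_def[of H w])
    finally show "norm (hinner H w (vec a)) \<le> norm a * hnorm H w" by (simp add: mult.commute)
  qed
  have all: "hinner H u (vec a) = hinner H v (vec a)" for a
  proof (induction a rule: normalizer_induct)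
    case closed
    show ?case by (intro closed_Collect_eq linear_continuous_on bl u v)
  next
    case zero
    show ?case using linear_0[OF bounded_linear.linear[OF bl[OF u]]] linear_0[OF bounded_linear.linear[OF bl[OF v]]] by simp
  next
    case (add a b)
    then show ?case by (simp add: linear_add[OF bounded_linear.linear[OF bl[OF u]]] linear_add[OF bounded_linear.linear[OF bl[OF v]]])
  next
    case (scale a c)
    then show ?case using u v by (simp add: hscale_vec[symmetric] inner_simps vec_in)
  next
    case (normalizing n)
    show ?case
    proof (cases "active n")
      case False
      then have "N (n - 0) = 0" using inactive[OF normalizing] by simp
      then have "vec n = hzero H" by (simp only: hzero_vec vec_eq_iff)
      then show ?thesis using inner_zero_left inner_commute u v zero_closed by (metis complex_cnj_zero)
    qed (rule eq)
  qed
  define z where "z = hadd H u (hscale H (- 1) v)"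
  have z: "z \<in> hcarrier H" using u v by (simp add: z_def inner_simps)
  have zv: "hinner H z (vec a) = 0" for a
    using all[of a] u v by (simp add: z_def inner_simps vec_in)
  obtain s where s: "(\<lambda>n. hdist H (vec (s n)) z) \<longlonglongrightarrow> 0" by (rule vec_dense[OF z])
  have "(\<lambda>n. hinner H (vec (s n)) z) \<longlonglongrightarrow> hinner H z z" by (rule tendsto_hinner[OF vec_in z z s])
  moreover have "hinner H (vec (s n)) z = 0" for n using inner_commute[OF z vec_in] zv by simp
  ultimately have "hinner H z z = 0" by (simp add: LIMSEQ_const_iff)
  then have "z = hzero H" by (rule inner_eq_zero[OF z])
  then show ?thesis using eq_if_diff_zero[OF u v] by (simp add: z_def)
qed

lemma distinct_characters_orthogonal:
  assumes w: "w \<in> hcarrier H" "rep h w = hscale H (transported y n h) w"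
    and m: "active m" and h: "h \<in> M" and ne: "transported y n h \<noteq> transported y m h"
  shows "hinner H w (vec m) = 0"
proof -
  have "transported y n h * hinner H w (vec m) = hinner H (rep h w) (vec m)"
    using w by (simp add: inner_simps vec_in)
  also have "\<dots> = hinner H w (rep (star h) (vec m))" by (rule hinner_gns_rep[OF w(1) vec_in])
  also have "\<dots> = transported y m h * hinner H w (vec m)"
    using rep_eigen[OF m star_in[OF h]] transported_star[OF y_in _ h, of m] m w(1)
    by (simp add: inner_simps vec_in active_def)
  finally show ?thesis using ne by simp
qed

text \<open>Multiplicity one: \<open>w\<close> and its component along \<open>\<pi>(n)\<xi>\<close> have the same inner products with all the
  \<open>\<pi>(m)\<xi>\<close>, which are either parallel to \<open>\<pi>(n)\<xi>\<close> or orthogonal to both.\<close>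

lemma eigenvector_parallel:
  assumes n: "active n" and w: "w \<in> hcarrier H" "\<And>h. h \<in> M \<Longrightarrow> rep h w = hscale H (transported y n h) w"
  obtains c where "w = hscale H c (vec n)"
proof -
  define c where "c = hinner H w (vec n) / hinner H (vec n) (vec n)"
  have nn0: "hinner H (vec n) (vec n) \<noteq> 0"
    using n by (simp add: hinner_vec rho_M normalizing_star_mult active_def)
  have "w = hscale H c (vec n)"
  proof (rule vec_separating)
    fix m assume m: "active m"
    show "hinner H w (vec m) = hinner H (hscale H c (vec n)) (vec m)"
    proof (cases "\<forall>h\<in>M. transported y n h = transported y m h")
      case True
      then obtain d where "vec m = hscale H d (vec n)" using same_character_parallel[OF n m] by blast
      then show ?thesis using nn0 w(1) by (simp add: inner_simps vec_in c_def)
    next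
      case False
      then obtain h where h: "h \<in> M" "transported y n h \<noteq> transported y m h" by blast
      have "hinner H w (vec m) = 0" by (rule distinct_characters_orthogonal[OF w(1) w(2)[OF h(1)] m h])
      moreover have "hinner H (vec n) (vec m) = 0"
        by (rule distinct_characters_orthogonal[OF vec_in rep_eigen[OF n h(1)] m h])
      ultimately show ?thesis by (simp add: inner_simps vec_in)
    qed
  qed (simp_all add: w inner_simps vec_in)
  then show ?thesis by (rule that)
qed

definition M_invariant :: "(nat \<Rightarrow> 'a) set set \<Rightarrow> bool"
  where "M_invariant S \<longleftrightarrow> closed_subspace H S \<and> (\<forall>h\<in>M. \<forall>u\<in>S. rep h u \<in> S)"

lemma M_invariantD:
  assumes "M_invariant S"
  shows "\<And>u. u \<in> S \<Longrightarrow> u \<in> hcarrier H" "hzero H \<in> S" "\<And>u v. u \<in> S \<Longrightarrow> v \<in> S \<Longrightarrow> hadd H u v \<in> S"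
    "\<And>c u. u \<in> S \<Longrightarrow> hscale H c u \<in> S" "\<And>h u. h \<in> M \<Longrightarrow> u \<in> S \<Longrightarrow> rep h u \<in> S" "closed_subspace H S"
  using assms by (auto simp: M_invariant_def closed_subspace_def)

text \<open>As \<open>M\<close> is self-adjoint, the projection onto \<open>S\<close> commutes with \<open>M\<close>. It maps \<open>\<pi>(n)\<xi>\<close> to a joint
  eigenvector with the same character, hence to a multiple of \<open>\<pi>(n)\<xi>\<close>, and so to 0 if that vector
  is not in \<open>S\<close>.\<close>

lemma M_invariant_dichotomy:
  assumes S: "M_invariant S" and n: "active n" and nS: "vec n \<notin> S" and w: "w \<in> S"
  shows "hinner H (vec n) w = 0" "hinner H w (vec n) = 0"
proof -
  note SD = M_invariantD[OF S]
  obtain v where v: "v \<in> S" "\<And>w. w \<in> S \<Longrightarrow> hinner H (vec n) w = hinner H v w"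
    by (rule orthogonal_projection[OF SD(6) vec_in[of n]]) blast
  have vH: "v \<in> hcarrier H" by (rule SD(1)[OF v(1)])
  have "rep h v = hscale H (transported y n h) v" if h: "h \<in> M" for h
  proof (rule eq_if_diff_zero)
    let ?z = "hadd H (rep h v) (hscale H (- 1) (hscale H (transported y n h) v))"
    have zS: "?z \<in> S" by (intro SD v h)
    have zH: "?z \<in> hcarrier H" by (rule SD(1)[OF zS])
    have "hinner H (rep h v) ?z = hinner H v (rep (star h) ?z)" by (rule hinner_gns_rep[OF vH zH])
    also have "\<dots> = hinner H (vec n) (rep (star h) ?z)"
      by (rule v(2)[symmetric]) (intro SD star_in h zS)
    also have "\<dots> = hinner H (rep h (vec n)) ?z" by (rule hinner_gns_rep[OF vec_in zH, symmetric])
    also have "\<dots> = transported y n h * hinner H v ?z"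
      using rep_eigen[OF n h] v(2)[OF zS] by (simp only: inner_scale_left[OF vec_in zH])
    finally have eq: "hinner H (rep h v) ?z = transported y n h * hinner H v ?z" .
    have "hinner H ?z ?z = hinner H (rep h v) ?z + hinner H (hscale H (- 1) (hscale H (transported y n h) v)) ?z"
      by (rule inner_add_left) (intro gns_rep_in scale_closed vH zH)+
    also have "hinner H (hscale H (- 1) (hscale H (transported y n h) v)) ?z = - (transported y n h * hinner H v ?z)"
      using zH vH by (simp only: inner_scale_left scale_closed) simp
    finally have "hinner H ?z ?z = 0" by (simp only: eq) simp
    then show "?z = hzero H" by (rule inner_eq_zero[OF zH])
  qed (intro gns_rep_in scale_closed vH)+
  then obtain c where c: "v = hscale H c (vec n)" by (rule eigenvector_parallel[OF n vH])
  have "c = 0"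
  proof (rule ccontr)
    assume "c \<noteq> 0"
    then have "vec n = hscale H (1 / c) v" by (simp add: c scale_scale vec_in scale_one)
    then show False using SD(4)[OF v(1)] nS by simp
  qed
  then show 1: "hinner H (vec n) w = 0"
    using v(2)[OF w] by (simp add: c inner_scale_left vec_in SD(1)[OF w])
  show "hinner H w (vec n) = 0" using inner_commute[OF vec_in SD(1)[OF w], of n] 1 by simp
qed

lemma M_invariant_subset:
  assumes S: "M_invariant S" and T: "M_invariant T"
    and sub: "\<And>n. active n \<Longrightarrow> vec n \<in> S \<Longrightarrow> vec n \<in> T"
  shows "S \<subseteq> T"
proof
  fix u assume u: "u \<in> S"
  have uH: "u \<in> hcarrier H" by (rule M_invariantD(1)[OF S u])
  obtain v where v: "v \<in> T" "\<And>w. w \<in> T \<Longrightarrow> hinner H u w = hinner H v w"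
    by (rule orthogonal_projection[OF M_invariantD(6)[OF T] uH]) blast
  have "u = v"
  proof (rule vec_separating[OF uH M_invariantD(1)[OF T v(1)]])
    fix n assume n: "active n"
    show "hinner H u (vec n) = hinner H v (vec n)"
    proof (cases "vec n \<in> T")
      case True then show ?thesis by (rule v(2))
    next
      case False
      then have "vec n \<notin> S" using sub n by blast
      then show ?thesis
        using M_invariant_dichotomy(2)[OF S n _ u] M_invariant_dichotomy(2)[OF T n False v(1)] by simp
    qed
  qed
  then show "u \<in> T" using v(1) by simp
qed

lemma bounded_linear_state:
  assumes "state \<psi>"
  shows "bounded_linear \<psi>"
proof (rule bounded_linear_intro[where K=1])
  show "\<psi> (r *\<^sub>R a) = r *\<^sub>R \<psi> a" for r a
    using state_scaleR[OF assms, of r a] scaleR_conv_of_real[of r "\<psi> a"] by simp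
qed (simp_all add: assms state_add state_contractive)

theorem invariant_subspaces_nested:
  assumes B: "M \<subseteq> B" "dirichlet B"
    and S: "S \<in> invariant_subspaces H (rep ` B)" and T: "T \<in> invariant_subspaces H (rep ` B)"
  shows "S \<subseteq> T \<or> T \<subseteq> S"
proof (rule ccontr)
  assume not: "\<not> ?thesis"
  have MS: "M_invariant S" and MT: "M_invariant T"
    using S T B(1) by (auto simp: invariant_subspaces_def M_invariant_def)
  obtain n where n: "active n" "vec n \<in> S" "vec n \<notin> T" using M_invariant_subset[OF MS MT] not by blast
  obtain m where m: "active m" "vec m \<in> T" "vec m \<notin> S" using M_invariant_subset[OF MT MS] not by blast
  have nm: "normalizing n" "normalizing m" using n m by (simp_all add: active_def)
  have b1: "\<rho> (star m * (b * n)) = 0" if "b \<in> B" for b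
  proof -
    have "rep b (vec n) \<in> S" using S n(2) that by (auto simp: invariant_subspaces_def)
    then have "hinner H (rep b (vec n)) (vec m) = 0" by (rule M_invariant_dichotomy(2)[OF MS m(1,3)])
    then show ?thesis by (simp add: gns_rep_vec hinner_vec)
  qed
  have b2: "\<rho> (star m * (star b * n)) = 0" if "b \<in> B" for b
  proof -
    have "rep b (vec m) \<in> T" using T m(2) that by (auto simp: invariant_subspaces_def)
    then have "hinner H (rep b (vec m)) (vec n) = 0" by (rule M_invariant_dichotomy(2)[OF MT n(1,3)])
    then have "\<rho> (star n * (b * m)) = 0" by (simp add: gns_rep_vec hinner_vec)
    then have "\<rho> (star (star n * (b * m))) = 0" by (simp add: state_star[OF state])
    then show ?thesis by (simp add: star_mult star_star mult.assoc)
  qed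
  have "bounded_linear (\<lambda>a. \<rho> (star m * (a * n)))"
    by (rule bounded_linear_compose[OF bounded_linear_state[OF state]],
        rule bounded_linear_compose[OF bounded_linear_mult_right bounded_linear_mult_left])
  then have "closed {a. \<rho> (star m * (a * n)) = 0}"
    by (intro closed_Collect_eq linear_continuous_on continuous_on_const)
  moreover have "{a + star b | a b. a \<in> B \<and> b \<in> B} \<subseteq> {a. \<rho> (star m * (a * n)) = 0}"
    by (auto simp: ring_distribs state_add[OF state] b1 b2)
  ultimately have "closure {a + star b | a b. a \<in> B \<and> b \<in> B} \<subseteq> {a. \<rho> (star m * (a * n)) = 0}"
    by (rule closure_minimal[rotated])
  then have "\<rho> (star m * ((m * star n) * n)) = 0" using B(2) by (auto simp: dirichlet_def)
  moreover have "\<rho> (star m * ((m * star n) * n)) = y ((star m * m) * (star n * n))"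
    by (simp only: mult.assoc[symmetric]) (simp add: rho_M mult.assoc normalizing_star_mult nm
        mult_in[OF normalizing_star_mult[OF nm(2)] normalizing_star_mult[OF nm(1)], unfolded mult.assoc])
  ultimately have "y (star m * m) * y (star n * n) = 0"
    by (simp add: char_mult[OF y_in] normalizing_star_mult nm)
  then show False using n m by (simp add: active_def)
qed

lemma closed_subspace_zero: "closed_subspace H {hzero H}"
  unfolding closed_subspace_def
proof (intro conjI allI ballI impI)
  show "{hzero H} \<subseteq> hcarrier H" by (simp add: zero_closed)
  fix u v c assume "u \<in> {hzero H}" "v \<in> {hzero H}"
  then show "hadd H u v \<in> {hzero H}" by (simp add: add_zero zero_closed)
next
  fix u c assume "u \<in> {hzero H}"
  then show "hscale H c u \<in> {hzero H}" by (simp add: hzero_vec hscale_vec)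
next
  fix s u assume u: "u \<in> hcarrier H" and s: "(\<forall>n. s n \<in> {hzero H}) \<and> (\<lambda>n. hdist H (s n) u) \<longlonglongrightarrow> 0"
  then have "s = (\<lambda>n. hzero H)" by auto
  with s have "hdist H (hzero H) u = 0" by (simp add: LIMSEQ_const_iff)
  then show "u \<in> {hzero H}" using hdist_zero_imp_eq[OF zero_closed u] by simp
qed simp

lemma closed_subspace_carrier: "closed_subspace H (hcarrier H)"
  by (simp add: closed_subspace_def zero_closed add_closed scale_closed)

theorem irreducible: "irreducible_representation UNIV H rep"
  unfolding irreducible_representation_def
proof (intro conjI representation_gns_rep)
  have "vec 1 \<noteq> hzero H" by (simp add: hzero_vec vec_eq_iff gns_seminorm_one[OF state])
  then show "hcarrier H \<noteq> {hzero H}" using vec_in by blast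
  show "invariant_subspaces H (range rep) = {{hzero H}, hcarrier H}"
  proof (intro equalityI subsetI)
    fix S assume "S \<in> {{hzero H}, hcarrier H}"
    moreover have "rep a (hzero H) = hzero H" for a by (simp add: hzero_vec gns_rep_vec)
    ultimately show "S \<in> invariant_subspaces H (range rep)"
      using closed_subspace_zero closed_subspace_carrier gns_rep_in by (auto simp: invariant_subspaces_def)
  next
    fix S assume S: "S \<in> invariant_subspaces H (range rep)"
    then have inv: "\<And>a u. u \<in> S \<Longrightarrow> rep a u \<in> S" and MS: "M_invariant S"
      by (auto simp: invariant_subspaces_def M_invariant_def)
    show "S \<in> {{hzero H}, hcarrier H}"
    proof (cases "vec 1 \<in> S")
      case True
      have "vec a \<in> S" for a using inv[OF True, of a] by (simp add: gns_rep_vec)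
      moreover have "M_invariant (hcarrier H)"
        by (simp add: M_invariant_def closed_subspace_carrier gns_rep_in)
      ultimately have "hcarrier H \<subseteq> S" by (intro M_invariant_subset[OF _ MS]) auto
      then show ?thesis using M_invariantD(1)[OF MS] by blast
    next
      case False
      have "u = hzero H" if u: "u \<in> S" for u
      proof (rule vec_separating)
        show uH: "u \<in> hcarrier H" by (rule M_invariantD(1)[OF MS u])
        fix n assume "active n"
        have "hinner H u (vec n) = hinner H u (rep n (vec 1))" by (simp add: gns_rep_vec)
        also have "\<dots> = hinner H (rep (star n) u) (vec 1)"
          using hinner_gns_rep[OF uH vec_in, of "star n" 1] by (simp add: star_star)
        also have "\<dots> = 0" by (rule M_invariant_dichotomy(2)[OF MS active_one False inv[OF u]])
        also have "\<dots> = hinner H (hzero H) (vec n)" by (simp add: inner_zero_left vec_in)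
        finally show "hinner H u (vec n) = hinner H (hzero H) (vec n)" .
      qed (rule zero_closed)
      then have "S = {hzero H}" using M_invariantD(2)[OF MS] by blast
      then show ?thesis by simp
    qed
  qed
qed

text \<open>Domination transfers null vectors from \<open>\<rho>\<close> to \<open>\<psi>\<close>. This gives \<open>\<psi>(hn) = y(h)\<psi>(n)\<close> for \<open>h\<close> in \<open>M\<close>. If
  \<open>n\<close> fixes \<open>y\<close>, then \<open>n - E(n)(y)\<close> is a null vector and determines \<open>\<psi>(n)\<close>; if \<open>n\<close> moves \<open>y\<close>, then
  \<open>\<psi>(hn)\<close> is also \<open>h(\<alpha>\<^sub>n(y))\<psi>(n)\<close>, and \<open>\<psi>(n) = 0\<close>.\<close>

lemma dominated_state_eq:
  assumes \<psi>: "state \<psi>" and t: "t > 0" and dom: "\<And>a. t * Re (\<psi> (star a * a)) \<le> Re (\<rho> (star a * a))"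
  shows "\<psi> = \<rho>"
proof
  have null: "gns_seminorm \<psi> a = 0" if "N a = 0" for a
  proof -
    have "t * Re (\<psi> (star a * a)) \<le> 0" using dom[of a] gns_seminorm_sq[OF state, of a] that by simp
    then have "Re (\<psi> (star a * a)) \<le> 0" using t by (simp add: mult_le_0_iff)
    then show ?thesis using state_Re_nonneg[OF \<psi>, of a] by (simp add: gns_seminorm_def)
  qed
  have null': "\<psi> (b * a) = 0" if "N a = 0" for a b
    using gns_Cauchy_Schwarz[OF \<psi>, of "star b" a] null[OF that] by (simp add: star_star)
  have char: "\<psi> (h * n) = y h * \<psi> n" if h: "h \<in> M" for h n
  proof -
    define g where "g = star h - cnj (y h) *\<^sub>C 1"
    have g: "g \<in> M" by (simp add: g_def M_intros h)
    have "y g = 0" by (simp add: g_def char_diff[OF y_in] char_scaleC[OF y_in] char_one[OF y_in] char_star[OF y_in] M_intros h)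
    then have "N g = 0" using char_star_mult[OF y_in g] by (simp add: gns_seminorm_def rho_M M_intros g)
    then have "\<psi> (star n * g) = 0" by (rule null')
    then have "\<psi> (star (star n * g)) = 0" by (simp add: state_star[OF \<psi>])
    also have "star (star n * g) = h * n - y h *\<^sub>C n"
      by (simp add: g_def star_simps left_diff_distrib mult_scaleC_left)
    finally show ?thesis by (simp add: state_diff[OF \<psi>] state_scaleC[OF \<psi>])
  qed
  show "\<psi> a = \<rho> a" for a
  proof (induction a rule: normalizer_induct)
    case closed
    show ?case by (intro closed_Collect_eq linear_continuous_on bounded_linear_state \<psi> state)
  next
    case zero show ?case by (simp add: state_zero[OF \<psi>] state_zero[OF state])
  next
    case (add a b) then show ?case by (simp add: state_add[OF \<psi>] state_add[OF state])
  next
    case (scale a c) then show ?case by (simp add: state_scaleC[OF \<psi>] state_scaleC[OF state])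
  next
    case (normalizing n)
    consider "\<not> active n" | "fixes_point n y" | h where "active n" "h \<in> M" "transported y n h \<noteq> y h"
      using normalizing by (auto simp: fixes_point_def active_def transported_def field_simps)
    then show ?case
    proof cases
      case 1
      then have "N n = 0" by (rule inactive[OF normalizing])
      then show ?thesis using state_norm_le[OF \<psi>, of n] state_norm_le[OF state, of n] null by simp
    next
      case 2
      have "\<psi> (1 * (n - y (E n) *\<^sub>C 1)) = 0" by (rule null'[OF fixing_seminorm[OF normalizing 2]])
      then have "\<psi> n = y (E n)" by (simp add: state_diff[OF \<psi>] state_scaleC[OF \<psi>] state_one[OF \<psi>])
      then show ?thesis by (simp add: point_state_def)
    next
      case 3
      have nul: "N (h * n - transported y n h *\<^sub>C n) = 0"
        using gns_seminorm_normalizer_eigen[OF y_in normalizing _ 3(2)] 3(1) by (simp add: active_def)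
      have "\<psi> (h * n) = transported y n h * \<psi> n"
        using null'[OF nul, of 1] by (simp add: state_diff[OF \<psi>] state_scaleC[OF \<psi>])
      then have 1: "\<psi> n = 0" using char[OF 3(2), of n] 3(3) by simp
      have "\<rho> (h * n) = transported y n h * \<rho> n"
        using state_norm_le[OF state, of "h * n - transported y n h *\<^sub>C n"] nul
        by (simp add: state_diff[OF state] state_scaleC[OF state])
      moreover have "\<rho> (h * n) = y h * \<rho> n"
        using 3(2) by (simp add: point_state_def E_left char_mult[OF y_in] E_in)
      ultimately show ?thesis using 1 3(3) by simp
    qed
  qed
qed

theorem pure: "pure_state \<rho>"
  unfolding pure_state_def
proof (intro conjI allI impI state)
  fix \<psi>1 \<psi>2 :: "'a \<Rightarrow> complex" and t :: real
  assume a: "state \<psi>1 \<and> state \<psi>2 \<and> 0 < t \<and> t < 1 \<and>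
    (\<forall>a. \<rho> a = complex_of_real t * \<psi>1 a + complex_of_real (1 - t) * \<psi>2 a)"
  then have Re: "Re (\<rho> a) = t * Re (\<psi>1 a) + (1 - t) * Re (\<psi>2 a)" for a by simp
  show "\<psi>1 = \<rho>"
    by (rule dominated_state_eq[of _ t]) (use a in \<open>auto simp: Re state_Re_nonneg\<close>)
  show "\<psi>2 = \<rho>"
    by (rule dominated_state_eq[of _ "1 - t"]) (use a in \<open>auto simp: Re state_Re_nonneg\<close>)
qed

end

section \<open>The norm formula\<close>

context cartan_pair
begin

lemma trivial_isotropy_pointI: "y \<in> trivial_isotropy_points M E \<Longrightarrow> trivial_isotropy_point M E y"
  by unfold_locales

text \<open>If the supremum \<open>c\<close> were too small, \<open>h = c\<^sup>2 - b\<^sup>*b\<close> would have a negative part \<open>m\<close> with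
  \<open>m h m = -w\<^sup>2 \<noteq> 0\<close>, and by density and faithfulness \<open>E(w\<^sup>2)\<close> would be positive at a point with trivial
  isotropy. There the vector \<open>\<pi>(m)\<xi>\<close> contradicts \<open>\<parallel>\<pi>(b)\<parallel> \<le> c\<close>.\<close>

theorem norm_eq_SUP_trivial_isotropy:
  "norm b = (SUP y\<in>trivial_isotropy_points M E.
      operator_norm (gns_space (point_state E y)) (gns_rep (point_state E y) b))"
proof -
  let ?Y = "trivial_isotropy_points M E"
  let ?op = "\<lambda>y. operator_norm (gns_space (point_state E y)) (gns_rep (point_state E y) b)"
  have gns: "gns (point_state E y)" if "y \<in> ?Y" for y
    using that by unfold_locales (simp add: trivial_isotropy_points_def state_point_state)
  have le: "?op y \<le> norm b" if "y \<in> ?Y" for y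
    by (rule gns.operator_norm_gns_rep_le[OF gns[OF that]])
  have ne: "?Y \<noteq> {}" using trivial_isotropy_dense[OF one_in] by auto
  define c where "c = (SUP y\<in>?Y. ?op y)"
  have opc: "?op y \<le> c" if "y \<in> ?Y" for y
    unfolding c_def by (rule cSUP_upper[OF that]) (use le in \<open>auto intro!: bdd_aboveI2\<close>)
  have op0: "?op y \<ge> 0" if "y \<in> ?Y" for y
  proof -
    interpret gns "point_state E y" by (rule gns[OF that])
    show ?thesis using seminorm_le_operator_norm[of b 1] N_nonneg[of b] by (simp add: gns_seminorm_one[OF state])
  qed
  obtain y0 where "y0 \<in> ?Y" using ne by blast
  then have c0: "c \<ge> 0" using opc op0 order_trans by blast
  define h where "h = c\<^sup>2 *\<^sub>R 1 - star b * b"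
  have sh: "star h = h" by (simp add: h_def star_simps)
  obtain m w where mw: "star m = m" "star w = w" "m * h * m = - (w * w)" "w = 0 \<Longrightarrow> square h"
    by (rule negative_part[OF sh]) blast
  have "E (w * w) = 0"
  proof (rule ccontr)
    assume "E (w * w) \<noteq> 0"
    then obtain y where y: "y \<in> ?Y" "y (E (w * w)) \<noteq> 0" using trivial_isotropy_dense[OF E_in] by blast
    interpret gns "point_state E y" by (rule gns[OF y(1)])
    have "N (b * m) \<le> c * N m"
      using seminorm_le_operator_norm[of b m] mult_right_mono[OF opc[OF y(1)] N_nonneg[of m]] by simp
    then have "(N (b * m))\<^sup>2 \<le> (c * N m)\<^sup>2" by (intro power_mono N_nonneg)
    then have "Re (point_state E y (star (b * m) * (b * m))) \<le> c\<^sup>2 * Re (point_state E y (star m * m))"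
      by (simp add: gns_seminorm_sq[OF state] power_mult_distrib)
    moreover have "w * w = star (b * m) * (b * m) - c\<^sup>2 *\<^sub>R (star m * m)"
      using mw(3) by (simp add: h_def star_mult mw(1) left_diff_distrib right_diff_distrib mult.assoc
          eq_neg_iff_add_eq_0 minus_equation_iff) (simp add: algebra_simps eq_neg_iff_add_eq_0)
    ultimately have "Re (point_state E y (w * w)) \<le> 0"
      by (simp add: state_diff[OF state] state_scaleR[OF state])
    moreover have "Re (point_state E y (star w * w)) \<ge> 0" "Im (point_state E y (star w * w)) = 0"
      by (simp_all add: state_Re_nonneg[OF state] state_Im_zero[OF state])
    ultimately have "point_state E y (w * w) = 0" by (simp add: mw(2) complex_eq_iff)
    then show False using y(2) by (simp add: point_state_def)
  qed
  then have "w = 0" using E_faithful[of w] mw(2) by simp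
  then have "positive h" using mw(4) by (simp add: positive_iff_square)
  then have "norm (star b * b) \<le> norm (c\<^sup>2 *\<^sub>R 1 :: 'a)"
    unfolding h_def by (rule positive_norm_mono[OF positive_star_mult_self])
  then have "(norm b)\<^sup>2 \<le> c\<^sup>2" by (simp add: cstar_identity)
  then have "norm b \<le> c" using c0 by (rule power2_le_imp_le)
  moreover have "c \<le> norm b" unfolding c_def by (rule cSUP_least[OF ne le])
  ultimately show ?thesis by (simp add: c_def)
qed

end

theorem corollary9:
  fixes A M :: "'b::unital_cstar_algebra set"
    and j :: "'b \<Rightarrow> 'a::unital_cstar_algebra"
    and E :: "'a \<Rightarrow> 'a"
  assumes "unital_operator_algebra A"
    and "cstar_cover A j"
    and "dirichlet (j ` A)"
    and "star_subalgebra M" and "abelian M" and "M \<subseteq> A"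
    and "cartan_subalgebra (j ` M)"
    and "faithful_conditional_expectation (j ` M) E"
  shows "(\<forall>y\<in>trivial_isotropy_points (j ` M) E.
      pure_state (point_state E y) \<and>
      irreducible_representation UNIV (gns_space (point_state E y)) (gns_rep (point_state E y)) \<and>
      nest_representation A (gns_space (point_state E y)) (\<lambda>a. gns_rep (point_state E y) (j a))) \<and>
    (\<forall>a\<in>A. norm a = (SUP y\<in>trivial_isotropy_points (j ` M) E.
      operator_norm (gns_space (point_state E y)) (gns_rep (point_state E y) (j a))))"
proof (intro conjI ballI)
  interpret cartan_pair "j ` M" E
    using assms(7,8) by unfold_locales (auto simp: cartan_subalgebra_def)
  (* The matrix norms of A agree with those of j A, so representations of j A pull back to A. *)
  have mn: "matrix_norm n (\<lambda>i k. j (a i k)) = matrix_norm n a" if "\<forall>i<n. \<forall>k<n. a i k \<in> A" for n a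
    using assms(2) that by (simp add: cstar_cover_def completely_isometric_on_def)
  have hom: "j (a + b) = j a + j b" "j (c *\<^sub>C a) = c *\<^sub>C j a" "j (a * b) = j a * j b" if "a \<in> A" "b \<in> A" for a b c
    using assms(2) that by (simp_all add: cstar_cover_def homomorphism_on_def linear_on_def)
  {
    fix y assume y: "y \<in> trivial_isotropy_points (j ` M) E"
    interpret trivial_isotropy_point "j ` M" E y by (rule trivial_isotropy_pointI[OF y])
    show "pure_state (point_state E y)" by (rule pure)
    show "irreducible_representation UNIV H rep" by (rule irreducible)
    have r: "representation UNIV H rep" by (rule representation_gns_rep)
    show "nest_representation A H (\<lambda>a. rep (j a))"
      unfolding nest_representation_def
    proof (intro conjI ballI)
      show "representation A H (\<lambda>a. rep (j a))"
        unfolding representation_def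
      proof (intro conjI ballI allI impI)
        show "hilbert_space H" by unfold_locales
        show "bounded_operator H (rep (j a))" for a by (rule bounded_operator_gns_rep)
        show "rep (j (a + b)) u = hadd H (rep (j a) u) (rep (j b) u)"
          if "a \<in> A" "b \<in> A" "u \<in> hcarrier H" for a b u
          using r that by (simp add: representation_def hom)
        show "rep (j (c *\<^sub>C a)) u = hscale H c (rep (j a) u)" if "a \<in> A" "u \<in> hcarrier H" for c a u
          using r that hom(2)[OF that(1) that(1)] by (simp add: representation_def)
        show "rep (j (a * b)) u = rep (j a) (rep (j b) u)" if "a \<in> A" "b \<in> A" "u \<in> hcarrier H" for a b u
          using r that by (simp add: representation_def hom)
        show "operator_matrix_norm H n (\<lambda>i k. rep (j (a i k))) \<le> matrix_norm n a"
          if "\<forall>i<n. \<forall>k<n. a i k \<in> A" for n a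
          using operator_matrix_norm_gns_rep_le[of n "\<lambda>i k. j (a i k)"] mn[OF that] by simp
      qed
      have img: "(\<lambda>a. rep (j a)) ` A = rep ` (j ` A)" by (simp add: image_image)
      fix S T assume "S \<in> invariant_subspaces H ((\<lambda>a. rep (j a)) ` A)" "T \<in> invariant_subspaces H ((\<lambda>a. rep (j a)) ` A)"
      then show "S \<subseteq> T \<or> T \<subseteq> S"
        unfolding img by (rule invariant_subspaces_nested[OF image_mono[OF assms(6)] assms(3)])
    qed
  }
  fix a assume "a \<in> A"
  then have "matrix_norm 1 (\<lambda>_ _. j a) = matrix_norm 1 (\<lambda>_ _. a)" by (intro mn) simp
  then have "norm a = norm (j a)" by (simp only: matrix_norm_1)
  then show "norm a = (SUP y\<in>trivial_isotropy_points (j ` M) E.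
      operator_norm (gns_space (point_state E y)) (gns_rep (point_state E y) (j a)))"
    using norm_eq_SUP_trivial_isotropy[of "j a"] by simp
qed

end
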